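(* Let $\mu$ be a partition and $n\ge\ell(\mu)$ a positive integer. Then the collapsing map $M\mapsto\rho(M)=(\rho_N(M),\rho_Q(M))$ restricted to $\mathrm{MLQ}(\mu,n)$ is a bijection \[\rho:\ \mathrm{MLQ}(\mu,n)\longrightarrow\bigcup_{\lambda}\mathrm{MLQ}_0(\lambda,n)\times\mathrm{SSYT}(\lambda',\mu'),\] the union being over partitions $\lambda$, and it satisfies $x^{M}=x^{\rho_N(M)}$ and $\operatorname{maj}(M)=\operatorname{charge}(\rho_Q(M))$ for all $M\in\mathrm{MLQ}(\mu,n)$.
   Context: Partitions and tableaux. For a partition $\lambda$, $\lambda'$ is its conjugate and $\ell(\lambda)$ its number of nonzero parts. Young diagrams are in French notation (row 1 at the bottom). A semistandard Young tableau (SSYT) has entries weakly increasing along rows (left to right) and strictly increasing up columns; its content is $(c_1,c_2,\dots)$, $c_i$ = number of entries $i$. $\mathrm{SSYT}(\lambda,\beta)$ is the set of SSYT of shape $\lambda$ and content $\beta$. The row reading word $\mathrm{rrw}(T)$ reads rows from top to bottom, each left to right. Binary matrices and multiline queues. $\mathcal M(L,n)$ is the set of tuples $B=(B_1,\dots,B_L)$ of subsets of $[n]$, drawn as an $L\times n$ grid with rows $1..L$ bottom to top and columns $1..n$ left to right, a ball in cell $(r,j)$ iff $j\in B_r$. Its weight is $x^B=\prod_{r}\prod_{b\in B_r}x_b$. For a partition $\lambda$ with $L=\lambda_1$ and $n\ge\ell(\lambda)$, $\mathrm{MLQ}(\lambda,n)=\{B\in\mathcal M(L,n):|B_j|=\lambda'_j\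 \forall j\}$. Binary matrices with empty top rows are identified with the tuple obtained by deleting those rows. The column word $\mathrm{cw}(B)$ scans columns left to right, each column top to bottom, recording the row number of each ball. Bracketing. For a word $w$ and $i\ge1$, $\mathrm{Par}_i(w)$ reads $w$ left to right writing "(" for each $i+1$ and ")" for each $i$, and iteratively matches a "(" with a ")" to its right when adjacent or separated only by matched parentheses; the remaining letters $i,i+1$ are unmatched. Major index. For $M\in\mathrm{MLQ}(\lambda,n)$, $L=\lambda_1$: for $r=L,\dots,2$, each unlabelled ball of row $r$ gets label $r$; then balls of row $r$, in decreasing label order (left to right among equal labels), are each paired with the first unlabelled ball of row $r-1$ weakly to the right, cyclically modulo $n$, which gets the same label; a pairing wraps if the lower ball is in a column strictly left of the upper ball. Unlabelled balls in row 1 get label 1. $\operatorname{maj}(M)=\sum(\ell(p)-r(p)+1)$ over wrapping pairings $p$, with $r(p)$ the row of the upper ball and $\ell(p)$ the label. $\mathrm{MLQ}_0(\lambda,n)=\{M\in\mathrm{MLQ}(\lambda,n):\operatorname{maj}(M)=0\}$. Charge. For a permutation $\tau$ of $[m]$, $\operatorname{charge}(\tau)=\sum(m-i)$ over $i\in[m-1]$ with $i$ left of $i+1$ in $\tau$. For a word $w$ with letters $1..k$ and weakly decreasing multiplicities, the first charge subword is found by locating the leftmost $k$, then cyclically to the right the next $k-1$, then $k-2$, …, down to $1$; these letters in positional order form a permutation $w^{(1)}$; remove and repeat to get $w^{(2)},\dots$; $\operatorname{charge}(w)=\sum_i\operatorname{charge}(w^{(i)})$. For a SSYT $T$ with such content,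 $\operatorname{charge}(T)=\operatorname{charge}(\mathrm{rrw}(T))$. Collapsing. For $B\in\mathcal M(L,n)$ and $1\le i<L$, $e_i^\star(B)$ moves every ball of row $i+1$ whose letter $i+1$ is unmatched in $\mathrm{Par}_i(\mathrm{cw}(B))$ down to row $i$ in the same column. Products act right to left; $e^\star_{[a,b]}=e^\star_ae^\star_{a+1}\cdots e^\star_b$; $\rho_N(B)=e^\star_{[1,L-1]}\cdots e^\star_{[1,2]}e^\star_{[1,1]}(B)$. With $N^{(k)}$ the bottom $k$ rows of $e^\star_{[1,k-1]}\cdots e^\star_{[1,1]}(B)$ ($N^{(0)}$ empty), $\rho_Q(B)$ is the filling whose row $r$ contains $|N^{(i)}_r|-|N^{(i-1)}_r|$ entries $i$ for each $i=1,\dots,L$ (with $|N^{(i-1)}_i|=0$), in weakly increasing order. $\rho(B)=(\rho_N(B),\rho_Q(B))$. *)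

theory Defs
  imports Main "HOL-Library.Multiset"
begin

definition is_partition :: "nat list \<Rightarrow> bool" where
  "is_partition la \<longleftrightarrow> sorted (rev la) \<and> 0 \<notin> set la"

definition first_part :: "nat list \<Rightarrow> nat" where
  "first_part la = (if la = [] then 0 else hd la)"

definition conj_part :: "nat list \<Rightarrow> nat list" where
  "conj_part la = map (\<lambda>j. card {i. i < length la \<and> j \<le> la ! i}) [1..<first_part la + 1]"

text \<open>A binary matrix B = (B_1,...,B_L) is a list of sets of columns; row r (1-based) is
  B ! (r - 1).\<close>
definition binmat :: "nat \<Rightarrow> nat \<Rightarrow> nat set list set" where
  "binmat L n = {B. length B = L \<and> (\<forall>r < L. B ! r \<subseteq> {1..n})}"

text \<open>The monomial x^B, represented as a multiset of variable indices.\<close>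
definition xmon :: "nat set list \<Rightarrow> nat multiset" where
  "xmon B = (\<Sum>r < length B. mset_set (B ! r))"

text \<open>Deleting empty top rows (identification of binary matrices).\<close>
definition strip_rows :: "nat set list \<Rightarrow> nat set list" where
  "strip_rows B = rev (dropWhile (\<lambda>S. S = {}) (rev B))"

definition MLQ :: "nat list \<Rightarrow> nat \<Rightarrow> nat set list set" where
  "MLQ la n = {B \<in> binmat (first_part la) n.
                 \<forall>j \<in> {1..first_part la}. card (B ! (j - 1)) = conj_part la ! (j - 1)}"

text \<open>Column word with ball positions: list of (column, row) pairs, columns left to right,
  each column top to bottom; the column word itself is the list of rows.\<close>
definition cwp :: "nat \<Rightarrow> nat set list \<Rightarrow> (nat \<times> nat) list" where
  "cwp n B = concat (map (\<lambda>j. map (\<lambda>r. (j, r))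
                 (filter (\<lambda>r. j \<in> B ! (r - 1)) (rev [1..<length B + 1]))) [1..<n + 1])"

definition cw :: "nat \<Rightarrow> nat set list \<Rightarrow> nat list" where
  "cw n B = map snd (cwp n B)"

text \<open>Bracketing Par_i: reading left to right, i+1 is "(" and i is ")"; each ")" is matched
  with the nearest unmatched "(" to its left (stack scan). The result is the list of
  columns of the unmatched letters i+1.\<close>
fun par_stack :: "nat \<Rightarrow> (nat \<times> nat) list \<Rightarrow> nat list \<Rightarrow> nat list" where
  "par_stack i [] s = s"
| "par_stack i ((j, r) # w) s =
     (if r = Suc i then par_stack i w (j # s)
      else if r = i then par_stack i w (drop 1 s)
      else par_stack i w s)"

definition unmatched_cols :: "nat \<Rightarrow> nat \<Rightarrow> nat set list \<Rightarrow> nat set" where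
  "unmatched_cols n i B = set (par_stack i (cwp n B) [])"

definition estar :: "nat \<Rightarrow> nat \<Rightarrow> nat set list \<Rightarrow> nat set list" where
  "estar n i B = (let U = unmatched_cols n i B in
                    B[i - 1 := B ! (i - 1) \<union> U, i := B ! i - U])"

definition estar_int :: "nat \<Rightarrow> nat \<Rightarrow> nat \<Rightarrow> nat set list \<Rightarrow> nat set list" where
  "estar_int n a b B = foldr (estar n) [a..<b + 1] B"

fun collapse_pre :: "nat \<Rightarrow> nat \<Rightarrow> nat set list \<Rightarrow> nat set list" where
  "collapse_pre n 0 B = B"
| "collapse_pre n (Suc k) B = estar_int n 1 k (collapse_pre n k B)"

definition rhoN :: "nat \<Rightarrow> nat set list \<Rightarrow> nat set list" where
  "rhoN n B = collapse_pre n (length B) B"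

definition Ncard :: "nat \<Rightarrow> nat set list \<Rightarrow> nat \<Rightarrow> nat \<Rightarrow> nat" where
  "Ncard n B i r = (if 1 \<le> r \<and> r \<le> i then card (collapse_pre n i B ! (r - 1)) else 0)"

text \<open>Tableaux: list of rows, row 1 (bottom) first; each row a list of entries.\<close>
definition strip_tab :: "nat list list \<Rightarrow> nat list list" where
  "strip_tab T = rev (dropWhile (\<lambda>x. x = []) (rev T))"

definition rhoQ :: "nat \<Rightarrow> nat set list \<Rightarrow> nat list list" where
  "rhoQ n B = strip_tab (map (\<lambda>r. concat (map (\<lambda>i. replicate (Ncard n B i r - Ncard n B (i - 1) r) i)
                                         [1..<length B + 1]))
                         [1..<length B + 1])"

definition rho :: "nat \<Rightarrow> nat set list \<Rightarrow> nat set list \<times> nat list list" where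
  "rho n B = (strip_rows (rhoN n B), rhoQ n B)"

definition SSYT :: "nat list \<Rightarrow> nat list \<Rightarrow> nat list list set" where
  "SSYT la beta = {T. map length T = la
      \<and> (\<forall>r < length T. sorted (T ! r))
      \<and> (\<forall>r c. Suc r < length T \<and> c < length (T ! Suc r) \<longrightarrow> T ! r ! c < T ! Suc r ! c)
      \<and> (\<forall>x \<in> set (concat T). 1 \<le> x)
      \<and> (\<forall>i \<ge> 1. count (mset (concat T)) i = (if i \<le> length beta then beta ! (i - 1) else 0))}"

definition rrw :: "nat list list \<Rightarrow> nat list" where
  "rrw T = concat (rev T)"

definition charge_perm :: "nat list \<Rightarrow> nat" where
  "charge_perm tau = (\<Sum>i \<in> {i. 1 \<le> i \<and> i < length tau \<and>
        (\<exists>a b. a < b \<and> b < length tau \<and> tau ! a = i \<and> tau ! b = Suc i)}. length tau - i)"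

definition next_pos :: "nat list \<Rightarrow> nat \<Rightarrow> nat \<Rightarrow> nat" where
  "next_pos w p j = hd (filter (\<lambda>q. w ! q = j) ([Suc p..<length w] @ [0..<Suc p]))"

fun charge_chain :: "nat list \<Rightarrow> nat \<Rightarrow> nat \<Rightarrow> nat list" where
  "charge_chain w p 0 = []"
| "charge_chain w p (Suc j) = (let q = next_pos w p (Suc j) in q # charge_chain w q j)"

definition charge_positions :: "nat list \<Rightarrow> nat set" where
  "charge_positions w = (let k = Max (set w);
                             p = hd (filter (\<lambda>q. w ! q = k) [0..<length w])
                         in set (p # charge_chain w p (k - 1)))"

fun charge_fuel :: "nat \<Rightarrow> nat list \<Rightarrow> nat" where
  "charge_fuel 0 w = 0"
| "charge_fuel (Suc f) w = (if w = [] then 0 else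
      charge_perm (nths w (charge_positions w)) + charge_fuel f (nths w (- charge_positions w)))"

definition charge_word :: "nat list \<Rightarrow> nat" where
  "charge_word w = charge_fuel (length w) w"

definition charge_tab :: "nat list list \<Rightarrow> nat" where
  "charge_tab T = charge_word (rrw T)"

text \<open>Pair the balls of row r (list ord of (column, label)) in order with the first not yet
  labelled ball of the lower row (set low) weakly to the right cyclically mod n; returns the
  labels of the lower row and the accumulated maj contribution of wrapping pairings.\<close>
fun pair_step :: "nat \<Rightarrow> nat \<Rightarrow> nat set \<Rightarrow> (nat \<times> nat) list \<Rightarrow> (nat \<Rightarrow> nat option) \<Rightarrow> nat
                   \<Rightarrow> (nat \<Rightarrow> nat option) \<times> nat" where
  "pair_step n r low [] m acc = (m, acc)"
| "pair_step n r low ((c, l) # bs) m acc =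
     (let d = hd (filter (\<lambda>d. d \<in> low \<and> m d = None) ([c..<n + 1] @ [1..<c]))
      in pair_step n r low bs (m(d \<mapsto> l)) (acc + (if d < c then l + 1 - r else 0)))"

text \<open>maj_aux n L B r lab: r is the current row (1-based), lab the labels already given to
  balls of row r by the pairing from row r+1.\<close>
fun maj_aux :: "nat \<Rightarrow> nat \<Rightarrow> nat set list \<Rightarrow> nat \<Rightarrow> (nat \<Rightarrow> nat option) \<Rightarrow> nat" where
  "maj_aux n L B (Suc (Suc k)) lab =
     (let r = Suc (Suc k);
          full = (\<lambda>c. case lab c of Some l \<Rightarrow> l | None \<Rightarrow> r);
          ord = concat (map (\<lambda>l. map (\<lambda>c. (c, l))
                   (filter (\<lambda>c. c \<in> B ! Suc k \<and> full c = l) [1..<n + 1])) (rev [r..<L + 1]));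
          res = pair_step n r (B ! k) ord Map.empty 0
      in snd res + maj_aux n L B (Suc k) (fst res))"
| "maj_aux n L B _ lab = 0"

definition maj :: "nat \<Rightarrow> nat set list \<Rightarrow> nat" where
  "maj n M = maj_aux n (length M) M (length M) Map.empty"

definition MLQ0 :: "nat list \<Rightarrow> nat \<Rightarrow> nat set list set" where
  "MLQ0 la n = {M \<in> MLQ la n. maj n M = 0}"

end

theory Submission
  imports Defs
begin

text \<open>A binary matrix is its column word together with the columns of the letters, and the operators
  \<open>estar\<close> change only the letters: they are the maximal raising operators on words. These commute with
  Knuth equivalence. On the row word of a tableau \<open>T\<close> collapsing can be computed by hand, and \<open>\<rho>\<^sub>Q\<close>
  returns \<open>T\<close>; as every word is Knuth equivalent to the row word of a tableau, the column word of \<open>M\<close> is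
  equivalent to that of \<open>\<rho>\<^sub>Q(M)\<close>. Injectivity follows because along equivalent words the raising steps can
  be undone in the same way, and surjectivity because the steps from the row word of \<open>Q\<close> to the highest
  weight word lift along a Knuth equivalence to the column word of \<open>N\<close>. Finally both \<open>maj\<close> and \<open>charge\<close> are
  the same sum of numbers of unmatched letters in iterated Lascoux-Schuetzenberger reflections of a
  word, which is a Knuth invariant and vanishes exactly on highest weight words.\<close>

section \<open>Unmatched parentheses\<close>

text \<open>The equality of \<open>maj\<close> and charge is the delicate point: both match letters
  i + 1 cyclically with letters i, but in different orders. The pairing procedure goes row by row
  and takes balls by label; charge goes subword by subword. What reconciles them is that, when there
  are at least as many letters i as letters i + 1, the set of letters i reached and the number of
  wraps do not depend on the order in which the letters i + 1 choose. The set consists of the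
  letters i of the reflected word, and the number of wraps is the number of unmatched letters i + 1.
  The weights come from counting by thresholds: a wrapping pairing with label x between rows i + 1
  and i is counted once for every l with i < l \<le> x, and a letter j left of j + 1 in a charge
  subword with largest letter k once for every l with j < l \<le> k. Both counts give the double sum
  \<open>refl_charge\<close>. The family \<open>rematch\<close> has a free parameter so that
  collapse, its inverse and reflection share one proof of compatibility with Knuth
  equivalence.\<close>

text \<open>In the bracketing for \<open>i\<close>, a letter \<open>i\<close> is a closing and a letter \<open>i + 1\<close> an opening parenthesis;
  \<open>closes\<close> and \<open>opens\<close> count the unmatched ones. The recursions process a word from its right end.\<close>

fun closes :: "nat \<Rightarrow> nat list \<Rightarrow> nat" where
  "closes i [] = 0"
| "closes i (x # w) = (if x = i then Suc (closes i w) else if x = Suc i then closes i w - 1 else closes i w)"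

fun opens :: "nat \<Rightarrow> nat list \<Rightarrow> nat" where
  "opens i [] = 0"
| "opens i (x # w) = (if x = Suc i \<and> closes i w = 0 then Suc (opens i w) else opens i w)"

abbreviation free :: "nat \<Rightarrow> nat list \<Rightarrow> nat" where
  "free i w \<equiv> closes i w + opens i w"

text \<open>The unmatched letters form a word \<open>i\<^sup>x (i + 1)\<^sup>y\<close>; it is replaced by \<open>i\<close> repeated \<open>x + y - a\<close> times followed by
  \<open>i + 1\<close> repeated \<open>a\<close> times. The value \<open>a = 0\<close> gives the collapsing operator, \<open>a = x\<close> the Lascoux-Schuetzenberger
  reflection, and \<open>a = y\<close> restores the word after a collapse. Only \<open>a \<le> x + y\<close> is meaningful.\<close>

fun rematch :: "nat \<Rightarrow> nat \<Rightarrow> nat list \<Rightarrow> nat list" where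
  "rematch i a [] = []"
| "rematch i a (x # w) =
     (if x = i \<or> (x = Suc i \<and> closes i w = 0)
      then if a \<le> free i w then i # rematch i a w else Suc i # rematch i (a - 1) w
      else x # rematch i a w)"

text \<open>Only unmatched openings of \<open>u\<close> meet unmatched closings of \<open>v\<close>;
  the truncated subtraction is what survives of the latter.\<close>

lemma closes_append: "closes i (u @ v) = closes i u + (closes i v - opens i u)"
  by (induction u) auto

lemma opens_append: "opens i (u @ v) = opens i v + (opens i u - closes i v)"
  by (induction u) (auto simp: closes_append)

lemma length_rematch [simp]: "length (rematch i a w) = length w"
  by (induction i a w rule: rematch.induct) auto


text \<open>In the rewritten word of free letters every i precedes every i + 1, so no new pair
  arises and the old pairs remain.\<close>

lemma free_rematch: "a \<le> free i w \<Longrightarrow> closes i (rematch i a w) = free i w - a \<and> opens i (rematch i a w) = a"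
proof (induction w arbitrary: a)
  case (Cons x w)
  consider (low) "x = i \<or> (x = Suc i \<and> closes i w = 0)" "a \<le> free i w"
    | (high) "x = i \<or> (x = Suc i \<and> closes i w = 0)" "a = Suc (free i w)"
    | (fixed) "x \<noteq> i" "\<not> (x = Suc i \<and> closes i w = 0)" "a \<le> free i w"
    using Cons.prems by (auto simp: le_Suc_eq split: if_splits)
  then show ?case
  proof cases
    case low
    then show ?thesis using Cons.IH[of a] by auto
  next
    case high
    then show ?thesis using Cons.IH[of "free i w"] by auto
  next
    case fixed
    then have "closes i (rematch i a w) = free i w - a \<and> opens i (rematch i a w) = a" using Cons.IH by blast
    moreover have "a \<le> free i (x # w)" by fact
    ultimately show ?thesis using fixed by auto
  qed
qed simp

lemmas closes_rematch = free_rematch[THEN conjunct1] and opens_rematch = free_rematch[THEN conjunct2]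

lemma rematch_opens [simp]: "rematch i (opens i w) w = w"
  by (induction w) auto

text \<open>Rewriting keeps the set of unmatched positions, and the result depends only on that set
  and the parameter. A collapse can therefore be undone once the number of its changed letters is
  known.\<close>

lemma rematch_rematch: "a \<le> free i w \<Longrightarrow> b \<le> free i w \<Longrightarrow> rematch i b (rematch i a w) = rematch i b w"
proof (induction w arbitrary: a b)
  case (Cons x w)
  let ?U = "free i w"
  have "\<not> (x = i \<or> (x = Suc i \<and> closes i w = 0)) \<Longrightarrow>
      a \<le> ?U \<and> b \<le> ?U \<and> (x = Suc i \<longrightarrow> a < ?U \<and> b < ?U)"
    using Cons.prems by (auto split: if_splits)
  then consider (cond) "x = i \<or> (x = Suc i \<and> closes i w = 0)"
    | (fixed) "x \<noteq> i" "\<not> (x = Suc i \<and> closes i w = 0)" "a \<le> ?U" "b \<le> ?U"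
      "x = Suc i \<longrightarrow> a < ?U \<and> b < ?U"
    by blast
  then show ?case
  proof cases
    case cond
    then have ab: "a \<le> Suc ?U" "b \<le> Suc ?U" using Cons.prems by (auto split: if_splits)
    define a' where "a' = min a ?U"
    define b' where "b' = min b ?U"
    have tra: "rematch i a (x # w) = (if a \<le> ?U then i else Suc i) # rematch i a' w"
      using cond ab by (auto simp: a'_def min_def le_Suc_eq)
    have a': "a' \<le> ?U" "b' \<le> ?U" by (auto simp: a'_def b'_def)
    have l: "closes i (rematch i a' w) = ?U - a'" "opens i (rematch i a' w) = a'"
      using a' free_rematch by auto
    have "\<not> a \<le> ?U \<Longrightarrow> a' = ?U" by (simp add: a'_def)
    then have "rematch i b (rematch i a (x # w)) = (if b \<le> ?U then i else Suc i) # rematch i b' (rematch i a' w)"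
      unfolding tra using l a' ab by (auto simp: b'_def min_def le_Suc_eq)
    also have "\<dots> = rematch i b (x # w)"
      using cond ab Cons.IH[OF a'] by (auto simp: b'_def min_def le_Suc_eq)
    finally show ?thesis .
  next
    case fixed
    then have "closes i (rematch i a w) = ?U - a" "opens i (rematch i a w) = a" using free_rematch by auto
    then show ?thesis using fixed Cons.IH[of a b] by auto
  qed
qed simp

text \<open>Here \<open>m\<close> openings of \<open>u\<close> are closed by letters of
  \<open>v\<close>. The \<open>a\<close> letters i + 1 go to the last free positions, so
  \<open>v\<close> takes as many as it has free letters left; the remaining \<open>a - b\<close> go
  to \<open>u\<close>, where the \<open>m\<close> openings closed by \<open>v\<close> also count as
  free and must stay i + 1.\<close>

lemma rematch_append:
  assumes "a \<le> free i (u @ v)"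
  defines "m \<equiv> min (opens i u) (closes i v)"
  defines "b \<equiv> min a (free i v - m)"
  shows "rematch i a (u @ v) = rematch i (m + a - b) u @ rematch i b v"
  using assms(1) unfolding m_def b_def
proof (induction u arbitrary: a)
  case Nil
  then show ?case by auto
next
  case (Cons x u)
  let ?m = "min (opens i u) (closes i v)" and ?b = "\<lambda>a m. min a (free i v - m)"
  have U: "free i (u @ v) = free i u + free i v - 2 * ?m"
    by (auto simp: closes_append opens_append)
  show ?case
  proof (cases "x = i \<or> (x = Suc i \<and> closes i (u @ v) = 0)")
    case c: True
    have m1: "x = Suc i \<Longrightarrow> min (opens i (x # u)) (closes i v) = ?m" "x = i \<Longrightarrow> opens i (x # u) = opens i u"
      using c by (auto simp: closes_append)
    have m: "min (opens i (x # u)) (closes i v) = ?m" using m1 c by auto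
    have c': "x = i \<or> (x = Suc i \<and> closes i u = 0)" using c by (auto simp: closes_append)
    show ?thesis
    proof (cases "a \<le> free i (u @ v)")
      case True
      then have "?m + a - ?b a ?m \<le> free i u" using U by (auto simp: min_def)
      then show ?thesis unfolding m using Cons.IH[OF True] c c' True by auto
    next
      case False
      then have a: "a = Suc (free i (u @ v))" using Cons.prems c by (auto split: if_splits)
      have e0: "?m + a - ?b a ?m = Suc (free i u)" using U unfolding a by (auto simp: min_def)
      have e1: "?m + (a - 1) - ?b (a - 1) ?m = free i u" using U unfolding a by (auto simp: min_def)
      have e2: "?b (a - 1) ?m = ?b a ?m" using U unfolding a by (auto simp: min_def)
      have "rematch i a ((x # u) @ v) = Suc i # rematch i (a - 1) (u @ v)" using c False by auto
      also have "rematch i (a - 1) (u @ v) = rematch i (free i u) u @ rematch i (?b a ?m) v"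
        using Cons.IH[of "a - 1"] e1 e2 a by (simp only:) simp
      also have "Suc i # rematch i (free i u) u @ rematch i (?b a ?m) v
          = rematch i (Suc (free i u)) (x # u) @ rematch i (?b a ?m) v" using c' by auto
      finally show ?thesis unfolding m e0 .
    qed
  next
    case nc: False
    then have a: "a \<le> free i (u @ v)" using Cons.prems by (auto split: if_splits)
    show ?thesis
    proof (cases "x = Suc i \<and> closes i u = 0")
      \<comment> \<open>\<open>x\<close> is open in \<open>u\<close> but closed by a letter of
        \<open>v\<close>: the number of crossing pairs grows by one, while the share of
        \<open>v\<close> stays the same.\<close>
      case True
      then have lv: "opens i u < closes i v" using nc by (auto simp: closes_append)
      have "a < free i (u @ v)" using Cons.prems True nc by (auto split: if_splits)
      then have "Suc (opens i u) + a - ?b a (Suc (opens i u)) = Suc (free i u)"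
        "opens i u + a - ?b a (opens i u) = free i u" "?b a (Suc (opens i u)) = ?b a (opens i u)"
        using U lv True  by (auto simp: min_def)
      then show ?thesis using Cons.IH[OF a] True lv nc by (auto simp: min_def)
    next
      case False
      then have "opens i (x # u) = opens i u" by auto
      moreover have "rematch i a ((x # u) @ v) = x # rematch i a (u @ v)" using nc by auto
      moreover have "rematch i k (x # u) = x # rematch i k u" for k using False nc by auto
      ultimately show ?thesis by (simp only: Cons.IH[OF a] append_Cons)
    qed
  qed
qed

section \<open>Knuth equivalence\<close>

inductive knuth :: "nat list \<Rightarrow> nat list \<Rightarrow> bool" where
  knuth_refl: "knuth w w"
| knuth_sym: "knuth v w \<Longrightarrow> knuth w v"
| knuth_trans: "knuth u v \<Longrightarrow> knuth v w \<Longrightarrow> knuth u w"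
| knuth_yzx: "x < y \<Longrightarrow> y \<le> z \<Longrightarrow> knuth (u @ [y, z, x] @ v) (u @ [y, x, z] @ v)"
| knuth_xzy: "x \<le> y \<Longrightarrow> y < z \<Longrightarrow> knuth (u @ [x, z, y] @ v) (u @ [z, x, y] @ v)"

lemma knuth_append: "knuth w w' \<Longrightarrow> knuth (u @ w @ v) (u @ w' @ v)"
proof (induction rule: knuth.induct)
  case (knuth_yzx x y z u' v')
  then show ?case using knuth.knuth_yzx[of x y z "u @ u'" "v' @ v"] by simp
next
  case (knuth_xzy x y z u' v')
  then show ?case using knuth.knuth_xzy[of x y z "u @ u'" "v' @ v"] by simp
qed (blast intro: knuth.intros)+

lemma knuth_mset: "knuth w w' \<Longrightarrow> mset w = mset w'"
  by (induction rule: knuth.induct) auto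

lemma knuth_triple_yzx: "x < y \<Longrightarrow> y \<le> z \<Longrightarrow> knuth [y, z, x] [y, x, z]"
  using knuth_yzx[of x y z "[]" "[]"] by simp

lemma knuth_triple_xzy: "x \<le> y \<Longrightarrow> y < z \<Longrightarrow> knuth [x, z, y] [z, x, y]"
  using knuth_xzy[of x y z "[]" "[]"] by simp

text \<open>A finite check, but the rewritten triples may be related by the other rule: (i+1)(i+1)i
  and (i+1)i(i+1) collapse to i(i+1)i and (i+1)ii.\<close>

lemma rematch_yzx:
  assumes "x < y" "y \<le> z"
  shows "closes i [y, z, x] = closes i [y, x, z] \<and> opens i [y, z, x] = opens i [y, x, z]"
    and "a \<le> free i [y, z, x] \<Longrightarrow> knuth (rematch i a [y, z, x]) (rematch i a [y, x, z])"
proof -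
  show "closes i [y, z, x] = closes i [y, x, z] \<and> opens i [y, z, x] = opens i [y, x, z]"
    using assms by auto
  assume "a \<le> free i [y, z, x]"
  then show "knuth (rematch i a [y, z, x]) (rematch i a [y, x, z])"
    using assms by (cases "x = i"; cases "x = Suc i"; cases "y = i"; cases "y = Suc i"; cases "z = i"; cases "z = Suc i")
       (auto simp: le_Suc_eq intro: knuth_refl knuth_triple_yzx knuth_triple_xzy knuth_triple_yzx[THEN knuth_sym] knuth_triple_xzy[THEN knuth_sym])
qed

lemma rematch_xzy:
  assumes "x \<le> y" "y < z"
  shows "closes i [x, z, y] = closes i [z, x, y] \<and> opens i [x, z, y] = opens i [z, x, y]"
    and "a \<le> free i [x, z, y] \<Longrightarrow> knuth (rematch i a [x, z, y]) (rematch i a [z, x, y])"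
proof -
  show "closes i [x, z, y] = closes i [z, x, y] \<and> opens i [x, z, y] = opens i [z, x, y]"
    using assms by auto
  assume "a \<le> free i [x, z, y]"
  then show "knuth (rematch i a [x, z, y]) (rematch i a [z, x, y])"
    using assms by (cases "x = i"; cases "x = Suc i"; cases "y = i"; cases "y = Suc i"; cases "z = i"; cases "z = Suc i")
       (auto simp: le_Suc_eq intro: knuth_refl knuth_triple_yzx knuth_triple_xzy knuth_triple_yzx[THEN knuth_sym] knuth_triple_xzy[THEN knuth_sym])
qed

text \<open>The surroundings see a factor only through its two counts, so both factors receive the
  same parameter \<open>b\<close> and the surroundings change alike. The last clause will show that
  a reflection leaves certain factors untouched.\<close>

lemma rematch_context:
  assumes sig: "closes i k = closes i k'" "opens i k = opens i k'"
  shows "closes i (u @ k @ v) = closes i (u @ k' @ v) \<and> opens i (u @ k @ v) = opens i (u @ k' @ v)"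
    and "a \<le> free i (u @ k @ v) \<Longrightarrow> \<exists>A b C. rematch i a (u @ k @ v) = A @ rematch i b k @ C \<and>
       rematch i a (u @ k' @ v) = A @ rematch i b k' @ C \<and> length A = length u \<and> length C = length v \<and>
       b \<le> free i k \<and> (opens i (u @ k @ v) \<le> a \<longrightarrow> opens i k \<le> b)"
proof -
  have kv: "closes i (k @ v) = closes i (k' @ v)" "opens i (k @ v) = opens i (k' @ v)"
    using sig by (auto simp: closes_append opens_append)
  then show 1: "closes i (u @ k @ v) = closes i (u @ k' @ v) \<and> opens i (u @ k @ v) = opens i (u @ k' @ v)"
    by (auto simp: closes_append[of i u] opens_append[of i u])
  assume a: "a \<le> free i (u @ k @ v)"
  define m b where "m = min (opens i u) (closes i (k @ v))" and "b = min a (free i (k @ v) - m)"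
  define m' b' where "m' = min (opens i k) (closes i v)" and "b' = min b (free i v - m')"
  have b: "b \<le> free i (k @ v)" by (simp add: b_def)
  have "m' + b - b' \<le> free i k" using b by (auto simp: b'_def m'_def closes_append opens_append)
  moreover have "opens i k \<le> m' + b - b'" if "opens i (u @ k @ v) \<le> a"
  proof -
    have "opens i (k @ v) \<le> b" using that unfolding b_def m_def opens_append[of i u] by auto
    then have "opens i v + (opens i k - closes i v) \<le> b" by (simp add: opens_append)
    then show ?thesis unfolding b'_def m'_def by (auto simp: min_def)
  qed
  moreover have "rematch i a (u @ k @ v) = rematch i (m + a - b) u @ rematch i (m' + b - b') k @ rematch i b' v"
    unfolding rematch_append[OF a] m_def[symmetric] b_def[symmetric]
    unfolding rematch_append[OF b] m'_def[symmetric] b'_def[symmetric] ..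
  moreover have "rematch i a (u @ k' @ v) = rematch i (m + a - b) u @ rematch i (m' + b - b') k' @ rematch i b' v"
  proof -
    have a': "a \<le> free i (u @ k' @ v)" and b': "b \<le> free i (k' @ v)" using a b 1 kv by auto
    show ?thesis
      unfolding rematch_append[OF a'] kv[symmetric] m_def[symmetric] b_def[symmetric]
      unfolding rematch_append[OF b'] sig[symmetric] m'_def[symmetric] b'_def[symmetric] ..
  qed
  ultimately show "\<exists>A b C. rematch i a (u @ k @ v) = A @ rematch i b k @ C \<and>
       rematch i a (u @ k' @ v) = A @ rematch i b k' @ C \<and> length A = length u \<and> length C = length v \<and>
       b \<le> free i k \<and> (opens i (u @ k @ v) \<le> a \<longrightarrow> opens i k \<le> b)"
    by (intro exI[of _ "rematch i (m + a - b) u"] exI[of _ "m' + b - b'"] exI[of _ "rematch i b' v"]) simp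
qed

lemma knuth_rematch_context:
  assumes sig: "closes i k = closes i k' \<and> opens i k = opens i k'"
    and k: "\<And>a. a \<le> free i k \<Longrightarrow> knuth (rematch i a k) (rematch i a k')"
    and a: "a \<le> free i (u @ k @ v)"
  shows "knuth (rematch i a (u @ k @ v)) (rematch i a (u @ k' @ v))"
proof -
  obtain A b C where "rematch i a (u @ k @ v) = A @ rematch i b k @ C"
    "rematch i a (u @ k' @ v) = A @ rematch i b k' @ C" "b \<le> free i k"
    using rematch_context(2)[of i k k' a u v] sig a by blast
  then show ?thesis using knuth_append[OF k] by simp
qed

lemma knuth_rematch_all:
  assumes "knuth w w'"
  shows "closes i w = closes i w' \<and> opens i w = opens i w' \<and> (\<forall>a \<le> free i w. knuth (rematch i a w) (rematch i a w'))"
  using assms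
proof (induction rule: knuth.induct)
  case (knuth_yzx x y z u v)
  show ?case
    using rematch_context(1)[of i "[y, z, x]" "[y, x, z]"] rematch_yzx[OF knuth_yzx]
      knuth_rematch_context[of i "[y, z, x]" "[y, x, z]"] by blast
next
  case (knuth_xzy x y z u v)
  show ?case
    using rematch_context(1)[of i "[x, z, y]" "[z, x, y]"] rematch_xzy[OF knuth_xzy]
      knuth_rematch_context[of i "[x, z, y]" "[z, x, y]"] by blast
next
  case (knuth_trans u v w)
  then show ?case using knuth.knuth_trans by auto
qed (auto intro: knuth.intros)

lemma knuth_closes: "knuth w w' \<Longrightarrow> closes i w = closes i w'"
  and knuth_opens: "knuth w w' \<Longrightarrow> opens i w = opens i w'"
  and knuth_rematch: "knuth w w' \<Longrightarrow> a \<le> free i w \<Longrightarrow> knuth (rematch i a w) (rematch i a w')"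
  using knuth_rematch_all by blast+

section \<open>Collapsing a tableau\<close>

abbreviation raise_seq :: "nat list \<Rightarrow> nat list \<Rightarrow> nat list" where
  "raise_seq is w \<equiv> foldr (\<lambda>i. rematch i 0) is w"

lemma knuth_raise_seq: "knuth w w' \<Longrightarrow> knuth (raise_seq is w) (raise_seq is w')"
  by (induction "is") (auto intro: knuth_rematch)

text \<open>The number of letters changed by each raising step is a Knuth invariant, so the steps can be undone.\<close>

lemma raise_seq_inj:
  assumes "knuth w w'" "raise_seq is w = raise_seq is w'"
  shows "w = w'"
  using assms(2)
proof (induction "is")
  case (Cons i "is")
  let ?x = "raise_seq is w" and ?y = "raise_seq is w'"
  have "opens i ?x = opens i ?y" using knuth_raise_seq[OF assms(1)] knuth_opens by blast
  then have "rematch i (opens i ?x) (rematch i 0 ?x) = rematch i (opens i ?y) (rematch i 0 ?y)" using Cons.prems by simp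
  then have "?x = ?y" by (simp add: rematch_rematch)
  then show ?case by (rule Cons.IH)
qed simp

fun collapse_seq :: "nat \<Rightarrow> nat list" where
  "collapse_seq 0 = []"
| "collapse_seq (Suc k) = [1..<k + 1] @ collapse_seq k"

text \<open>Letting \<open>f\<close> see the row index makes every intermediate stage of a collapse
  a reading word over the same tableau, with entries rewritten row by row.\<close>

fun row_word :: "(nat \<Rightarrow> nat \<Rightarrow> nat) \<Rightarrow> nat list list \<Rightarrow> nat \<Rightarrow> nat list" where
  "row_word f T 0 = []"
| "row_word f T (Suc n) = map (f n) (T ! n) @ row_word f T n"

lemma row_word_rrw: "row_word (\<lambda>r x. x) T (length T) = rrw T"
proof -
  have "n \<le> length T \<Longrightarrow> row_word (\<lambda>r x. x) T n = concat (rev (take n T))" for n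
    by (induction n) (auto simp: take_Suc_conv_app_nth)
  from this[of "length T"] show ?thesis by (simp add: rrw_def)
qed

lemma row_word_cong:
  "(\<And>r x. r < n \<Longrightarrow> x \<in> set (T ! r) \<Longrightarrow> f r x = g r x) \<Longrightarrow> row_word f T n = row_word g T n"
  by (induction n) auto

text \<open>Rows may be empty at the top, so that all tableaux with entries at most \<open>L\<close> can be given exactly \<open>L\<close> rows.\<close>

definition tableau :: "nat list list \<Rightarrow> bool" where
  "tableau T \<longleftrightarrow> (\<forall>r < length T. sorted (T ! r) \<and> 0 \<notin> set (T ! r)) \<and>
     (\<forall>r c. Suc r < length T \<and> c < length (T ! Suc r) \<longrightarrow>
        c < length (T ! r) \<and> T ! r ! c < T ! Suc r ! c)"

lemma tableau_entry_ge:
  assumes "tableau T" "r < length T" "x \<in> set (T ! r)"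
  shows "Suc r \<le> x"
  using assms(2,3)
proof (induction r arbitrary: x)
  case 0
  then have "0 \<notin> set (T ! 0)" using assms(1) unfolding tableau_def by blast
  then show ?case using 0 by (cases x) auto
next
  case (Suc r)
  then obtain c where c: "c < length (T ! Suc r)" "x = T ! Suc r ! c" by (auto simp: in_set_conv_nth)
  then have "c < length (T ! r)" "T ! r ! c < x" using assms(1) Suc.prems unfolding tableau_def by auto
  then have "Suc r \<le> T ! r ! c" using Suc by simp
  then show ?case using \<open>T ! r ! c < x\<close> by simp
qed

abbreviation cnt :: "nat list \<Rightarrow> nat \<Rightarrow> nat" where
  "cnt w \<equiv> count (mset w)"

lemma rematch_no_low:
  "i \<notin> set w \<Longrightarrow> closes i w = 0 \<and> opens i w = cnt w (Suc i) \<and>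
     rematch i 0 w = map (\<lambda>x. if x = Suc i then i else x) w"
  by (induction w) auto

lemma rematch_append_closed: "opens i u \<le> closes i v \<Longrightarrow> rematch i 0 (u @ v) = u @ rematch i 0 v"
  using rematch_append[of 0 i u v] by simp

lemma rematch_replicate_append: "closes i (replicate b i @ v) = b + closes i v \<and> opens i (replicate b i @ v) = opens i v \<and>
  rematch i 0 (replicate b i @ v) = replicate b i @ rematch i 0 v"
  by (induction b) auto

lemma filter_prefix:
  "sorted_wrt (\<lambda>x y. P y \<longrightarrow> P x) xs \<Longrightarrow> xs = filter P xs @ filter (\<lambda>x. \<not> P x) xs"
proof (induction xs)
  case (Cons a xs)
  show ?case
  proof (cases "P a")
    case True
    then show ?thesis using Cons by simp
  next
    case False
    then have "\<forall>x \<in> set xs. \<not> P x" using Cons.prems by auto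
    then show ?thesis using False by (simp add: filter_empty_conv filter_id_conv)
  qed
qed simp

lemma sorted_nth_le_iff:
  assumes "sorted xs" 
  shows "c < length (filter (\<lambda>x. x \<le> k) xs) \<longleftrightarrow> c < length xs \<and> xs ! c \<le> (k::nat)"
proof -
  let ?a = "filter (\<lambda>x. x \<le> k) xs" and ?b = "filter (\<lambda>x. \<not> x \<le> k) xs"
  have xs: "xs = ?a @ ?b"
    by (rule filter_prefix, rule sorted_wrt_mono_rel[OF _ assms]) simp
  show ?thesis
  proof (cases "c < length ?a")
    case True
    then have "?a ! c \<in> set ?a" using nth_mem by blast
    then show ?thesis using True
      by (metis (mono_tags, lifting) length_append mem_Collect_eq nth_append set_filter trans_less_add1 xs)
  next
    case False
    have "\<not> xs ! c \<le> k" if "c < length xs"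
    proof -
      have "c - length ?a < length ?b" using that False arg_cong[OF xs, of length] by simp
      then have "?b ! (c - length ?a) \<in> set ?b" using nth_mem by blast
      moreover have "xs ! c = ?b ! (c - length ?a)" using xs False by (metis nth_append)
      ultimately show ?thesis by simp
    qed
    then show ?thesis using False by blast
  qed
qed

text \<open>An entry at most k + 1 stands above an entry at most k by column strictness. This makes
  the openings of an upper row find enough closings in the row below.\<close>

lemma tableau_count_le:
  assumes "tableau T" "Suc r < length T"
  shows "length (filter (\<lambda>x. x \<le> Suc k) (T ! Suc r)) \<le> length (filter (\<lambda>x. x \<le> k) (T ! r))"
proof (rule ccontr)
  let ?c = "length (filter (\<lambda>x. x \<le> k) (T ! r))"
  have s: "sorted (T ! r)" "sorted (T ! Suc r)" using assms unfolding tableau_def by auto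
  assume "\<not> ?thesis"
  then have "?c < length (filter (\<lambda>x. x \<le> Suc k) (T ! Suc r))" by simp
  then have "?c < length (T ! Suc r)" "T ! Suc r ! ?c \<le> Suc k"
    using sorted_nth_le_iff[OF s(2), of ?c "Suc k"] by blast+
  then have "?c < length (T ! r)" "T ! r ! ?c \<le> k" using assms unfolding tableau_def by fastforce+
  then show False using sorted_nth_le_iff[OF s(1), of ?c k] by simp
qed

text \<open>The entry \<open>x\<close> of the row with index \<open>r\<close> (counted from 0) when the entries up to \<open>k\<close> are collapsed and
  the operators \<open>k, k - 1, ..., j\<close> have acted on the entries \<open>k + 1\<close>.\<close>

definition part_coll :: "nat \<Rightarrow> nat \<Rightarrow> nat \<Rightarrow> nat \<Rightarrow> nat" where
  "part_coll k j r x = (if x \<le> k then Suc r else if x = Suc k then max (Suc r) j else x)"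

lemma set_row_word: "set (row_word f T n) = {f r x |r x. r < n \<and> x \<in> set (T ! r)}"
  by (induction n) (auto simp: less_Suc_eq)

lemma count_mset_map: "count (mset (map f xs)) y = length (filter (\<lambda>x. f x = y) xs)"
  by (induction xs) auto

text \<open>Letters j occur only in the row with index j - 1, as its collapsed entries. Letters j +
  1 come from the row above it, where all are matched by \<open>tableau_count_le\<close>, and from
  the entries k + 1 of the rows up to index j - 1. The latter have no j to their right, because rows
  increase, so exactly these are lowered.\<close>

lemma row_word_step:
  assumes T: "tableau T" and L: "n \<le> length T" "j < n" "1 \<le> j" and k: "j \<le> k"
  shows "rematch j 0 (row_word (part_coll k (Suc j)) T n) = row_word (part_coll k j) T n"
  using L(1,2)
proof (induction n)
  case (Suc n)
  let ?f = "part_coll k (Suc j)" and ?g = "part_coll k j"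
  show ?case
  proof (cases "j < n")
    case True
    let ?u = "map (?f n) (T ! n)"
    have "j \<notin> set ?u" "Suc j \<notin> set ?u" using True k by (auto simp: part_coll_def)
    then have "opens j ?u = 0" using rematch_no_low by (simp add: count_eq_zero_iff)
    then have st: "rematch j 0 (?u @ row_word ?f T n) = ?u @ rematch j 0 (row_word ?f T n)"
      by (intro rematch_append_closed) simp
    have u: "?u = map (?g n) (T ! n)" using True by (auto simp: part_coll_def)
    have "rematch j 0 (row_word ?f T n) = row_word ?g T n" using Suc True by simp
    then show ?thesis unfolding row_word.simps st by (simp only: u)
  next
    case False
    then have nj: "n = j" using Suc by simp
    obtain i where i: "j = Suc i" using L by (cases j) auto
    let ?u = "map (?f j) (T ! j)" and ?v = "map (?f i) (T ! i)" and ?w = "row_word ?f T i"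
    let ?a = "filter (\<lambda>x. x \<le> k) (T ! i)" and ?b = "filter (\<lambda>x. \<not> x \<le> k) (T ! i)"
    have so: "sorted (T ! i)" using T Suc.prems i nj unfolding tableau_def by auto
    have ab: "T ! i = ?a @ ?b"
      by (rule filter_prefix, rule sorted_wrt_mono_rel[OF _ so]) simp
    have "map (?f i) ?a = replicate (length ?a) j" 
      by (intro replicate_eqI) (auto simp: part_coll_def i)
    then have v: "?v = replicate (length ?a) j @ map (?f i) ?b" using ab by (metis map_append)
    have jb: "j \<notin> set (map (?f i) ?b @ ?w)" using k i by (auto simp: part_coll_def set_row_word)
    have "j \<notin> set ?u" using k by (auto simp: part_coll_def i)
    then have "opens j ?u = cnt ?u (Suc j)" using rematch_no_low by blast
    also have "\<dots> = length (filter (\<lambda>x. ?f j x = Suc j) (T ! j))"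
      by (rule count_mset_map)
    also have "\<dots> = length (filter (\<lambda>x. x \<le> Suc k) (T ! j))"
      using k by (intro arg_cong[of _ _ length] filter_cong) (auto simp: part_coll_def)
    also have "\<dots> \<le> length ?a" using tableau_count_le[OF T, of i k] Suc.prems i nj by simp
    also have "\<dots> \<le> closes j (?v @ ?w)" unfolding v by (simp add: rematch_replicate_append)
    finally have "rematch j 0 (?u @ ?v @ ?w) = ?u @ rematch j 0 (?v @ ?w)" by (rule rematch_append_closed)
    also have "rematch j 0 (?v @ ?w) = replicate (length ?a) j @ rematch j 0 (map (?f i) ?b @ ?w)"
      unfolding v by (simp add: rematch_replicate_append)
    also have "rematch j 0 (map (?f i) ?b @ ?w) = map (\<lambda>x. if x = Suc j then j else x) (map (?f i) ?b @ ?w)"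
      using rematch_no_low[OF jb] by blast
    also have "\<dots> = map (?g i) ?b @ row_word ?g T i"
    proof -
      have "map (\<lambda>x. if x = Suc j then j else x) (row_word ?f T m) = row_word ?g T m" if "m \<le> i" for m
        using that k i by (induction m) (auto simp: part_coll_def)
      then show ?thesis using k i by (auto simp: part_coll_def)
    qed
    also have "replicate (length ?a) j @ map (?g i) ?b @ row_word ?g T i = map (?g i) (T ! i) @ row_word ?g T i"
    proof -
      have "map (?g i) ?a = replicate (length ?a) j" 
        by (intro replicate_eqI) (auto simp: part_coll_def i)
      then show ?thesis using ab by (metis append_assoc map_append)
    qed
    finally have "rematch j 0 (?u @ ?v @ ?w) = ?u @ map (?g i) (T ! i) @ row_word ?g T i" .
    moreover have "row_word ?f T (Suc n) = ?u @ ?v @ ?w"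
      "row_word ?g T (Suc n) = ?u @ map (?g i) (T ! i) @ row_word ?g T i"
      using nj i by (auto simp: part_coll_def)
    ultimately show ?thesis by (simp only:)
  qed
qed simp

definition full_coll :: "nat \<Rightarrow> nat \<Rightarrow> nat \<Rightarrow> nat" where
  "full_coll k r x = (if x \<le> k then Suc r else x)"

lemma raise_seq_row_word:
  assumes T: "tableau T" and L: "k \<le> length T"
  shows "raise_seq (collapse_seq k) (rrw T) = row_word (full_coll k) T (length T)"
  using L
proof (induction k)
  case 0
  have "rrw T = row_word (full_coll 0) T (length T)" unfolding row_word_rrw[symmetric]
    by (intro row_word_cong) (use tableau_entry_ge[OF T] in \<open>fastforce simp: full_coll_def\<close>)
  then show ?case by simp
next
  case (Suc k)
  let ?n = "length T"
  have "raise_seq [j..<k + 1] (row_word (part_coll k (Suc k)) T ?n) = row_word (part_coll k j) T ?n"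
    if "1 \<le> j" "j \<le> Suc k" for j
    using that(2,1)
  proof (induction rule: inc_induct)
    case base
    then show ?case by simp
  next
    case (step m)
    then have "[m..<k + 1] = m # [Suc m..<k + 1]" by (simp add: upt_conv_Cons)
    then show ?case using step row_word_step[OF T, of ?n m k] Suc.prems by simp
  qed
  then have "raise_seq [1..<k + 1] (row_word (part_coll k (Suc k)) T ?n) = row_word (part_coll k 1) T ?n"
    by simp
  \<comment> \<open>An entry k + 1 lies in a row with index at most k, so the maximum in
    \<open>part_coll\<close> is k + 1 itself.\<close>
  moreover have "row_word (full_coll k) T ?n = row_word (part_coll k (Suc k)) T ?n"
    by (intro row_word_cong) (use tableau_entry_ge[OF T] in \<open>fastforce simp: full_coll_def part_coll_def\<close>)
  moreover have "row_word (part_coll k 1) T ?n = row_word (full_coll (Suc k)) T ?n"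
    by (intro row_word_cong) (auto simp: full_coll_def part_coll_def)
  ultimately show ?case using Suc by simp
qed


text \<open>The word versions of \<open>Ncard\<close> and \<open>rhoQ\<close>: they depend only on
  the contents of raised words, hence are Knuth invariant.\<close>

definition collapse_count :: "nat list \<Rightarrow> nat \<Rightarrow> nat \<Rightarrow> nat" where
  "collapse_count w i r = (if 1 \<le> r \<and> r \<le> i then cnt (raise_seq (collapse_seq i) w) r else 0)"

definition recording_tab :: "nat \<Rightarrow> nat list \<Rightarrow> nat list list" where
  "recording_tab L w = map (\<lambda>r. concat (map (\<lambda>i. replicate (collapse_count w i r - collapse_count w (i - 1) r) i) [1..<L + 1])) [1..<L + 1]"

lemma knuth_recording_tab: "knuth w w' \<Longrightarrow> recording_tab L w = recording_tab L w'"
proof -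
  assume k: "knuth w w'"
  have "collapse_count w i r = collapse_count w' i r" for i r
    unfolding collapse_count_def using knuth_mset[OF knuth_raise_seq[OF k]] by simp
  then show ?thesis by (simp add: recording_tab_def)
qed

lemma count_full_coll:
  assumes "r < n" "r < i"
  shows "cnt (row_word (full_coll i) T n) (Suc r) = length (filter (\<lambda>x. x \<le> i) (T ! r))"
  using assms(1)
proof (induction n)
  case (Suc n)
  have c: "count (image_mset (full_coll i m) (mset xs)) (Suc r) = (if m = r then length (filter (\<lambda>x. x \<le> i) xs) else 0)" for m xs
    using assms(2) by (induction xs) (auto simp: full_coll_def)
  have "cnt (row_word (full_coll i) T m) (Suc r) = 0" if "m \<le> r" for m
    using that by (induction m) (auto simp: c)
  then show ?case using Suc c by (cases "r = n") auto
qed simp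

lemma concat_replicate_sorted:
  assumes "sorted xs" "set xs \<subseteq> {a..<b}"
  shows "concat (map (\<lambda>i. replicate (cnt xs i) i) [a..<b]) = xs"
proof -
  let ?c = "\<lambda>l. concat (map (\<lambda>i. replicate (cnt xs i) i) l)"
  have "cnt (?c l) x = (if x \<in> set l then cnt xs x else 0)" if "distinct l" for l x
    using that by (induction l) auto
  then have "mset (?c [a..<b]) = mset xs" 
    using assms(2) by (intro multiset_eqI) (auto simp: count_eq_zero_iff)
  moreover have "sorted (?c l)" if "sorted l" for l
    using that by (induction l) (auto simp: sorted_append)
  ultimately show ?thesis using properties_for_sort[of "?c [a..<b]" xs] assms(1)
    by (simp add: sorted_sort_id)
qed

text \<open>Collapsing the entries up to i turns those of row r into the letter r, so the recorded
  counts are the numbers of entries at most i in each row, and their differences are the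
  multiplicities of i.\<close>

lemma recording_tab_rrw:
  assumes T: "tableau T" and L: "length T = L" and le: "\<forall>r < L. \<forall>x \<in> set (T ! r). x \<le> L"
  shows "recording_tab L (rrw T) = T"
proof (rule nth_equalityI)
  show "length (recording_tab L (rrw T)) = length T" using L by (simp add: recording_tab_def)
  fix r assume "r < length (recording_tab L (rrw T))"
  then have r: "r < L" by (simp add: recording_tab_def del: upt_Suc)
  have N: "collapse_count (rrw T) i (Suc r) = length (filter (\<lambda>x. x \<le> i) (T ! r))" if "i \<le> L" for i
  proof (cases "r < i")
    case True
    then show ?thesis using that L r raise_seq_row_word[OF T, of i] count_full_coll[of r L i T] by (simp add: collapse_count_def)
  next
    case False
    then have "filter (\<lambda>x. x \<le> i) (T ! r) = []"
      using tableau_entry_ge[OF T, of r] L r by (force simp: filter_empty_conv)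
    then show ?thesis using False by (simp add: collapse_count_def)
  qed
  have "length (filter (\<lambda>x. x \<le> i) xs) - length (filter (\<lambda>x. x \<le> i - 1) xs) = cnt xs i"
    if "1 \<le> i" for i :: nat and xs
  proof -
    have "length (filter (\<lambda>x. x \<le> i) xs) = length (filter (\<lambda>x. x \<le> i - 1) xs) + cnt xs i"
      using that by (induction xs) auto
    then show ?thesis by simp
  qed
  then have "recording_tab L (rrw T) ! r = concat (map (\<lambda>i. replicate (cnt (T ! r) i) i) [1..<L + 1])"
    using r by (auto simp: recording_tab_def N simp del: upt_Suc intro!: arg_cong[of _ _ concat])
  also have "\<dots> = T ! r"
  proof (rule concat_replicate_sorted)
    show "sorted (T ! r)" using T r L by (simp add: tableau_def)
    have "\<And>x. x \<in> set (T ! r) \<Longrightarrow> Suc r \<le> x" using tableau_entry_ge[OF T] r L by simp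
    then show "set (T ! r) \<subseteq> {1..<L + 1}" using le r by fastforce
  qed
  finally show "recording_tab L (rrw T) ! r = T ! r" .
qed

section \<open>Row insertion\<close>

definition row_insert :: "nat \<Rightarrow> nat list \<Rightarrow> nat list" where
  "row_insert x R = (let k = length (takeWhile (\<lambda>y. y \<le> x) R) in if k = length R then R @ [x] else R[k := x])"

fun insert_letter :: "nat \<Rightarrow> nat list list \<Rightarrow> nat list list" where
  "insert_letter x [] = [[x]]"
| "insert_letter x (R # Rs) = row_insert x R #
     (let k = length (takeWhile (\<lambda>y. y \<le> x) R) in if k = length R then Rs else insert_letter (R ! k) Rs)"

text \<open>Every entry passed by \<open>x\<close> has a left neighbour that exceeds
  \<open>x\<close> and does not exceed the entry; this neighbour licenses the exchange.\<close>

lemma knuth_bump_right: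
  "sorted (y # v) \<Longrightarrow> x < y \<Longrightarrow> knuth ([y] @ v @ [x]) ([y, x] @ v)"
proof (induction v arbitrary: y)
  case (Cons z v)
  then have "knuth ([z] @ v @ [x]) ([z, x] @ v)" by (intro Cons.IH) auto
  then have "knuth ([y] @ [z] @ v @ [x]) ([y, z, x] @ v)" using knuth_append[of _ _ "[y]" "[]"] by fastforce
  moreover have "knuth ([y, z, x] @ v) ([y, x, z] @ v)"
    using Cons.prems knuth_yzx[of x y z "[]" v] by simp
  ultimately show ?case using knuth_trans by fastforce
qed (simp add: knuth_refl)

text \<open>When \<open>y\<close> passes a letter of \<open>u\<close>, the letter after both lies
  between them in size and licenses the exchange.\<close>

lemma knuth_bump_left:
  "sorted (u @ [x]) \<Longrightarrow> x < y \<Longrightarrow> knuth (u @ [y, x]) ([y] @ u @ [x])"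
proof (induction u)
  case (Cons a u)
  then have "knuth (u @ [y, x]) ([y] @ u @ [x])" by auto
  then have 1: "knuth ([a] @ u @ [y, x]) ([a] @ [y] @ u @ [x])" using knuth_append[of _ _ "[a]" "[]"] by fastforce
  obtain b t where b: "u @ [x] = b # t" by (cases "u @ [x]") auto
  then have "b \<in> set (u @ [x])" by simp
  then have "a \<le> b" "b < y" using Cons.prems by (auto simp: sorted_append)
  then have "knuth ([a, y] @ u @ [x]) ([y, a] @ u @ [x])"
    using b knuth_xzy[of a b y "[]" t] by simp
  with 1 show ?case using knuth_trans by fastforce
qed (simp add: knuth_refl)

lemma takeWhile_split:
  fixes x :: nat and R :: "nat list"
  defines "k \<equiv> length (takeWhile (\<lambda>y. y \<le> x) R)"
  shows "k \<le> length R" "\<And>i. i < k \<Longrightarrow> R ! i \<le> x" "k < length R \<Longrightarrow> x < R ! k"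
proof -
  show "k \<le> length R" by (simp add: k_def length_takeWhile_le)
  show "R ! i \<le> x" if "i < k" for i
    using that unfolding k_def by (metis nth_mem set_takeWhileD takeWhile_nth)
  show "x < R ! k" if "k < length R"
    using that unfolding k_def by (meson not_le nth_length_takeWhile)
qed

text \<open>In a bumped row \<open>u @ [y] @ v\<close> the new letter first moves next to the bumped
  \<open>y\<close>, which then moves to the front of the row; there it is the letter inserted into
  the rows above.\<close>

lemma knuth_insert_letter:
  assumes "\<forall>R \<in> set T. sorted R"
  shows "knuth (rrw T @ [x]) (rrw (insert_letter x T))"
  using assms
proof (induction T arbitrary: x)
  case Nil
  then show ?case by (simp add: rrw_def knuth_refl)
next
  case (Cons R Rs)
  let ?k = "length (takeWhile (\<lambda>y. y \<le> x) R)"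
  show ?case
  proof (cases "?k = length R")
    case True
    then show ?thesis by (simp add: row_insert_def rrw_def knuth_refl)
  next
    case False
    then have k: "?k < length R" "x < R ! ?k" using takeWhile_split(1,3)[of x R] by auto
    define u v where uv: "u = take ?k R" "v = drop (Suc ?k) R"
    let ?y = "R ! ?k"
    have R: "R = u @ ?y # v" using k by (simp add: uv id_take_nth_drop)
    have "\<forall>z \<in> set u. z \<le> x" unfolding uv by (metis set_takeWhileD takeWhile_eq_take)
    moreover have "sorted (u @ ?y # v)" using Cons.prems R by (metis list.set_intros(1))
    ultimately have su: "sorted (u @ [x])" and sv: "sorted (?y # v)" by (simp_all add: sorted_append)
    have "knuth (u @ ([?y] @ v @ [x]) @ []) (u @ ([?y, x] @ v) @ [])"
      by (intro knuth_append knuth_bump_right sv k)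
    moreover have "knuth ([] @ (u @ [?y, x]) @ v) ([] @ ([?y] @ u @ [x]) @ v)"
      by (intro knuth_append knuth_bump_left su k)
    ultimately have "knuth (u @ [?y] @ v @ [x]) ([?y] @ u @ [x] @ v)"
      using knuth_trans by fastforce
    moreover have "R[?k := x] = u @ [x] @ v" using k by (simp add: uv upd_conv_take_nth_drop)
    ultimately have "knuth (R @ [x]) ([?y] @ R[?k := x])" using R by (metis append.assoc append_Cons append_Nil)
    then have "knuth (rrw Rs @ (R @ [x]) @ []) (rrw Rs @ ([?y] @ R[?k := x]) @ [])" by (rule knuth_append)
    moreover have "knuth ([] @ (rrw Rs @ [?y]) @ R[?k := x]) ([] @ rrw (insert_letter ?y Rs) @ R[?k := x])"
      by (intro knuth_append Cons.IH) (use Cons.prems in simp)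
    ultimately have "knuth (rrw Rs @ R @ [x]) (rrw (insert_letter ?y Rs) @ R[?k := x])"
      using knuth_trans by fastforce
    then show ?thesis using False by (simp add: row_insert_def rrw_def)
  qed
qed

section \<open>Row insertion preserves tableaux\<close>

definition dom_row :: "nat list \<Rightarrow> nat list \<Rightarrow> bool" where
  "dom_row R S \<longleftrightarrow> length S \<le> length R \<and> (\<forall>c < length S. R ! c < S ! c)"

text \<open>Unlike in \<open>tableau\<close>, rows are nonempty, so that the number of rows can be
  bounded by the largest entry before padding.\<close>

definition tight_tableau :: "nat list list \<Rightarrow> bool" where
  "tight_tableau T \<longleftrightarrow> (\<forall>R \<in> set T. sorted R \<and> R \<noteq> [] \<and> 0 \<notin> set R) \<and> successively dom_row T"

lemma sorted_row_insert: "sorted R \<Longrightarrow> sorted (row_insert x R)"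
proof -
  assume s: "sorted R"
  let ?k = "length (takeWhile (\<lambda>y. y \<le> x) R)"
  note t = takeWhile_split[where x="x" and R=R]
  show ?thesis
  proof (cases "?k = length R")
    case True
    then have "\<forall>y \<in> set R. y \<le> x" using t(2) by (auto simp: in_set_conv_nth)
    then show ?thesis using s True by (simp add: row_insert_def sorted_append)
  next
    case False
    then have k: "?k < length R" using t(1) by simp
    have "R[?k := x] ! i \<le> R[?k := x] ! j" if "i \<le> j" "j < length R" for i j
    proof -
      have "R ! i \<le> R ! j" using s that by (simp add: sorted_iff_nth_mono)
      moreover have "R ! ?k \<le> R ! j" if "?k \<le> j"
        using s that \<open>j < length R\<close> by (simp add: sorted_iff_nth_mono)
      ultimately show ?thesis using t(2)[of i] t(3) k that by (auto simp: nth_list_update)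
    qed
    then show ?thesis using False by (simp add: row_insert_def sorted_iff_nth_mono)
  qed
qed

text \<open>The bumped letter leaves column \<open>k\<close> of \<open>R\<close> and enters
  \<open>S\<close> at a column \<open>l \<le> k\<close>, since the entry of \<open>S\<close> above
  it, if any, is larger. Below its new place the changed row \<open>R\<close> has a smaller entry:
  an old one left of column \<open>k\<close>, or \<open>x\<close> itself.\<close>

lemma row_insert_dom:
  fixes x :: nat
  assumes "dom_row R S"
  defines "k \<equiv> length (takeWhile (\<lambda>y. y \<le> x) R)"
  shows "k = length R \<Longrightarrow> dom_row (row_insert x R) S"
    and "k < length R \<Longrightarrow> dom_row (row_insert x R) (row_insert (R ! k) S)"
proof -
  show "dom_row (row_insert x R) S" if "k = length R"
    using assms that by (auto simp: row_insert_def dom_row_def nth_append)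
  assume k: "k < length R"
  let ?y = "R ! k"
  define l where "l = length (takeWhile (\<lambda>z. z \<le> ?y) S)"
  note tR = takeWhile_split[where x="x" and R=R, folded k_def] and tS = takeWhile_split[where x="?y" and R=S, folded l_def]
  have lk: "l \<le> k"
  proof (rule ccontr)
    assume "\<not> l \<le> k"
    then have "S ! k \<le> ?y" "k < length S" using tS by auto
    then show False using assms(1) by (auto simp: dom_row_def)
  qed
  have R': "row_insert x R = R[k := x]" using k by (simp add: row_insert_def k_def[symmetric])
  have xy: "x < ?y" using tR(3) k by simp
  have Rl: "R[k := x] ! l < ?y"
    using tR(2)[of l] lk xy k by (cases "l = k") auto
  have Rc: "R[k := x] ! c < S ! c" if "c < length S" for c
  proof -
    have "R ! c < S ! c" using assms(1) that by (auto simp: dom_row_def)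
    then show ?thesis using xy k by (cases "c = k") auto
  qed
  show "dom_row (row_insert x R) (row_insert ?y S)"
  proof (cases "l = length S")
    case True
    then have "row_insert ?y S = S @ [?y]" by (simp add: row_insert_def l_def[symmetric])
    then show ?thesis using True lk k Rl Rc unfolding R' dom_row_def
      by (auto simp: nth_append less_Suc_eq)
  next
    case False
    then have "row_insert ?y S = S[l := ?y]" by (simp add: row_insert_def l_def[symmetric])
    moreover have "l < length S" using False tS(1) by simp
    ultimately show ?thesis using Rl Rc assms(1) unfolding R' dom_row_def
      by (auto simp: nth_list_update)
  qed
qed

lemma insert_letter_nonempty: "insert_letter x T \<noteq> []" 
  by (cases T) auto

lemma hd_insert_letter: "hd (insert_letter x T) = row_insert x (if T = [] then [] else hd T)"
  by (cases T) (auto simp: row_insert_def)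

lemma set_row_insert: "set (row_insert x R) \<subseteq> insert x (set R)"
  by (auto simp: row_insert_def Let_def dest!: set_update_subset_insert[THEN subsetD])

lemma row_insert_Nil: "row_insert x R \<noteq> []"
  by (auto simp: row_insert_def Let_def)

lemma tight_tableau_insert_letter: "tight_tableau T \<Longrightarrow> 0 < x \<Longrightarrow> tight_tableau (insert_letter x T)"
proof (induction T arbitrary: x)
  case Nil
  then show ?case by (simp add: tight_tableau_def)
next
  case (Cons R Rs)
  let ?k = "length (takeWhile (\<lambda>y. y \<le> x) R)"
  have R: "sorted R" "0 \<notin> set R" and Rs: "tight_tableau Rs" 
    and d: "Rs = [] \<or> dom_row R (hd Rs)"
    using Cons.prems by (auto simp: tight_tableau_def successively_Cons)
  have R': "sorted (row_insert x R)" "0 \<notin> set (row_insert x R)" "row_insert x R \<noteq> []"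
    using sorted_row_insert[OF R(1)] set_row_insert[of x R] row_insert_Nil R(2) Cons.prems by auto
  show ?case
  proof (cases "?k = length R")
    case True
    then have "Rs = [] \<or> dom_row (row_insert x R) (hd Rs)" using d row_insert_dom(1) by blast
    then show ?thesis using True R' Rs by (auto simp: tight_tableau_def successively_Cons)
  next
    case False
    then have k: "?k < length R" using takeWhile_split(1)[of x R] by simp
    have "dom_row R (if Rs = [] then [] else hd Rs)" using d by (auto simp: dom_row_def)
    then have "dom_row (row_insert x R) (hd (insert_letter (R ! ?k) Rs))"
      unfolding hd_insert_letter by (intro row_insert_dom(2) k)
    moreover have "tight_tableau (insert_letter (R ! ?k) Rs)"
      using takeWhile_split(3)[OF k] by (intro Cons.IH Rs) simp
    ultimately show ?thesis using False R' insert_letter_nonempty by (auto simp: tight_tableau_def successively_Cons)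
  qed
qed

lemma ex_tight_tableau:
  assumes "0 \<notin> set w"
  shows "\<exists>T. tight_tableau T \<and> knuth w (rrw T)"
  using assms
proof (induction w rule: rev_induct)
  case Nil
  have "tight_tableau []" by (simp add: tight_tableau_def)
  then show ?case using knuth_refl[of "[]"] by (metis concat.simps(1) rev.simps(1) rrw_def)
next
  case (snoc x w)
  then obtain T where T: "tight_tableau T" "knuth w (rrw T)" by auto
  have "knuth ([] @ w @ [x]) ([] @ rrw T @ [x])" using T knuth_append by blast
  moreover have "knuth (rrw T @ [x]) (rrw (insert_letter x T))" using T by (intro knuth_insert_letter) (auto simp: tight_tableau_def)
  ultimately have "knuth (w @ [x]) (rrw (insert_letter x T))" using knuth_trans by fastforce
  moreover have "tight_tableau (insert_letter x T)" using T snoc by (intro tight_tableau_insert_letter) auto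
  ultimately show ?case by blast
qed

lemma tight_tableau_tableau:
  assumes "tight_tableau T"
  shows "tableau (T @ replicate m [])"
proof -
  let ?T = "T @ replicate m []"
  have n: "?T ! r = (if r < length T then T ! r else [])" if "r < length T + m" for r
    using that by (auto simp: nth_append)
  have "sorted (?T ! r) \<and> 0 \<notin> set (?T ! r)" if "r < length ?T" for r
    using assms that n[of r] by (auto simp: tight_tableau_def)
  moreover have "c < length (?T ! r) \<and> ?T ! r ! c < ?T ! Suc r ! c"
    if "Suc r < length ?T" "c < length (?T ! Suc r)" for r c
  proof -
    have r: "Suc r < length T" using that n[of "Suc r"] by (auto split: if_splits)
    then have "dom_row (T ! r) (T ! Suc r)" using assms by (auto simp: tight_tableau_def successively_conv_nth)
    then show ?thesis using that r by (auto simp: nth_append dom_row_def)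
  qed
  ultimately show ?thesis unfolding tableau_def by blast
qed

text \<open>By column strictness the row with index r has entries at least r + 1, so there are at
  most \<open>L\<close> nonempty rows, and padding gives exactly \<open>L\<close>.\<close>

lemma ex_tableau:
  assumes "set w \<subseteq> {1..L}"
  shows "\<exists>T. tableau T \<and> length T = L \<and> (\<forall>r < L. set (T ! r) \<subseteq> {1..L}) \<and> knuth w (rrw T)"
proof -
  obtain T where T: "tight_tableau T" "knuth w (rrw T)" using ex_tight_tableau[of w] assms by fastforce
  have "set (concat T) = set (rrw T)" by (auto simp: rrw_def)
  also have "\<dots> = set w" using knuth_mset[OF T(2)] by (metis set_mset_mset)
  finally have s: "set (concat T) \<subseteq> {1..L}" using assms by simp
  have p: "tableau T" using tight_tableau_tableau[OF T(1), of 0] by simp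
  have "length T \<le> L"
  proof (rule ccontr)
    assume "\<not> length T \<le> L"
    then have L: "L < length T" by simp
    then have "T ! L \<noteq> []" using T(1) by (auto simp: tight_tableau_def)
    then have "hd (T ! L) \<in> set (T ! L)" by simp
    then have "Suc L \<le> hd (T ! L)" "hd (T ! L) \<le> L" using tableau_entry_ge[OF p L] s L by fastforce+
    then show False by simp
  qed
  let ?T = "T @ replicate (L - length T) []"
  have "rrw ?T = rrw T" by (simp add: rrw_def)
  moreover have "set (?T ! r) \<subseteq> {1..L}" if "r < L" for r
    using that s by (force simp: nth_append)
  ultimately show ?thesis using tight_tableau_tableau[OF T(1)] T(2) \<open>length T \<le> L\<close>
    by (intro exI[of _ ?T]) auto
qed

section \<open>Reflections and the charge\<close>

abbreviation reflect :: "nat \<Rightarrow> nat list \<Rightarrow> nat list" where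
  "reflect i w \<equiv> rematch i (closes i w) w"

abbreviation reflects :: "nat list \<Rightarrow> nat list \<Rightarrow> nat list" where
  "reflects is w \<equiv> foldr reflect is w"

text \<open>The letters \<open>l\<close> are carried down to the rows \<open>l - 1, ..., 1\<close> by reflections; a letter left unmatched on the way
  is one whose cyclic partner lies to its left. In this form Knuth invariance is immediate.\<close>

definition refl_charge :: "nat \<Rightarrow> nat list \<Rightarrow> nat" where
  "refl_charge L w = (\<Sum>l = 1..L. \<Sum>i = 1..<l. opens i (reflects [Suc i..<l] w))"

lemma knuth_reflects: "knuth w w' \<Longrightarrow> knuth (reflects is w) (reflects is w')"
proof (induction "is")
  case (Cons i "is")
  then have k: "knuth (reflects is w) (reflects is w')" by blast
  show ?case using knuth_rematch[OF k, of "closes i (reflects is w)" i] knuth_closes[OF k, of i] by simp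
qed simp

lemma knuth_refl_charge: "knuth w w' \<Longrightarrow> refl_charge L w = refl_charge L w'"
  unfolding refl_charge_def using knuth_opens[OF knuth_reflects] by simp

lemma length_reflects [simp]: "length (reflects is w) = length w"
  by (induction "is") auto

lemma count_balance: "cnt w i + opens i w = cnt w (Suc i) + closes i w"
  by (induction w) auto

lemma opens_le_count: "opens i w \<le> cnt w (Suc i)"
  by (induction w) auto

lemma count_rematch_sum: "cnt (rematch i a w) i + cnt (rematch i a w) (Suc i)
    = cnt w i + cnt w (Suc i)"
  by (induction w arbitrary: a) auto

lemma count_reflect: "cnt (reflect i w) (Suc i) = cnt w i"
proof -
  have "closes i (reflect i w) = opens i w" "opens i (reflect i w) = closes i w" using free_rematch[of "closes i w" i w] by auto
  then show ?thesis
    using count_balance[of w i] count_balance[of "reflect i w" i] count_rematch_sum[of i "closes i w" w] by simp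
qed

lemma rematch_nth_other:
  "p < length w \<Longrightarrow> w ! p \<noteq> i \<Longrightarrow> w ! p \<noteq> Suc i \<Longrightarrow> rematch i a w ! p = w ! p"
proof (induction w arbitrary: a p)
  case (Cons x w)
  then show ?case by (cases p) auto
qed simp

lemma rematch_nth_pair:
  "p < length w \<Longrightarrow> w ! p \<in> {i, Suc i} \<Longrightarrow> rematch i a w ! p \<in> {i, Suc i}"
proof (induction w arbitrary: a p)
  case (Cons x w)
  show ?case
  proof (cases p)
    case 0
    then show ?thesis using Cons.prems by auto
  next
    case (Suc q)
    then have "\<And>a. rematch i a w ! q \<in> {i, Suc i}" using Cons by simp
    then show ?thesis using Suc by auto
  qed
qed simp

text \<open>With \<open>a\<close> at least the old number of openings, the initial block of letters
  i among the free letters can only shrink.\<close>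

lemma rematch_nth_low:
  "opens i w \<le> a \<Longrightarrow> a \<le> free i w \<Longrightarrow> p < length w \<Longrightarrow> rematch i a w ! p = i \<Longrightarrow> w ! p = i"
proof (induction w arbitrary: a p)
  case (Cons x w)
  consider (cond) "x = i \<or> (x = Suc i \<and> closes i w = 0)"
    | (fixed) "x \<noteq> i" "\<not> (x = Suc i \<and> closes i w = 0)" by blast
  then show ?case
  proof cases
    case cond
    show ?thesis
    proof (cases "a \<le> free i w")
      case True
      then have "x = i" "opens i w \<le> a" using cond Cons.prems by (auto split: if_splits)
      then show ?thesis using True Cons by (cases p) auto
    next
      case False
      then have "a - 1 = free i w" using cond Cons.prems by (auto split: if_splits)
      then have "rematch i (a - 1) w ! q = i \<Longrightarrow> q < length w \<Longrightarrow> w ! q = i" for q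
        using Cons.IH[of "a - 1" q] by simp
      then show ?thesis using False cond Cons.prems by (cases p) auto
    qed
  next
    case fixed
    then have "opens i w \<le> a" "a \<le> free i w" using Cons.prems by (auto split: if_splits)
    then show ?thesis using fixed Cons by (cases p) auto
  qed
qed simp

lemma opens_le_closes: "cnt w (Suc i) \<le> cnt w i \<Longrightarrow> opens i w \<le> closes i w"
  using count_balance[of w i] by linarith

text \<open>Letters other than i and i + 1 are invisible to the bracketing. The pointwise form
  serves to compare words that carry zeros at different positions.\<close>

lemma rematch_neutral:
  assumes "length v = length w"
    and "\<And>p. p < length w \<Longrightarrow> v ! p = w ! p \<or> (v ! p \<notin> {i, Suc i} \<and> w ! p \<notin> {i, Suc i})"
  shows "closes i v = closes i w \<and> opens i v = opens i w \<and>
    (\<forall>a p. p < length w \<longrightarrow> rematch i a v ! p = (if v ! p \<in> {i, Suc i} then rematch i a w ! p else v ! p))"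
  using assms
proof (induction v w rule: list_induct2)
  case (Cons x v y w)
  have IH: "closes i v = closes i w \<and> opens i v = opens i w \<and>
    (\<forall>a p. p < length w \<longrightarrow> rematch i a v ! p = (if v ! p \<in> {i, Suc i} then rematch i a w ! p else v ! p))"
  proof (rule Cons.IH)
    fix p assume "p < length w"
    then show "v ! p = w ! p \<or> (v ! p \<notin> {i, Suc i} \<and> w ! p \<notin> {i, Suc i})"
      using Cons.prems[of "Suc p"] by simp
  qed
  have xy: "x = y \<or> (x \<notin> {i, Suc i} \<and> y \<notin> {i, Suc i})" using Cons.prems[of 0] by simp
  have "rematch i a (x # v) ! p = (if (x # v) ! p \<in> {i, Suc i} then rematch i a (y # w) ! p else (x # v) ! p)"
    if "p < length (y # w)" for a p
  proof (cases p)
    case 0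
    then show ?thesis using xy IH by auto
  next
    case (Suc q)
    then show ?thesis using xy IH that by auto
  qed
  then show ?case using xy IH by auto
qed simp

section \<open>Cyclic search and deletion of cyclic partners\<close>

lemma upt_split: "i \<le> j \<Longrightarrow> j \<le> k \<Longrightarrow> [i..<k] = [i..<j] @ [j..<k]"
  using upt_add_eq_append[of i j "k - j"] by simp

lemma next_pos_later:
  assumes "p < q" "q < length w" "w ! q = j" "\<And>m. p < m \<Longrightarrow> m < q \<Longrightarrow> w ! m \<noteq> j"
  shows "next_pos w p j = q"
proof -
  have "[Suc p..<length w] = [Suc p..<q] @ q # [Suc q..<length w]"
    using upt_split[of "Suc p" q "length w"] assms(1,2) by (simp add: upt_conv_Cons)
  moreover have "filter (\<lambda>q. w ! q = j) [Suc p..<q] = []"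
    using assms(4) by (auto simp: filter_empty_conv)
  ultimately show ?thesis using assms(3) by (simp add: next_pos_def)
qed

lemma next_pos_wrap:
  assumes "q \<le> p" "w ! q = j" "\<And>m. p < m \<Longrightarrow> m < length w \<Longrightarrow> w ! m \<noteq> j"
    "\<And>m. m < q \<Longrightarrow> w ! m \<noteq> j"
  shows "next_pos w p j = q"
proof -
  have "[0..<Suc p] = [0..<q] @ q # [Suc q..<Suc p]"
    using upt_split[of 0 q "Suc p"] assms(1) by (simp add: upt_conv_Cons del: upt_Suc)
  moreover have "filter (\<lambda>q. w ! q = j) [0..<q] = []" "filter (\<lambda>q. w ! q = j) [Suc p..<length w] = []"
    using assms(3,4) by (auto simp: filter_empty_conv)
  ultimately show ?thesis using assms(2) unfolding next_pos_def
    by (metis (mono_tags, lifting) append_Nil filter.simps(2) filter_append list.sel(1))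
qed

lemma next_pos_cases:
  assumes "p < length w" "j \<in> set w"
  obtains (later) q where "p < q" "q < length w" "w ! q = j" "\<And>m. p < m \<Longrightarrow> m < q \<Longrightarrow> w ! m \<noteq> j"
      "next_pos w p j = q"
  | (wrap) q where "q \<le> p" "w ! q = j" "\<And>m. p < m \<Longrightarrow> m < length w \<Longrightarrow> w ! m \<noteq> j"
      "\<And>m. m < q \<Longrightarrow> w ! m \<noteq> j" "next_pos w p j = q"
proof (cases "\<exists>q. p < q \<and> q < length w \<and> w ! q = j")
  case True
  define q where "q = (LEAST q. p < q \<and> q < length w \<and> w ! q = j)"
  have q: "p < q" "q < length w" "w ! q = j" using LeastI_ex[OF True] by (auto simp: q_def)
  moreover have "w ! m \<noteq> j" if "p < m" "m < q" for m
    using not_less_Least[of m "\<lambda>q. p < q \<and> q < length w \<and> w ! q = j"] that q by (auto simp: q_def)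
  ultimately show ?thesis using later next_pos_later by blast
next
  case False
  obtain q0 where q0: "q0 < length w" "w ! q0 = j" using assms(2) by (auto simp: in_set_conv_nth)
  define q where "q = (LEAST q. w ! q = j)"
  have q: "w ! q = j" using LeastI[of "\<lambda>q. w ! q = j"] q0(2) by (simp add: q_def)
  have "q \<le> q0" using Least_le[of "\<lambda>q. w ! q = j"] q0(2) by (simp add: q_def)
  then have "q \<le> p" using q q0 False by (metis le_less_trans not_le)
  moreover have "w ! m \<noteq> j" if "m < q" for m
    using not_less_Least[of m "\<lambda>q. w ! q = j"] that by (auto simp: q_def)
  ultimately show ?thesis using wrap False q next_pos_wrap by blast
qed

lemma no_low_fixed: "i \<notin> set w \<Longrightarrow> rematch i (opens i w) w = w \<and> closes i w = 0"
  using rematch_no_low rematch_opens by blast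

text \<open>The factor from i + 1 to its cyclic partner i has no unmatched i and as many unmatched i
  + 1 as \<open>x\<close>, even if the bracketing pairs this i with a letter of \<open>x\<close>. As
  there are no more openings than closings, the reflection asks the factor for at least the openings
  it has, hence leaves it unchanged.\<close>

lemma pick_later:
  assumes x: "i \<notin> set x" and i: "1 \<le> i"
    and le: "cnt v (Suc i) \<le> cnt v i"
    and v: "v = u @ [Suc i] @ x @ [i] @ y"
  shows "opens i v = opens i (u @ [0] @ x @ [0] @ y) \<and> 
    (\<exists>A B C. reflect i v = A @ [Suc i] @ B @ [i] @ C \<and> reflect i (u @ [0] @ x @ [0] @ y) = A @ [0] @ B @ [0] @ C
       \<and> length A = length u \<and> length B = length x)"
proof -
  let ?k = "[Suc i] @ x @ [i]" and ?k' = "[0] @ x @ [0]"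
  have x0: "closes i x = 0" using rematch_no_low[OF x] by blast
  have k: "closes i ?k = 0" "opens i ?k = opens i x" using x0 by (auto simp: closes_append opens_append)
  have k': "closes i ?k' = 0" "opens i ?k' = opens i x" using x0 i by (auto simp: closes_append opens_append)
  have eq: "closes i ?k = closes i ?k'" "opens i ?k = opens i ?k'" using k k' by simp_all
  have v: "v = u @ ?k @ y" using v by simp
  note ctx = rematch_context[OF eq, where u = u and v = y]
  have "opens i v \<le> closes i v" using le by (rule opens_le_closes)
  then obtain A b C where A: "reflect i v = A @ rematch i b ?k @ C" 
    "rematch i (closes i v) (u @ ?k' @ y) = A @ rematch i b ?k' @ C" "length A = length u" "b \<le> free i ?k" "opens i ?k \<le> b"
    using ctx(2)[of "closes i v"] unfolding v by auto
  then have b: "b = opens i x" using k by simp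
  have "rematch i b ?k = ?k" "rematch i b ?k' = ?k'" using b k(2) k'(2) rematch_opens by metis+
  then have "reflect i v = A @ [Suc i] @ x @ [i] @ C" "reflect i (u @ ?k' @ y) = A @ [0] @ x @ [0] @ C"
    using A ctx(1) v by auto
  then show ?thesis using A(3) ctx(1) v by auto
qed

lemma rematch_append_open:
  assumes "closes i z = 0" "opens i z \<le> a" "a \<le> free i (x @ z)"
  shows "rematch i a (x @ z) = rematch i (a - opens i z) x @ z"
  using rematch_append[OF assms(3)] assms(1,2) by simp

lemma rematch_append_matched:
  assumes "opens i u \<le> closes i z" "a \<le> free i z - opens i u"
  shows "rematch i a (u @ z) = u @ rematch i a z"
proof -
  have "a \<le> free i (u @ z)" using assms by (simp add: closes_append opens_append)
  from rematch_append[OF this] show ?thesis using assms by (simp add: min_def)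
qed

text \<open>This i is the first one and no i follows the i + 1, which is therefore unmatched.
  Deleting both loses that one opening; an opening of \<open>u\<close> deprived of its partner finds
  another in \<open>x\<close>, because the letters i are numerous enough.\<close>

lemma pick_wrap:
  assumes u: "i \<notin> set u" and y: "i \<notin> set y" and i: "1 \<le> i"
    and le: "cnt v (Suc i) \<le> cnt v i"
    and v: "v = u @ [i] @ x @ [Suc i] @ y"
  shows "opens i v = Suc (opens i (u @ [0] @ x @ [0] @ y)) \<and> 
    (\<exists>A B C. reflect i v = A @ [i] @ B @ [Suc i] @ C \<and> reflect i (u @ [0] @ x @ [0] @ y) = A @ [0] @ B @ [0] @ C
       \<and> length A = length u \<and> length B = length x)"
proof -
  define c o' ku h where d: "c = closes i x" "o' = opens i x" "ku = opens i u" "h = opens i y"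
  have u0: "closes i u = 0" and y0: "closes i y = 0" "rematch i h y = y"
    using no_low_fixed[OF u] no_low_fixed[OF y] d by auto
  have cu: "cnt u (Suc i) = ku" "cnt y (Suc i) = h" "cnt u i = 0" "cnt y i = 0"
    using rematch_no_low[OF u] rematch_no_low[OF y] u y d by (auto simp: count_eq_zero_iff)
  have "ku + cnt x (Suc i) + 1 + h \<le> 1 + cnt x i" using le cu unfolding v by simp
  \<comment> \<open>The unmatched letters i of \<open>x\<close> suffice for the openings of
    \<open>u\<close> and, cyclically, for those left over in \<open>x\<close> and
    \<open>y\<close>.\<close>
  then have c: "ku + o' + h \<le> c" using count_balance[of x i] d by simp
  let ?z = "[Suc i] @ y" and ?z' = "[0] @ y"
  have z: "closes i ?z = 0" "opens i ?z = Suc h" "rematch i (Suc h) ?z = ?z" "closes i ?z' = 0" "opens i ?z' = h" "rematch i h ?z' = ?z'"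
    using y0 i d by auto
  \<comment> \<open>The reflection of \<open>v\<close> has c + 1 - ku unmatched letters i + 1, of
    which the last h + 1 fill free positions of \<open>[Suc i] @ y\<close>; after the deletion the
    numbers are c - ku and h. Both leave \<open>?b\<close> for \<open>x\<close>.\<close>
  let ?b = "c - ku - h"
  have xz: "closes i (x @ ?z) = c" "opens i (x @ ?z) = o' + Suc h" "closes i (x @ ?z') = c" "opens i (x @ ?z') = o' + h"
    using z d by (simp_all only: closes_append opens_append)
  have "rematch i (c + 1 - ku) (x @ ?z) = rematch i (c + 1 - ku - Suc h) x @ ?z"
    using rematch_append_open[of i ?z "c + 1 - ku" x] xz z(1,2) c by simp
  then have txz: "rematch i (c + 1 - ku) (x @ ?z) = rematch i ?b x @ ?z" by simp
  have txz': "rematch i (c - ku) (x @ ?z') = rematch i ?b x @ ?z'"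
    using rematch_append_open[of i ?z' "c - ku" x] xz z(4,5) c by simp
  have w: "closes i ([i] @ x @ ?z) = c + 1" "opens i ([i] @ x @ ?z) = o' + Suc h"
     "closes i ([0] @ x @ ?z') = c" "opens i ([0] @ x @ ?z') = o' + h"
    using xz i by auto
  have v': "v = u @ ([i] @ x @ ?z)" using v by simp
  let ?v' = "u @ ([0] @ x @ ?z')"
  have lv: "closes i v = c + 1 - ku" "opens i v = o' + Suc h" "closes i ?v' = c - ku" "opens i ?v' = o' + h"
    unfolding v' closes_append[of i u] opens_append[of i u] w using u0 d c by auto
  have "reflect i v = u @ rematch i (c + 1 - ku) ([i] @ x @ ?z)"
    unfolding lv unfolding v' by (rule rematch_append_matched) (use w d c in auto)
  also have "rematch i (c + 1 - ku) ([i] @ x @ ?z) = [i] @ rematch i (c + 1 - ku) (x @ ?z)"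
    using xz c by simp
  finally have 1: "reflect i v = u @ [i] @ rematch i ?b x @ ?z" unfolding txz .
  have "reflect i ?v' = u @ rematch i (c - ku) ([0] @ x @ ?z')"
    unfolding lv by (rule rematch_append_matched) (use w d c in auto)
  also have "rematch i (c - ku) ([0] @ x @ ?z') = [0] @ rematch i (c - ku) (x @ ?z')"
    using i by simp
  finally have 2: "reflect i ?v' = u @ [0] @ rematch i ?b x @ ?z'" unfolding txz' .
  show ?thesis
    using 1 2 lv by (intro conjI exI[of _ u] exI[of _ "rematch i ?b x"] exI[of _ y]) auto
qed

lemma list_split_two:
  assumes "p < q" "q < length v"
  shows "v = take p v @ [v ! p] @ drop (Suc p) (take q v) @ [v ! q] @ drop (Suc q) v"
proof -
  have q: "v = take q v @ v ! q # drop (Suc q) v" using assms(2) by (rule id_take_nth_drop)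
  have "drop (Suc p) v = drop (Suc p) (take q v @ v ! q # drop (Suc q) v)"
    using q by (rule arg_cong)
  also have "\<dots> = drop (Suc p) (take q v) @ v ! q # drop (Suc q) v"
    using assms by simp
  finally show ?thesis using id_take_nth_drop[of p v] assms by simp
qed

text \<open>Since 0 is a neutral letter, writing 0 deletes a letter without moving the others. Deleting a letter \<open>i + 1\<close>
  together with its cyclic partner changes neither the reflection nor, up to the wrap, the number of unmatched letters;
  hence greedy cyclic matching may proceed in any order.\<close>

lemma pick:
  assumes p: "p < length v" "v ! p = Suc i" and i: "1 \<le> i"
    and le: "cnt v (Suc i) \<le> cnt v i"
  defines "q \<equiv> next_pos v p i"
  shows "q < length v" "v ! q = i" "p \<noteq> q"
    and "opens i v = opens i (v[p := 0, q := 0]) + (if q < p then 1 else 0)"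
    and "reflect i v = (reflect i (v[p := 0, q := 0]))[p := Suc i, q := i]"
proof -
  have "Suc i \<in># mset v" using p by (metis nth_mem set_mset_mset)
  then have "i \<in># mset v" using le unfolding count_greater_zero_iff[symmetric] by linarith
  then have iv: "i \<in> set v" by simp
  have "q < length v \<and> v ! q = i \<and> p \<noteq> q \<and> 
    opens i v = opens i (v[p := 0, q := 0]) + (if q < p then 1 else 0) \<and>
    reflect i v = (reflect i (v[p := 0, q := 0]))[p := Suc i, q := i]"
  proof (cases rule: next_pos_cases[OF p(1) iv])
    case 2: (1 q')
    then have q': "q' = q" by (simp add: q_def)
    define u x y where d: "u = take p v" "x = drop (Suc p) (take q v)" "y = drop (Suc q) v"
    have v: "v = u @ [Suc i] @ x @ [i] @ y"
      using list_split_two[of p q v] 2 q' p unfolding d by simp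
    have l: "length u = p" "length x = q - Suc p" using 2 q' p by (auto simp: d)
    have "i \<notin> set x" using 2(4) q' 2(2) by (auto simp: d in_set_conv_nth)
    from pick_later[OF this i le v] obtain A B C where A:
      "opens i v = opens i (u @ [0] @ x @ [0] @ y)" "reflect i v = A @ [Suc i] @ B @ [i] @ C"
      "reflect i (u @ [0] @ x @ [0] @ y) = A @ [0] @ B @ [0] @ C" "length A = length u" "length B = length x" by blast
    have v0: "v[p := 0, q := 0] = u @ [0] @ x @ [0] @ y"
      using l 2(1) q' by (subst v) (auto simp: list_update_append split: nat.splits)
    have upd: "(A @ [0] @ B @ [0] @ C)[p := Suc i, q := i] = A @ [Suc i] @ B @ [i] @ C"
      using l A(4,5) 2(1) q' by (auto simp: list_update_append split: nat.splits)
    have "reflect i v = (reflect i (v[p := 0, q := 0]))[p := Suc i, q := i]"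
      unfolding v0 A(3) upd by (rule A(2))
    moreover have "opens i v = opens i (v[p := 0, q := 0])" unfolding v0 by (rule A(1))
    moreover have "q < length v" "v ! q = i" "p < q" using 2 q' by auto
    ultimately show ?thesis by simp
  next
    case 3: (2 q')
    then have q': "q' = q" by (simp add: q_def)
    have qp: "q < p" using 3 q' p by (metis le_neq_implies_less n_not_Suc_n)
    define u x y where d: "u = take q v" "x = drop (Suc q) (take p v)" "y = drop (Suc p) v"
    have v: "v = u @ [i] @ x @ [Suc i] @ y"
      using list_split_two[of q p v] 3 q' p qp unfolding d by simp
    have l: "length u = q" "length x = p - Suc q" using qp p by (auto simp: d)
    have "i \<notin> set u" "i \<notin> set y" using 3(3,4) q' p by (auto simp: d in_set_conv_nth)
    from pick_wrap[OF this i le v] obtain A B C where A: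
      "opens i v = Suc (opens i (u @ [0] @ x @ [0] @ y))" "reflect i v = A @ [i] @ B @ [Suc i] @ C"
      "reflect i (u @ [0] @ x @ [0] @ y) = A @ [0] @ B @ [0] @ C" "length A = length u" "length B = length x" by blast
    have v0: "v[p := 0, q := 0] = u @ [0] @ x @ [0] @ y"
      using l qp by (subst v) (auto simp: list_update_append split: nat.splits)
    have upd: "(A @ [0] @ B @ [0] @ C)[p := Suc i, q := i] = A @ [i] @ B @ [Suc i] @ C"
      using l A(4,5) qp by (auto simp: list_update_append split: nat.splits)
    have "reflect i v = (reflect i (v[p := 0, q := 0]))[p := Suc i, q := i]"
      unfolding v0 A(3) upd by (rule A(2))
    moreover have "opens i v = Suc (opens i (v[p := 0, q := 0]))" unfolding v0 by (rule A(1))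
    moreover have "q < length v" "v ! q = i" using 3 q' qp p by auto
    ultimately show ?thesis using qp by simp
  qed
  then show "q < length v" "v ! q = i" "p \<noteq> q"
    "opens i v = opens i (v[p := 0, q := 0]) + (if q < p then 1 else 0)"
    "reflect i v = (reflect i (v[p := 0, q := 0]))[p := Suc i, q := i]" by blast+
qed

fun picks :: "nat \<Rightarrow> nat list \<Rightarrow> nat list \<Rightarrow> nat list" where
  "picks i v [] = []"
| "picks i v (p # ps) = next_pos v p i # picks i (v[p := 0, next_pos v p i := 0]) ps"

lemma length_picks [simp]: "length (picks i v ps) = length ps"
  by (induction i v ps rule: picks.induct) auto

lemma count_update: 
  "p < length v \<Longrightarrow> y \<noteq> 0 \<Longrightarrow> cnt (v[p := 0]) y = cnt v y - (if v ! p = y then 1 else 0)"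
  by (simp add: mset_update)

text \<open>Each choice removes an i + 1 with its partner, and \<open>pick\<close> tells how both
  sides change. The list \<open>ps\<close> is an arbitrary enumeration, which is the independence of
  the order.\<close>

lemma picks_correct:
  assumes "distinct ps" "set ps = {p. p < length v \<and> v ! p = Suc i}" "1 \<le> i"
    and "cnt v (Suc i) \<le> cnt v i"
  shows "opens i v = length (filter (\<lambda>(p, q). q < p) (zip ps (picks i v ps))) \<and>
    {p. p < length v \<and> reflect i v ! p = i} = set (picks i v ps)"
  using assms
proof (induction ps arbitrary: v)
  case Nil
  then have "Suc i \<notin> set v" by (auto simp: in_set_conv_nth)
  \<comment> \<open>With no letter i + 1 left, the reflection turns every i into i + 1, so nothing
    is picked.\<close>
  then have "reflect i v = map (\<lambda>x. if x = i then Suc i else x) v \<and> opens i v = 0 \<and> closes i v = cnt v i"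
    by (induction v) auto
  then show ?case by (auto split: if_splits)
next
  case (Cons p ps)
  let ?q = "next_pos v p i"
  let ?v = "v[p := 0, ?q := 0]"
  have p: "p < length v" "v ! p = Suc i" using Cons.prems(2) by auto
  note pk = pick[OF p Cons.prems(3,4)]
  have ps: "set ps = {p. p < length ?v \<and> ?v ! p = Suc i}"
  proof -
    have "set ps = set (p # ps) - {p}" using Cons.prems(1) by simp
    also have "\<dots> = {p'. p' < length v \<and> v ! p' = Suc i} - {p}" unfolding Cons.prems(2) ..
    also have "\<dots> = {p. p < length ?v \<and> ?v ! p = Suc i}"
      using pk(1,2) p by (auto simp: nth_list_update)
    finally show ?thesis .
  qed
  have c: "cnt ?v (Suc i) \<le> cnt ?v i"
    using Cons.prems(3,4) p pk(1,2,3) by (simp add: count_update)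
  have IH: "opens i ?v = length (filter (\<lambda>(p, q). q < p) (zip ps (picks i ?v ps))) \<and>
    {p. p < length ?v \<and> reflect i ?v ! p = i} = set (picks i ?v ps)"
    using Cons.prems(1) by (intro Cons.IH ps c Cons.prems(3)) simp
  have "{p'. p' < length v \<and> reflect i v ! p' = i} = insert ?q {p. p < length ?v \<and> reflect i ?v ! p = i}"
  proof -
    have "reflect i ?v ! p \<noteq> i" using p pk(1,3) Cons.prems(3) rematch_nth_other[of p ?v i "closes i ?v"]
      by (simp add: nth_list_update)
    then show ?thesis unfolding pk(5) using pk(1,3) p by (auto simp: nth_list_update)
  qed
  then have "{p'. p' < length v \<and> reflect i v ! p' = i} = set (picks i v (p # ps))"
    using IH by simp
  moreover have l: "length (filter (\<lambda>(p, q). q < p) (zip (p # ps) (picks i v (p # ps))))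
      = (if ?q < p then 1 else 0) + length (filter (\<lambda>(p, q). q < p) (zip ps (picks i ?v ps)))" by simp
  ultimately show ?case using IH[THEN conjunct1] pk(4) unfolding l by (intro conjI) linarith+
qed

section \<open>Letters carried down by successive reflections\<close>

lemma reflects_low:
  assumes "p < length w"
  shows "reflects [j..<l] w ! p < j \<or> w ! p < j \<Longrightarrow> reflects [j..<l] w ! p = w ! p"
proof (induction "l - j" arbitrary: j)
  case 0
  then show ?case by simp
next
  case (Suc d)
  let ?x = "reflects [Suc j..<l] w"
  have e: "reflects [j..<l] w = reflect j ?x" using Suc.hyps(2) by (simp add: upt_conv_Cons)
  have IH: "?x ! p < Suc j \<or> w ! p < Suc j \<Longrightarrow> ?x ! p = w ! p" using Suc.hyps by simp
  have px: "p < length ?x" using assms by simp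
  show ?case
  proof (cases "?x ! p \<in> {j, Suc j}")
    case True
    then have "reflect j ?x ! p \<in> {j, Suc j}" using rematch_nth_pair[OF px] by blast
    moreover have "\<not> w ! p < j" using True IH by auto
    ultimately show ?thesis using Suc.prems e by auto
  next
    case False
    then have "reflect j ?x ! p = ?x ! p" using rematch_nth_other[OF px] by auto
    then show ?thesis using Suc.prems IH e by auto
  qed
qed

lemma reflects_eq_iff:
  assumes "p < length w" "i < j"
  shows "reflects [j..<l] w ! p = i \<longleftrightarrow> w ! p = i"
  using reflects_low[OF assms(1), of j l] assms(2) by linarith

lemma count_reflects_low:
  assumes "i < j"
  shows "cnt (reflects [j..<l] w) i = cnt w i"
proof -
  have c: "cnt xs i = card {p. p < length xs \<and> xs ! p = i}" for xs
    using count_mset_map[of "\<lambda>x. x" xs i] by (simp add: length_filter_conv_card)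
  show ?thesis unfolding c using reflects_eq_iff[OF _ assms] by (auto intro: arg_cong[of _ _ card])
qed

text \<open>Each reflection exchanges the multiplicities of two neighbouring letters, so the
  multiplicity of \<open>l\<close> travels down to \<open>j\<close>.\<close>

lemma count_reflects: "j \<le> l \<Longrightarrow> cnt (reflects [j..<l] w) j = cnt w l"
proof (induction "l - j" arbitrary: j)
  case 0
  then show ?case by simp
next
  case (Suc d)
  let ?x = "reflects [Suc j..<l] w"
  have e: "reflects [j..<l] w = reflect j ?x" using Suc.hyps(2) by (simp add: upt_conv_Cons)
  have "cnt ?x (Suc j) = cnt w l" using Suc by simp
  moreover have "cnt (reflect j ?x) j + cnt (reflect j ?x) (Suc j) = cnt ?x j + cnt ?x (Suc j)"
    by (rule count_rematch_sum)
  ultimately show ?case using count_reflect[of j ?x] e by simp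
qed

lemma refl_charge_restrict:
  assumes "\<forall>x \<in> set w. x \<le> k" "k \<le> L"
  shows "refl_charge L w = refl_charge k w"
proof -
  have "opens i (reflects [Suc i..<l] w) = 0" if "k < l" "i < l" for i l
  proof -
    have "l \<notin> set w" using assms that by fastforce
    then have "cnt (reflects [Suc i..<l] w) (Suc i) = 0"
      using count_reflects[of "Suc i" l w] that by (simp add: count_eq_zero_iff)
    then show ?thesis using opens_le_count[of i "reflects [Suc i..<l] w"] by linarith
  qed
  then have "(\<Sum>i = 1..<l. opens i (reflects [Suc i..<l] w)) = 0" if "l \<in> {1..L} - {1..k}" for l
    using that by (intro sum.neutral) force
  moreover have "{1..k} \<subseteq> {1..L}" using assms(2) by simp
  ultimately show ?thesis unfolding refl_charge_def by (metis (no_types, lifting) finite_atLeastAtMost sum.mono_neutral_right)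
qed

section \<open>Removing the first charge subword\<close>

lemma next_pos_valid:
  assumes "p < length w" "j \<in> set w"
  shows "next_pos w p j < length w \<and> w ! next_pos w p j = j"
  by (rule next_pos_cases[OF assms]) (use assms in auto)

lemma next_pos_cong:
  assumes "length v = length w" "p < length w" "\<And>m. m < length w \<Longrightarrow> v ! m = j \<longleftrightarrow> w ! m = j"
  shows "next_pos v p j = next_pos w p j"
proof -
  have "filter (\<lambda>q. v ! q = j) xs = filter (\<lambda>q. w ! q = j) xs" if "set xs \<subseteq> {..<length w}" for xs
    using that assms(3) by (intro filter_cong) auto
  from this[of "[Suc p..<length w] @ [0..<Suc p]"] show ?thesis
    using assms(1,2) unfolding next_pos_def by (simp add: subset_iff del: upt_Suc filter_append)
qed

text \<open>The letter j of the first charge subword sits at position \<open>pf j\<close>. In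
  \<open>w0\<close> the subword is overwritten by the neutral letter 0, so the other letters keep
  their positions; \<open>counts\<close> supplies the hypothesis of \<open>pick\<close>.\<close>

context
  fixes w w0 :: "nat list" and k :: nat and pf :: "nat \<Rightarrow> nat"
  assumes pf: "\<And>j. 1 \<le> j \<Longrightarrow> j \<le> k \<Longrightarrow> pf j < length w \<and> w ! pf j = j"
    and pf_next: "\<And>j. 1 \<le> j \<Longrightarrow> j < k \<Longrightarrow> pf j = next_pos w (pf (Suc j)) j"
    and counts: "\<And>j l. 1 \<le> j \<Longrightarrow> j \<le> l \<Longrightarrow> l \<le> k \<Longrightarrow> cnt w l \<le> cnt w j"
    and w0: "length w0 = length w"
      "\<And>p. p < length w \<Longrightarrow> w0 ! p = (if p \<in> pf ` {1..k} then 0 else w ! p)"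
begin

text \<open>\<open>pick\<close> overwrites only the positions of j + 1 and j. The other letters of
  the subword are invisible to the bracketing for j, so by \<open>rematch_neutral\<close> the whole
  subword may be overwritten at once.\<close>

lemma zero_step:
  fixes V V0 :: "nat list"
  assumes j: "1 \<le> j" "j < k" and len: "length V = length w" "length V0 = length w"
    and V0: "\<And>p. p < length w \<Longrightarrow> V0 ! p = (if p \<in> pf ` {1..k} then 0 else V ! p)"
    and Vpf: "\<And>m. 1 \<le> m \<Longrightarrow> m \<le> k \<Longrightarrow> V ! pf m = m"
    and nx: "next_pos V (pf (Suc j)) j = pf j"
    and le: "cnt V (Suc j) \<le> cnt V j"
  shows "opens j V = opens j V0 + (if pf j < pf (Suc j) then 1 else 0)"
    and "\<And>p. p < length w \<Longrightarrow> reflect j V0 ! p = (if p \<in> pf ` {1..k} then 0 else reflect j V ! p)"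
    and "\<And>m. 1 \<le> m \<Longrightarrow> m \<le> k \<Longrightarrow> reflect j V ! pf m = m"
proof -
  let ?V1 = "V[pf (Suc j) := 0, pf j := 0]"
  have "pf (Suc j) < length V" "V ! pf (Suc j) = Suc j" using pf[of "Suc j"] Vpf[of "Suc j"] j len by auto
  note pk = pick[OF this j(1) le, unfolded nx]
  have inj: "pf m = pf m' \<longleftrightarrow> m = m'" if "1 \<le> m" "m \<le> k" "1 \<le> m'" "m' \<le> k" for m m'
    using Vpf[OF that(1,2)] Vpf[OF that(3,4)] by metis
  have V1pf: "?V1 ! pf m = (if m = j \<or> m = Suc j then 0 else m)" if "1 \<le> m" "m \<le> k" for m
  proof -
    have ne: "m \<noteq> j \<Longrightarrow> pf j \<noteq> pf m" "m \<noteq> Suc j \<Longrightarrow> pf (Suc j) \<noteq> pf m"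
      using inj[OF that, of j] inj[OF that, of "Suc j"] j by auto
    have "pf m < length V" using pf[OF that] len by simp
    then show ?thesis using ne Vpf[OF that] by (cases "m = j"; cases "m = Suc j") simp_all
  qed
  have V1o: "?V1 ! p = V ! p" if "p \<notin> pf ` {1..k}" for p
  proof -
    have "p \<noteq> pf j" "p \<noteq> pf (Suc j)" using that j by auto
    then show ?thesis by simp
  qed
  have neut: "?V1 ! p = V0 ! p \<or> (?V1 ! p \<notin> {j, Suc j} \<and> V0 ! p \<notin> {j, Suc j})" if "p < length V0" for p
  proof (cases "p \<in> pf ` {1..k}")
    case True
    then obtain m where "p = pf m" "1 \<le> m" "m \<le> k" by auto
    moreover have "V0 ! p = 0" using True V0 that len by simp
    ultimately show ?thesis using V1pf j by auto
  next
    case False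
    then show ?thesis using V0 V1o that len by simp
  qed
  have "length ?V1 = length V0" using len by simp
  from rematch_neutral[OF this neut] have n: "closes j ?V1 = closes j V0" "opens j ?V1 = opens j V0"
    "\<And>p. p < length V0 \<Longrightarrow> reflect j ?V1 ! p = (if ?V1 ! p \<in> {j, Suc j} then reflect j V0 ! p else ?V1 ! p)"
    by auto
  show "opens j V = opens j V0 + (if pf j < pf (Suc j) then 1 else 0)" using pk(4) n(2) by simp
  show "reflect j V ! pf m = m" if "1 \<le> m" "m \<le> k" for m
  proof -
    have "reflect j ?V1 ! pf m = ?V1 ! pf m" if "m \<noteq> j" "m \<noteq> Suc j"
      using n(3)[of "pf m"] V1pf[of m] that \<open>1 \<le> m\<close> \<open>m \<le> k\<close> pf[of m] len by auto
    then show ?thesis unfolding pk(5)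
      using inj[OF that, of j] inj[OF that, of "Suc j"] V1pf[OF that] j pk(1) pf[of j] pf[of "Suc j"] len
      by (auto simp: nth_list_update)
  qed
  show "reflect j V0 ! p = (if p \<in> pf ` {1..k} then 0 else reflect j V ! p)" if p: "p < length w" for p
  proof (cases "p \<in> pf ` {1..k}")
    case True
    then have "V0 ! p = 0" using V0 p by simp
    then show ?thesis using True rematch_nth_other[of p V0 j] p len j by simp
  next
    case False
    then have "p \<noteq> pf j" "p \<noteq> pf (Suc j)" using j by auto
    then have "reflect j V ! p = reflect j ?V1 ! p" unfolding pk(5) by simp
    moreover have "V0 ! p \<notin> {j, Suc j} \<Longrightarrow> reflect j V0 ! p = V0 ! p" using rematch_nth_other[of p V0 j] p len by simp
    ultimately show ?thesis using False n(3)[of p] V1o[OF False] V0[OF p] p len by auto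
  qed
qed

lemma zero_reflects:
  assumes "1 \<le> j" "j \<le> l" "l \<le> k"
  shows "(\<forall>p < length w. reflects [j..<l] w0 ! p = (if p \<in> pf ` {1..k} then 0 else reflects [j..<l] w ! p)) \<and>
    (\<forall>m. 1 \<le> m \<and> m \<le> k \<longrightarrow> reflects [j..<l] w ! pf m = m) \<and>
    (j < l \<longrightarrow> opens j (reflects [Suc j..<l] w) = opens j (reflects [Suc j..<l] w0) + (if pf j < pf (Suc j) then 1 else 0))"
  using assms
proof (induction "l - j" arbitrary: j)
  case 0
  then show ?case using w0 pf by simp
next
  case (Suc d)
  let ?V = "reflects [Suc j..<l] w" and ?Z = "reflects [Suc j..<l] w0"
  have jl: "j < l" using Suc.hyps(2) by simp
  have e: "reflects [j..<l] w = reflect j ?V" "reflects [j..<l] w0 = reflect j ?Z" using jl by (simp_all add: upt_conv_Cons)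
  have IH: "\<And>p. p < length w \<Longrightarrow> ?Z ! p = (if p \<in> pf ` {1..k} then 0 else ?V ! p)"
    "\<And>m. 1 \<le> m \<Longrightarrow> m \<le> k \<Longrightarrow> ?V ! pf m = m"
    using Suc.hyps(1)[of "Suc j"] Suc.hyps(2) Suc.prems jl by auto
  have len: "length ?V = length w" "length ?Z = length w" using w0 by auto
  have jk: "j < k" using jl Suc.prems by simp
  \<comment> \<open>Reflections with indices above j do not touch the letters j, so the search finds
    the same position as in \<open>w\<close>.\<close>
  have "next_pos ?V (pf (Suc j)) j = next_pos w (pf (Suc j)) j"
    by (intro next_pos_cong len reflects_eq_iff) (use pf[of "Suc j"] jk in auto)
  then have nx: "next_pos ?V (pf (Suc j)) j = pf j" using pf_next Suc.prems(1) jk by simp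
  have le: "cnt ?V (Suc j) \<le> cnt ?V j"
    using count_reflects[of "Suc j" l w] count_reflects_low[of j "Suc j" l w] counts[of j l] jl Suc.prems by simp
  note z = zero_step[OF Suc.prems(1) jk len IH nx le]
  show ?case unfolding e using z jl by blast
qed

text \<open>The wrap between j + 1 and j does not depend on l, hence is counted for l = j + 1, ...,
  m. This is the origin of the weight m - j in the charge.\<close>

lemma sum_triangle: "(\<Sum>l = 1..m. \<Sum>j = 1..<l. t j) = (\<Sum>j = 1..<m. (m - j) * t j)" for t :: "nat \<Rightarrow> nat"
proof (induction m)
  case (Suc m)
  have "(\<Sum>j = 1..<Suc m. (Suc m - j) * t j) = (\<Sum>j = 1..<Suc m. (m - j) * t j + t j)"
    by (intro sum.cong) (auto simp: Suc_diff_le)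
  also have "\<dots> = (\<Sum>j = 1..<Suc m. (m - j) * t j) + (\<Sum>j = 1..<Suc m. t j)"
    by (rule sum.distrib)
  also have "(\<Sum>j = 1..<Suc m. (m - j) * t j) = (\<Sum>j = 1..<m. (m - j) * t j)"
    by (cases m) simp_all
  finally show ?case using Suc by simp
qed simp

lemma refl_charge_zero:
  "refl_charge k w = refl_charge k w0 + (\<Sum>j = 1..<k. (k - j) * (if pf j < pf (Suc j) then 1 else 0))"
proof -
  have "refl_charge k w = (\<Sum>l = 1..k. \<Sum>j = 1..<l. opens j (reflects [Suc j..<l] w0) + (if pf j < pf (Suc j) then 1 else 0))"
    unfolding refl_charge_def using zero_reflects by (intro sum.cong refl) simp
  then show ?thesis unfolding refl_charge_def sum.distrib sum_triangle .
qed

end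

lemma rematch_filter:
  assumes "1 \<le> i"
  shows "closes i (filter (\<lambda>x. x \<noteq> 0) w) = closes i w \<and> opens i (filter (\<lambda>x. x \<noteq> 0) w) = opens i w \<and>
    (\<forall>a. rematch i a (filter (\<lambda>x. x \<noteq> 0) w) = filter (\<lambda>x. x \<noteq> 0) (rematch i a w))"
  using assms by (induction w) auto

lemma refl_charge_filter: "refl_charge L (filter (\<lambda>x. x \<noteq> 0) w) = refl_charge L w"
proof -
  have s: "reflects is (filter (\<lambda>x. x \<noteq> 0) w) = filter (\<lambda>x. x \<noteq> 0) (reflects is w)" if "0 \<notin> set is" for "is"
    using that
  proof (induction "is")
    case (Cons i "is")
    then have "1 \<le> i" by (cases i) auto
    then show ?case using Cons rematch_filter[of i "reflects is w"] by simp
  qed simp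
  have "opens i (reflects [Suc i..<l] (filter (\<lambda>x. x \<noteq> 0) w)) = opens i (reflects [Suc i..<l] w)" if "1 \<le> i" for i l
    using s[of "[Suc i..<l]"] rematch_filter[OF that] by simp
  then show ?thesis unfolding refl_charge_def by (intro sum.cong refl) simp
qed

lemma nths_filter: "nths w P = map ((!) w) (filter (\<lambda>p. p \<in> P) [0..<length w])"
proof (induction w rule: rev_induct)
  case (snoc x w)
  have "map ((!) (w @ [x])) (filter (\<lambda>p. p \<in> P) [0..<length w]) = map ((!) w) (filter (\<lambda>p. p \<in> P) [0..<length w])"
    by (intro map_cong) (auto simp: nth_append)
  then show ?case using snoc by (simp add: nths_append nths_singleton)
qed simp

text \<open>Indexes the chain of positions by letters; the value at \<open>Suc j\<close> is the
  starting position.\<close>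

lemma charge_chain_pf:
  "\<exists>pf. pf (Suc j) = p \<and> (\<forall>i \<in> {1..j}. pf i = next_pos w (pf (Suc i)) i) \<and>
     set (charge_chain w p j) = pf ` {1..j}"
proof (induction j arbitrary: p)
  case (Suc j)
  let ?q = "next_pos w p (Suc j)"
  obtain pf where pf: "pf (Suc j) = ?q" "\<forall>i \<in> {1..j}. pf i = next_pos w (pf (Suc i)) i"
    "set (charge_chain w ?q j) = pf ` {1..j}" using Suc by blast
  let ?pf = "pf(Suc (Suc j) := p)"
  have "\<forall>i \<in> {1..Suc j}. ?pf i = next_pos w (?pf (Suc i)) i"
  proof
    fix i assume "i \<in> {1..Suc j}"
    then consider "i = Suc j" | "i \<in> {1..j}" by fastforce
    then show "?pf i = next_pos w (?pf (Suc i)) i"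
      using pf(1,2) by cases auto
  qed
  moreover have "set (charge_chain w p (Suc j)) = ?pf ` {1..Suc j}"
  proof -
    have "?pf ` {1..Suc j} = pf ` {1..Suc j}" by (intro image_cong) auto
    also have "\<dots> = insert (pf (Suc j)) (pf ` {1..j})" by (simp add: atLeastAtMostSuc_conv)
    finally show ?thesis using pf(1,3) by (simp add: Let_def)
  qed
  ultimately show ?case by (intro exI[of _ ?pf]) simp
qed auto

text \<open>The positions listed in \<open>ps\<close> increase, so the order of two letters in the
  subword is the order of their positions in \<open>w\<close>.\<close>

lemma charge_perm_nths:
  assumes pf: "\<And>j. 1 \<le> j \<Longrightarrow> j \<le> k \<Longrightarrow> pf j < length w \<and> w ! pf j = j"
  shows "charge_perm (nths w (pf ` {1..k})) = (\<Sum>j = 1..<k. (k - j) * (if pf j < pf (Suc j) then 1 else 0))"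
proof -
  let ?P = "pf ` {1..k}"
  define ps where "ps = filter (\<lambda>p. p \<in> ?P) [0..<length w]"
  have n: "nths w ?P = map ((!) w) ps" by (simp add: ps_def nths_filter)
  have set: "set ps = ?P" using pf by (auto simp: ps_def)
  have srt: "sorted_wrt (<) ps" unfolding ps_def by (intro sorted_wrt_filter) simp
  have "inj_on pf {1..k}" using pf by (metis atLeastAtMost_iff inj_onI)
  then have "card ?P = k" by (simp add: card_image)
  moreover have "distinct ps" by (simp add: ps_def)
  ultimately have len: "length ps = k" using set distinct_card by fastforce
  have uniq: "p = pf i" if "p \<in> ?P" "w ! p = i" for p i using that pf by auto
  have iff: "(\<exists>a b. a < b \<and> b < length ps \<and> map ((!) w) ps ! a = i \<and> map ((!) w) ps ! b = Suc i) \<longleftrightarrow> pf i < pf (Suc i)"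
    if i: "1 \<le> i" "i < k" for i
  proof
    assume "\<exists>a b. a < b \<and> b < length ps \<and> map ((!) w) ps ! a = i \<and> map ((!) w) ps ! b = Suc i"
    then obtain a b where ab: "a < b" "b < length ps" "w ! (ps ! a) = i" "w ! (ps ! b) = Suc i" by auto
    then have "ps ! a = pf i" "ps ! b = pf (Suc i)" using uniq set by (metis nth_mem order.strict_trans)+
    then show "pf i < pf (Suc i)" using sorted_wrt_nth_less[OF srt ab(1,2)] by simp
  next
    assume lt: "pf i < pf (Suc i)"
    have "pf i \<in> set ps" "pf (Suc i) \<in> set ps" using i set by auto
    then obtain a b where ab: "a < length ps" "ps ! a = pf i" "b < length ps" "ps ! b = pf (Suc i)"
      by (metis in_set_conv_nth)
    have "a < b"
    proof (rule ccontr)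
      assume "\<not> a < b"
      then have "b = a \<or> b < a" by auto
      then show False using ab lt sorted_wrt_nth_less[OF srt, of b a] by auto
    qed
    then show "\<exists>a b. a < b \<and> b < length ps \<and> map ((!) w) ps ! a = i \<and> map ((!) w) ps ! b = Suc i"
      using ab pf[of i] pf[of "Suc i"] i by (intro exI[of _ a] exI[of _ b]) auto
  qed
  have "charge_perm (nths w ?P) = (\<Sum>i \<in> {i. 1 \<le> i \<and> i < k \<and> pf i < pf (Suc i)}. k - i)"
    unfolding charge_perm_def n length_map len using iff len by (intro sum.cong) auto
  also have "\<dots> = (\<Sum>j = 1..<k. (k - j) * (if pf j < pf (Suc j) then 1 else 0))"
    by (intro sum.mono_neutral_cong_left) auto
  finally show ?thesis .
qed

lemma mset_compl_union: "mset (filter P xs) + mset (filter (\<lambda>x. \<not> P x) xs) = mset xs"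
  by (induction xs) auto

lemma reflects_Nil: "reflects is [] = []"
  by (induction "is") auto

text \<open>One round removes a subword whose charge is exactly the loss computed in
  \<open>refl_charge_zero\<close>; the remaining word is \<open>w0\<close> without its zeros, and it
  is again of weakly decreasing content.\<close>

lemma charge_fuel_refl_charge:
  assumes "length w \<le> f" "0 \<notin> set w" "\<And>i. 1 \<le> i \<Longrightarrow> cnt w (Suc i) \<le> cnt w i"
    "\<forall>x \<in> set w. x \<le> L"
  shows "charge_fuel f w = refl_charge L w"
  using assms
proof (induction f arbitrary: w)
  case 0
  then show ?case by (simp add: refl_charge_def reflects_Nil)
next
  case (Suc f)
  show ?case
  proof (cases "w = []")
    case True
    then show ?thesis by (simp add: refl_charge_def reflects_Nil)
  next
    case False
    define k where "k = Max (set w)"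
    have k: "k \<in> set w" "\<And>x. x \<in> set w \<Longrightarrow> x \<le> k" using False by (simp_all add: k_def)
    then have "k \<noteq> 0" using Suc.prems(2) by metis
    then have k1: "1 \<le> k" by simp
    have counts: "cnt w l \<le> cnt w j" if "1 \<le> j" "j \<le> l" for j l
      using that(2)
    proof (induction rule: dec_induct)
      case (step m)
      then show ?case using Suc.prems(3)[of m] that(1) by (meson le_trans)
    qed simp
    have inw: "j \<in> set w" if "1 \<le> j" "j \<le> k" for j
    proof -
      have "0 < cnt w k" using k(1) by simp
      then have "0 < cnt w j" using counts[OF that] by linarith
      then show ?thesis by simp
    qed
    define p where "p = hd (filter (\<lambda>q. w ! q = k) [0..<length w])"
    have "filter (\<lambda>q. w ! q = k) [0..<length w] \<noteq> []"
      using k(1) by (auto simp: filter_empty_conv in_set_conv_nth)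
    then have "p \<in> set (filter (\<lambda>q. w ! q = k) [0..<length w])" unfolding p_def by (rule hd_in_set)
    then have p: "p < length w" "w ! p = k" by auto
    obtain pf where pf: "pf k = p" "\<And>i. 1 \<le> i \<Longrightarrow> i < k \<Longrightarrow> pf i = next_pos w (pf (Suc i)) i"
      "set (charge_chain w p (k - 1)) = pf ` {1..k - 1}"
      using charge_chain_pf[of "k - 1" p w] k1 by auto
    have P: "charge_positions w = pf ` {1..k}"
    proof -
      have "{1..k} = insert k {1..k - 1}" using k1 by auto
      then show ?thesis using pf by (simp add: charge_positions_def Let_def k_def[symmetric] p_def[symmetric])
    qed
    have pfw: "pf j < length w \<and> w ! pf j = j" if "1 \<le> j" "j \<le> k" for j
      using that(2,1)
    proof (induction rule: inc_induct)
      case base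
      then show ?case using p pf by simp
    next
      case (step m)
      then show ?case using next_pos_valid[of "pf (Suc m)" w m] pf(2)[of m] inw[of m] by simp
    qed
    define w0 where "w0 = map (\<lambda>q. if q \<in> pf ` {1..k} then 0 else w ! q) [0..<length w]"
    have w0: "length w0 = length w" "\<And>q. q < length w \<Longrightarrow> w0 ! q = (if q \<in> pf ` {1..k} then 0 else w ! q)"
      by (auto simp: w0_def)
    let ?w' = "nths w (- pf ` {1..k})"
    have w': "?w' = filter (\<lambda>x. x \<noteq> 0) w0"
    proof -
      have nz: "w ! q \<noteq> 0" if "q < length w" for q using that Suc.prems(2) by (metis nth_mem)
      have "filter (\<lambda>x. x \<noteq> 0) w0 = map (\<lambda>q. if q \<in> pf ` {1..k} then 0 else w ! q) 
         (filter (\<lambda>q. q \<in> - pf ` {1..k}) [0..<length w])"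
        unfolding w0_def filter_map o_def
        using nz by (intro arg_cong[of _ _ "map _"] filter_cong) auto
      then show ?thesis by (simp add: nths_filter cong: map_cong)
    qed
    have ch: "refl_charge k w = refl_charge k ?w' + charge_perm (nths w (pf ` {1..k}))"
      using refl_charge_zero[OF pfw pf(2) counts w0] charge_perm_nths[OF pfw] refl_charge_filter[of k w0] w' by simp
    have mw: "mset w = mset ?w' + mset_set {1..k}"
    proof -
      have inj: "inj_on pf {1..k}" using pfw by (metis atLeastAtMost_iff inj_onI)
      let ?f = "\<lambda>A. filter (\<lambda>q. q \<in> A) [0..<length w]"
      have "mset (?f (pf ` {1..k})) = mset_set (pf ` {1..k})"
        using pfw by (subst mset_set_set[symmetric]) (auto intro!: arg_cong[of _ _ mset_set])
      also have "\<dots> = image_mset pf (mset_set {1..k})" by (rule image_mset_mset_set[OF inj, symmetric])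
      finally have "mset (nths w (pf ` {1..k})) = image_mset (\<lambda>j. w ! pf j) (mset_set {1..k})"
        by (simp add: nths_filter multiset.map_comp o_def)
      also have "\<dots> = image_mset (\<lambda>j. j) (mset_set {1..k})" using pfw by (intro image_mset_cong) auto
      finally have m: "mset (nths w (pf ` {1..k})) = mset_set {1..k}" by simp
      have "mset w = image_mset ((!) w) (mset [0..<length w])"
        by (metis map_nth mset_map)
      also have "mset [0..<length w] = mset (?f (- pf ` {1..k})) + mset (?f (pf ` {1..k}))"
        using mset_compl_union[of "\<lambda>q. q \<in> - pf ` {1..k}" "[0..<length w]"]
        unfolding Compl_iff not_not by (rule sym)
      finally show ?thesis using m by (simp add: nths_filter)
    qed
    have ce: "cnt ?w' j = cnt w j - (if 1 \<le> j \<and> j \<le> k then 1 else 0)" for j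
      unfolding mw by (auto simp: count_mset_set')
    have sub: "set ?w' \<subseteq> set w" by (rule set_nths_subset)
    have "charge_fuel f ?w' = refl_charge L ?w'"
    proof (rule Suc.IH)
      have "size (mset w) = size (mset ?w') + k" unfolding mw by simp
      then show "length ?w' \<le> f" using Suc.prems(1) k1 by simp
      show "cnt ?w' (Suc i) \<le> cnt ?w' i" if "1 \<le> i" for i
      proof (cases "i = k")
        \<comment> \<open>The letter k has lost an occurrence, but k + 1 does not occur at
          all.\<close>
        case True
        then have "Suc i \<notin> set w" using k(2) by (meson Suc_n_not_le_n)
        then have "cnt w (Suc i) = 0" by (simp add: count_eq_zero_iff)
        then show ?thesis unfolding ce[of "Suc i"] by linarith
      next
        case False
        then show ?thesis using Suc.prems(3)[OF that] that unfolding ce by auto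
      qed
    qed (use sub Suc.prems in auto)
    moreover have "refl_charge L w = refl_charge k w" "refl_charge L ?w' = refl_charge k ?w'"
      using k(2) sub Suc.prems(4) k(1) by (auto intro!: refl_charge_restrict)
    ultimately show ?thesis using False ch P by simp
  qed
qed

lemma charge_word_eq_refl_charge:
  assumes "0 \<notin> set w" "\<And>i. 1 \<le> i \<Longrightarrow> cnt w (Suc i) \<le> cnt w i"
    "\<forall>x \<in> set w. x \<le> L"
  shows "charge_word w = refl_charge L w"
  unfolding charge_word_def using charge_fuel_refl_charge[OF _ assms] by simp

section \<open>Binary matrices and their column words\<close>

definition col_word :: "nat set list \<Rightarrow> nat \<Rightarrow> nat list" where
  "col_word B j = filter (\<lambda>r. j \<in> B ! (r - 1)) (rev [1..<length B + 1])"

lemma cwp_col_word: "cwp n B = concat (map (\<lambda>j. map (Pair j) (col_word B j)) [1..<n + 1])"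
  by (simp add: cwp_def col_word_def)

lemma cw_col_word: "cw n B = concat (map (col_word B) [1..<n + 1])"
  by (simp add: cw_def cwp_col_word map_concat o_def del: upt_Suc)

lemma set_col_word: "set (col_word B j) = {r. 1 \<le> r \<and> r \<le> length B \<and> j \<in> B ! (r - 1)}"
  by (auto simp: col_word_def)

lemma col_word_decreasing: "sorted_wrt (>) (col_word B j)"
  unfolding col_word_def by (intro sorted_wrt_filter) (simp add: sorted_wrt_rev del: upt_Suc)

lemma decreasing_unique:
  fixes xs ys :: "nat list"
  assumes "sorted_wrt (>) xs" "sorted_wrt (>) ys" "set xs = set ys"
  shows "xs = ys"
proof -
  have "sorted_wrt (<) (rev xs)" "sorted_wrt (<) (rev ys)" using assms by (simp_all add: sorted_wrt_rev)
  then have "rev xs = rev ys" using assms(3)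
    by (metis strict_sorted_equal set_rev)
  then show ?thesis by simp
qed

lemma set_cwp:
  assumes "B \<in> binmat L n"
  shows "set (cwp n B) = {(j, r). 1 \<le> r \<and> r \<le> L \<and> j \<in> B ! (r - 1)}"
proof -
  have B: "length B = L" "\<And>r. r < L \<Longrightarrow> B ! r \<subseteq> {1..n}" using assms by (auto simp: binmat_def)
  have "j \<in> {1..<n + 1}" if "1 \<le> r" "r \<le> L" "j \<in> B ! (r - 1)" for j r
  proof -
    have "r - 1 < L" using that by simp
    then have "j \<in> {1..n}" using B(2) that(3) by blast
    then show ?thesis by simp
  qed
  moreover have "(j, r) \<in> set (cwp n B) \<longleftrightarrow> j \<in> {1..<n + 1} \<and> r \<in> set (col_word B j)" for j r
    unfolding cwp_col_word set_concat set_map set_upt by auto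
  ultimately show ?thesis unfolding set_col_word B(1) by auto
qed

lemma distinct_cwp: "distinct (cwp n B)"
proof -
  have "distinct (col_word B j)" for j by (simp add: col_word_def)
  then have d: "distinct (map (Pair j) (col_word B j))" for j by (simp add: distinct_map inj_on_def)
  have "distinct (concat (map (\<lambda>j. map (Pair j) (col_word B j)) js))" if "distinct js" for js
    using that
  proof (induction js)
    case (Cons j js)
    then show ?case using d[of j] by auto
  qed simp
  then show ?thesis unfolding cwp_col_word by simp
qed

lemma cwp_inj:
  assumes "B \<in> binmat L n" "B' \<in> binmat L n" "cwp n B = cwp n B'"
  shows "B = B'"
proof (rule nth_equalityI)
  show "length B = length B'" using assms by (simp add: binmat_def)
  fix r assume "r < length B"
  then have "r < L" using assms by (simp add: binmat_def)
  then have "j \<in> B ! r \<longleftrightarrow> (j, Suc r) \<in> set (cwp n B)" "j \<in> B' ! r \<longleftrightarrow> (j, Suc r) \<in> set (cwp n B')" for j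
    using set_cwp[OF assms(1)] set_cwp[OF assms(2)] by auto
  then show "B ! r = B' ! r" using assms(3) by auto
qed

lemma cwp_zip: "cwp n B = zip (map fst (cwp n B)) (cw n B)"
  by (simp add: cw_def zip_map_fst_snd)

text \<open>Reduces a rewriting of the column word to rewritings of single columns.\<close>

lemma rematch_concat:
  "a \<le> free i (concat ds) \<Longrightarrow> \<exists>as. length as = length ds \<and> (\<forall>j < length ds. as ! j \<le> free i (ds ! j)) \<and>
     rematch i a (concat ds) = concat (map2 (rematch i) as ds)"
proof (induction ds arbitrary: a)
  case (Cons d ds)
  define m b where "m = min (opens i d) (closes i (concat ds))" and "b = min a (free i (concat ds) - m)"
  have a: "a \<le> free i (d @ concat ds)" using Cons.prems by simp
  have b: "b \<le> free i (concat ds)" by (simp add: b_def)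
  have c: "m + a - b \<le> free i d" using a by (auto simp: b_def m_def closes_append opens_append)
  obtain as where as: "length as = length ds" "\<forall>j < length ds. as ! j \<le> free i (ds ! j)"
    "rematch i b (concat ds) = concat (map2 (rematch i) as ds)" using Cons.IH[OF b] by blast
  have "rematch i a (d @ concat ds) = rematch i (m + a - b) d @ concat (map2 (rematch i) as ds)"
    using rematch_append[OF a] as(3) by (simp add: m_def b_def)
  then show ?case using as(1,2) c
    by (intro exI[of _ "(m + a - b) # as"]) (auto simp: less_Suc_eq_0_disj)
qed simp

lemma rematch_none: "i \<notin> set w \<Longrightarrow> Suc i \<notin> set w \<Longrightarrow> rematch i a w = w"
  by (induction w arbitrary: a) auto

lemma set_rematch: "set (rematch i a w) \<subseteq> set w \<union> {i, Suc i}"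
  by (induction w arbitrary: a) auto

text \<open>A strictly decreasing word has at most one i + 1 and one i; if both occur they match and
  stay. So at most one letter changes, between i and i + 1, and the word stays decreasing.\<close>

lemma rematch_decreasing:
  "sorted_wrt (>) d \<Longrightarrow> a \<le> free i d \<Longrightarrow> sorted_wrt (>) (rematch i a d)"
proof (induction d arbitrary: a)
  case (Cons x d)
  have x: "\<forall>y \<in> set d. y < x" and d: "sorted_wrt (>) d" using Cons.prems by auto
  consider "x < i \<or> x = i" | "x = Suc i" "i \<notin> set d" | "x = Suc i" "i \<in> set d" | "x > Suc i"
    by linarith
  then show ?case
  proof cases
    case 1
    then have "i \<notin> set d" "Suc i \<notin> set d" using x by fastforce+
    then show ?thesis using x d 1 by (auto simp: rematch_none)
  next
    case 2
    then have "i \<notin> set d" "Suc i \<notin> set d" using x by fastforce+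
    then have "rematch i b d = d" for b by (rule rematch_none)
    moreover have "\<forall>y \<in> set d. y < i" using x 2 by (metis less_antisym)
    ultimately show ?thesis using x d 2 by auto
  next
    case 3
    have s: "Suc i \<notin> set d" using x 3 by blast
    have "distinct d" using d by (metis distinct_rev sorted_wrt_rev strict_sorted_iff)
    then have c: "cnt d i = 1" using 3 by (simp add: distinct_count_atmost_1)
    have "opens i d = 0" using opens_le_count[of i d] s by (simp add: count_eq_zero_iff[THEN iffD2])
    then have "closes i d = 1" using count_balance[of d i] c s by (simp add: count_eq_zero_iff[THEN iffD2])
    then have "a = 0" "opens i d = 0" "closes i d = 1" using Cons.prems(2) 3 \<open>opens i d = 0\<close> by auto
    moreover have "rematch i 0 d = d" using rematch_opens[of i d] \<open>opens i d = 0\<close> by simp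
    ultimately show ?thesis using x d 3 by auto
  next
    case 4
    then have "a \<le> free i d" using Cons.prems by simp
    then have "sorted_wrt (>) (rematch i a d)" using Cons.IH d by blast
    then show ?thesis using 4 x set_rematch[of i a d] by fastforce
  qed
qed simp

text \<open>Stated for every parameter, not only for the collapse, since surjectivity needs matrices
  for the inverse steps too. Each column keeps its number of balls, which is why the columns of the
  letters persist.\<close>

lemma rematch_binmat:
  assumes B: "B \<in> binmat L n" and i: "1 \<le> i" "i < L" and a: "a \<le> free i (cw n B)"
  shows "\<exists>B' \<in> binmat L n. map fst (cwp n B') = map fst (cwp n B) \<and> cw n B' = rematch i a (cw n B)"
proof -
  define ds where "ds = map (col_word B) [1..<n + 1]"
  have lB: "length B = L" using B by (simp add: binmat_def)
  have lds: "length ds = n" by (simp add: ds_def del: upt_Suc)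
  have cw: "cw n B = concat ds" by (simp add: cw_col_word ds_def)
  obtain as where as: "length as = n" "\<And>j. j < n \<Longrightarrow> as ! j \<le> free i (ds ! j)"
    "rematch i a (cw n B) = concat (map2 (rematch i) as ds)" using rematch_concat[of a i ds] a cw lds by auto
  define es where "es = map2 (rematch i) as ds"
  have les: "length es = n" using as lds by (simp add: es_def)
  have es: "es ! j = rematch i (as ! j) (col_word B (Suc j))" "length (es ! j) = length (col_word B (Suc j))"
    "sorted_wrt (>) (es ! j)" "set (es ! j) \<subseteq> {1..L}" if "j < n" for j
  proof -
    have dj: "ds ! j = col_word B (Suc j)" using that by (simp add: ds_def del: upt_Suc)
    show e: "es ! j = rematch i (as ! j) (col_word B (Suc j))" using that as lds dj by (simp add: es_def)
    show "length (es ! j) = length (col_word B (Suc j))" by (simp add: e)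
    show "sorted_wrt (>) (es ! j)" unfolding e
      using as(2)[OF that] dj by (intro rematch_decreasing col_word_decreasing) simp
    show "set (es ! j) \<subseteq> {1..L}" unfolding e
      using set_rematch[of i "as ! j" "col_word B (Suc j)"] i lB set_col_word[of B "Suc j"] by fastforce
  qed
  define B' where "B' = map (\<lambda>r. {j \<in> {1..n}. Suc r \<in> set (es ! (j - 1))}) [0..<L]"
  have lB': "length B' = L" by (simp add: B'_def)
  have B': "B' \<in> binmat L n" by (auto simp: binmat_def B'_def)
  have col: "col_word B' (Suc j) = es ! j" if "j < n" for j
  proof (rule decreasing_unique[OF col_word_decreasing es(3)[OF that]])
    have "B' ! (r - 1) = {j \<in> {1..n}. r \<in> set (es ! (j - 1))}" if "1 \<le> r" "r \<le> L" for r
      using that by (simp add: B'_def)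
    then have "r \<in> set (col_word B' (Suc j)) \<longleftrightarrow> r \<in> set (es ! j)" for r
      using es(4)[OF that] that unfolding set_col_word lB' by auto
    then show "set (col_word B' (Suc j)) = set (es ! j)" by blast
  qed
  have upt: "[1..<n + 1] = map Suc [0..<n]" by (simp add: map_Suc_upt)
  have "cw n B' = concat es"
    unfolding cw_col_word upt map_map o_def
    using col les by (intro arg_cong[of _ _ concat] nth_equalityI) auto
  then have "cw n B' = rematch i a (cw n B)" using as(3) by (simp add: es_def)
  moreover have "map fst (cwp n B') = map fst (cwp n B)"
    unfolding cwp_col_word upt map_map o_def map_concat
    using col es(2) by (intro arg_cong[of _ _ concat]) (auto simp: map_replicate_const)
  ultimately show ?thesis using B' by blast
qed

section \<open>Collapsing operators on matrices\<close>

lemma par_stack_append: "par_stack i ps s = par_stack i ps [] @ drop (closes i (map snd ps)) s"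
proof (induction ps arbitrary: s)
  case (Cons p ps)
  obtain j r where p: "p = (j, r)" by (cases p)
  have 1: "par_stack i ps (j # s) = par_stack i ps [] @ drop (closes i (map snd ps)) (j # s)" for s
    by (rule Cons.IH)
  have 2: "par_stack i ps (drop 1 s) = par_stack i ps [] @ drop (closes i (map snd ps)) (drop 1 s)" for s
    by (rule Cons.IH)
  show ?case
  proof (cases "r = Suc i")
    case True
    then show ?thesis unfolding p using 1[of s] 1[of "[]"] by (cases "closes i (map snd ps)") auto
  next
    case False
    show ?thesis
    proof (cases "r = i")
      case True
      then show ?thesis unfolding p using 2[of s] by simp
    next
      case F: False
      then show ?thesis unfolding p using False Cons.IH[of s] by simp
    qed
  qed
qed simp

lemma par_stack_subset: "set (par_stack i ps []) \<subseteq> {j. (j, Suc i) \<in> set ps}"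
proof (induction ps)
  case (Cons p ps)
  obtain j r where p: "p = (j, r)" by (cases p)
  show ?case using Cons par_stack_append[of i ps "[j]"] set_drop_subset[of "closes i (map snd ps)" "[j]"]
    unfolding p by (fastforce split: if_splits)
qed simp

text \<open>A column occurs at most once together with the letter i + 1, by distinctness; hence the
  set of columns on the stack identifies the unmatched letters.\<close>

lemma zip_rematch_par_stack:
  assumes "distinct ps"
  shows "zip (map fst ps) (rematch i 0 (map snd ps)) =
    map (\<lambda>(j, r). (j, if r = Suc i \<and> j \<in> set (par_stack i ps []) then i else r)) ps"
  using assms
proof (induction ps)
  case (Cons p ps)
  obtain j r where p: "p = (j, r)" by (cases p)
  let ?U = "set (par_stack i ps [])"
  have IH: "zip (map fst ps) (rematch i 0 (map snd ps)) =
    map (\<lambda>(j, r). (j, if r = Suc i \<and> j \<in> ?U then i else r)) ps" using Cons by simp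
  show ?case
  proof (cases "r = Suc i")
    case True
    have nin: "(j, Suc i) \<notin> set ps" using Cons.prems p True by simp
    then have j: "j \<notin> ?U" using par_stack_subset by blast
    have st: "par_stack i (p # ps) [] = par_stack i ps [] @ drop (closes i (map snd ps)) [j]"
      unfolding p using True par_stack_append[of i ps "[j]"] by simp
    have cong: "map (\<lambda>(j, r). (j, if r = Suc i \<and> j \<in> insert j' ?U then i else r)) ps =
        map (\<lambda>(j, r). (j, if r = Suc i \<and> j \<in> ?U then i else r)) ps" if "j' = j" for j'
      using nin that by (intro map_cong) auto
    show ?thesis
    proof (cases "closes i (map snd ps) = 0")
      case T: True
      then have "set (par_stack i (p # ps) []) = insert j ?U" using st by simp
      then show ?thesis using T True IH cong[OF refl] by (simp add: p)
    next
      case F: False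
      then have "set (par_stack i (p # ps) []) = ?U" using st by (cases "closes i (map snd ps)") auto
      then show ?thesis using F True IH j by (simp add: p)
    qed
  next
    case False
    have "par_stack i (p # ps) [] = par_stack i ps []" unfolding p using False by simp
    then show ?thesis using False IH by (simp add: p)
  qed
qed simp

lemma estar_binmat:
  assumes B: "B \<in> binmat L n" and i: "1 \<le> i" "i < L"
  shows "estar n i B \<in> binmat L n \<and> map fst (cwp n (estar n i B)) = map fst (cwp n B) \<and>
    cw n (estar n i B) = rematch i 0 (cw n B)"
proof -
  obtain B' where B': "B' \<in> binmat L n" "map fst (cwp n B') = map fst (cwp n B)"
    "cw n B' = rematch i 0 (cw n B)" using rematch_binmat[OF B i, of 0] by auto
  let ?U = "unmatched_cols n i B" and ?ps = "cwp n B"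
  have U: "?U = set (par_stack i ?ps [])" by (simp add: unmatched_cols_def)
  have "cwp n B' = zip (map fst ?ps) (rematch i 0 (map snd ?ps))"
    using cwp_zip[of n B'] B' by (simp add: cw_def)
  also have "\<dots> = map (\<lambda>(j, r). (j, if r = Suc i \<and> j \<in> ?U then i else r)) ?ps"
    unfolding U by (rule zip_rematch_par_stack[OF distinct_cwp])
  finally have ps': "set (cwp n B') = (\<lambda>(j, r). (j, if r = Suc i \<and> j \<in> ?U then i else r)) ` set ?ps"
    by simp
  have len: "length B = L" "length B' = L" using B B' by (auto simp: binmat_def)
  have UB: "?U \<subseteq> B ! i"
    using par_stack_subset[of i ?ps] i unfolding U set_cwp[OF B] by auto
  have "estar n i B = B'"
  proof (rule nth_equalityI)
    show "length (estar n i B) = length B'" using len by (simp add: estar_def Let_def)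
    fix r assume "r < length (estar n i B)"
    then have r: "r < L" using len by (simp add: estar_def Let_def)
    have P: "(j, Suc m) \<in> set ?ps \<longleftrightarrow> j \<in> B ! m" if "m < L" for j m
      using set_cwp[OF B] that by auto
    have E: "estar n i B ! r = (if Suc r = i then B ! r \<union> ?U else if r = i then B ! r - ?U else B ! r)"
      using r i len by (auto simp: estar_def Let_def nth_list_update)
    have "j \<in> B' ! r \<longleftrightarrow> j \<in> estar n i B ! r" for j
    proof -
      have "j \<in> B' ! r \<longleftrightarrow> (j, Suc r) \<in> set (cwp n B')" using set_cwp[OF B'(1)] r by auto
      also have "\<dots> \<longleftrightarrow> (\<exists>m. (j, m) \<in> set ?ps \<and> Suc r = (if m = Suc i \<and> j \<in> ?U then i else m))"
        unfolding ps' by force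
      also have "\<dots> \<longleftrightarrow> (j, Suc r) \<in> set ?ps \<and> \<not> (r = i \<and> j \<in> ?U) \<or>
          Suc r = i \<and> (j, Suc i) \<in> set ?ps \<and> j \<in> ?U"
        by (auto split: if_splits)
      also have "\<dots> \<longleftrightarrow> j \<in> B ! r \<and> \<not> (r = i \<and> j \<in> ?U) \<or> Suc r = i \<and> j \<in> B ! i \<and> j \<in> ?U"
        using P[OF r] P[OF i(2)] by simp
      also have "\<dots> \<longleftrightarrow> j \<in> estar n i B ! r" unfolding E using UB by auto
      finally show ?thesis .
    qed
    then show "estar n i B ! r = B' ! r" by blast
  qed
  then show ?thesis using B' by simp
qed

lemma foldr_estar:
  assumes B: "B \<in> binmat L n" and "is": "\<forall>i \<in> set is. 1 \<le> i \<and> i < L"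
  shows "foldr (estar n) is B \<in> binmat L n \<and> map fst (cwp n (foldr (estar n) is B)) = map fst (cwp n B) \<and>
    cw n (foldr (estar n) is B) = raise_seq is (cw n B)"
  using "is"
proof (induction "is")
  case (Cons i "is")
  then show ?case using estar_binmat[of "foldr (estar n) is B" L n i] by auto
qed (use B in simp)

lemma collapse_pre_foldr: "collapse_pre n k B = foldr (estar n) (collapse_seq k) B"
  by (induction k) (simp_all add: estar_int_def)

lemma set_collapse_seq: "i \<in> set (collapse_seq k) \<Longrightarrow> 1 \<le> i \<and> i < k"
  by (induction k) auto

lemma collapse_binmat:
  assumes B: "B \<in> binmat L n" and k: "k \<le> L"
  shows "collapse_pre n k B \<in> binmat L n" "map fst (cwp n (collapse_pre n k B)) = map fst (cwp n B)"
    "cw n (collapse_pre n k B) = raise_seq (collapse_seq k) (cw n B)"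
proof -
  have "\<forall>i \<in> set (collapse_seq k). 1 \<le> i \<and> i < L" using set_collapse_seq[of _ k] k by fastforce
  from foldr_estar[OF B this]
  show "collapse_pre n k B \<in> binmat L n" "map fst (cwp n (collapse_pre n k B)) = map fst (cwp n B)"
    "cw n (collapse_pre n k B) = raise_seq (collapse_seq k) (cw n B)"
    unfolding collapse_pre_foldr by blast+
qed

lemma card_row:
  assumes B: "B \<in> binmat L n" and r: "1 \<le> r" "r \<le> L"
  shows "card (B ! (r - 1)) = cnt (cw n B) r"
proof -
  have "cnt (cw n B) r = length (filter (\<lambda>p. snd p = r) (cwp n B))"
    unfolding cw_def by (rule count_mset_map)
  also have "\<dots> = card (set (filter (\<lambda>p. snd p = r) (cwp n B)))"
    using distinct_cwp by (intro distinct_card[symmetric]) simp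
  also have "set (filter (\<lambda>p. snd p = r) (cwp n B)) = (\<lambda>j. (j, r)) ` (B ! (r - 1))"
    using set_cwp[OF B] r by auto
  also have "card \<dots> = card (B ! (r - 1))" by (intro card_image) (simp add: inj_on_def)
  finally show ?thesis by simp
qed

lemma rhoQ_recording_tab:
  assumes B: "B \<in> binmat L n"
  shows "rhoQ n B = strip_tab (recording_tab L (cw n B))"
proof -
  have L: "length B = L" using B by (simp add: binmat_def)
  have N: "Ncard n B i r = collapse_count (cw n B) i r" if "i \<le> L" for i r
    using card_row[OF collapse_binmat(1)[OF B that], of r] collapse_binmat(3)[OF B that] that
    by (simp add: Ncard_def collapse_count_def)
  have "map (\<lambda>i. replicate (Ncard n B i r - Ncard n B (i - 1) r) i) [1..<L + 1]
      = map (\<lambda>i. replicate (collapse_count (cw n B) i r - collapse_count (cw n B) (i - 1) r) i) [1..<L + 1]" for r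
    by (intro map_cong refl) (auto simp: N)
  then show ?thesis unfolding rhoQ_def recording_tab_def L by (simp only:)
qed

lemma xmon_cwp:
  assumes B: "B \<in> binmat L n"
  shows "xmon B = mset (map fst (cwp n B))"
proof (rule multiset_eqI)
  fix j
  have L: "length B = L" using B by (simp add: binmat_def)
  have fin: "finite (B ! r)" if "r < L" for r using B that finite_subset by (fastforce simp: binmat_def)
  have "count (xmon B) j = (\<Sum>r < L. count (mset_set (B ! r)) j)"
    by (simp add: xmon_def L count_sum)
  also have "\<dots> = (\<Sum>r < L. if j \<in> B ! r then 1 else 0)"
    using fin by (intro sum.cong) (auto simp: count_mset_set')
  also have "\<dots> = card {r \<in> {..<L}. j \<in> B ! r}" by (simp add: sum.If_cases Int_def)
  also have "\<dots> = card ((\<lambda>r. (j, Suc r)) ` {r \<in> {..<L}. j \<in> B ! r})"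
    by (intro card_image[symmetric]) (simp add: inj_on_def)
  also have "(\<lambda>r. (j, Suc r)) ` {r \<in> {..<L}. j \<in> B ! r} = set (filter (\<lambda>p. fst p = j) (cwp n B))"
  proof -
    have "(a, b) \<in> (\<lambda>r. (j, Suc r)) ` {r \<in> {..<L}. j \<in> B ! r} \<longleftrightarrow> a = j \<and> 1 \<le> b \<and> b \<le> L \<and> j \<in> B ! (b - 1)" for a b
      by (cases b) auto
    then show ?thesis using set_cwp[OF B] by auto
  qed
  also have "card \<dots> = length (filter (\<lambda>p. fst p = j) (cwp n B))"
    using distinct_cwp by (intro distinct_card) simp
  finally show "count (xmon B) j = count (mset (map fst (cwp n B))) j" unfolding count_mset_map .
qed

section \<open>The major index\<close>

lemma block_less:
  fixes a b x y m :: nat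
  assumes "x < m" "y < m"
  shows "a * m + x < b * m + y \<longleftrightarrow> a < b \<or> a = b \<and> x < y"
proof -
  have "a * m + m \<le> b * m" if "a < b" for a b :: nat
    using mult_le_mono1[of "Suc a" b m] that by simp
  from this[of a b] this[of b a] show ?thesis using assms by (cases a b rule: linorder_cases) auto
qed

lemma nth_concat_blocks:
  "\<forall>xs \<in> set xss. length xs = m \<Longrightarrow> q < length xss \<Longrightarrow> s < m \<Longrightarrow> concat xss ! (q * m + s) = xss ! q ! s"
proof (induction xss arbitrary: q)
  case (Cons xs xss)
  show ?case
  proof (cases q)
    case 0
    then show ?thesis using Cons.prems by (simp add: nth_append)
  next
    case (Suc q')
    then have "concat xss ! (q' * m + s) = xss ! q' ! s" using Cons by simp
    then show ?thesis using Suc Cons.prems by (simp add: nth_append add.assoc)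
  qed
qed simp

lemma length_concat_blocks:
  "\<forall>xs \<in> set xss. length xs = m \<Longrightarrow> length (concat xss) = length xss * m"
  by (induction xss) auto

text \<open>Position in the column reading, counted from 0: within column \<open>c\<close>,
  \<open>L - r\<close> cells lie above row \<open>r\<close>.\<close>

definition cell :: "nat \<Rightarrow> nat \<Rightarrow> nat \<Rightarrow> nat" where
  "cell L c r = (c - 1) * L + (L - r)"

text \<open>Empty cells are recorded as 0, so a ball in column \<open>c\<close> and row \<open>r\<close> sits at index \<open>cell L c r\<close>.\<close>

definition padded :: "nat \<Rightarrow> nat set list \<Rightarrow> nat list" where
  "padded n M = concat (map (\<lambda>j. map (\<lambda>r. if j \<in> M ! (r - 1) then r else 0) (rev [1..<length M + 1])) [1..<n + 1])"

lemma filter_padded: "filter (\<lambda>x. x \<noteq> 0) (padded n M) = cw n M"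
proof -
  have "filter (\<lambda>x. x \<noteq> 0) (map (\<lambda>r. if j \<in> M ! (r - 1) then r else 0) xs) = filter (\<lambda>r. j \<in> M ! (r - 1)) xs"
    if "0 \<notin> set xs" for j xs
    using that by (induction xs) auto
  from this[of "rev [1..<length M + 1]"] show ?thesis
    unfolding padded_def cw_col_word col_word_def filter_concat map_map o_def by (simp del: upt_Suc)
qed

lemma cell_less:
  assumes "1 \<le> r" "r \<le> L" "1 \<le> r'" "r' \<le> L" "1 \<le> c" "1 \<le> d"
  shows "cell L c r < cell L d r' \<longleftrightarrow> c < d \<or> c = d \<and> r' < r"
  unfolding cell_def using block_less[of "L - r" L "L - r'" "c - 1" "d - 1"] assms by auto

lemma cell_eq:
  assumes "1 \<le> r" "r \<le> L" "1 \<le> r'" "r' \<le> L" "1 \<le> c" "1 \<le> d"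
  shows "cell L c r = cell L d r' \<longleftrightarrow> c = d \<and> r = r'"
  using cell_less[OF assms] cell_less[OF assms(3,4,1,2,6,5)] by (metis linorder_neqE_nat nat_neq_iff)

lemma cell_bound:
  assumes "1 \<le> r" "r \<le> L" "1 \<le> c" "c \<le> n"
  shows "cell L c r < n * L"
proof -
  have "Suc (c - 1) * L \<le> n * L" by (rule mult_le_mono1) (use assms in simp)
  then have "(c - 1) * L + L \<le> n * L" unfolding mult_Suc by linarith
  then show ?thesis using assms unfolding cell_def by linarith
qed

lemma length_padded: "length (padded n M) = n * length M"
  unfolding padded_def by (subst length_concat_blocks[where m = "length M"]) (auto simp del: upt_Suc)

lemma cell_surj:
  assumes "p < n * L"
  shows "\<exists>c r. 1 \<le> c \<and> c \<le> n \<and> 1 \<le> r \<and> r \<le> L \<and> p = cell L c r"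
proof (intro exI conjI)
  have L: "0 < L" using assms by (cases L) auto
  show "Suc (p div L) \<le> n" using assms by (simp add: less_mult_imp_div_less Suc_leI)
  show "1 \<le> L - p mod L" using L by (simp add: Suc_leI)
  show "p = cell L (Suc (p div L)) (L - p mod L)" using L by (simp add: cell_def less_imp_le_nat)
qed auto

lemma padded_cell:
  assumes "1 \<le> r" "r \<le> length M" "1 \<le> c" "c \<le> n"
  shows "padded n M ! cell (length M) c r = (if c \<in> M ! (r - 1) then r else 0)"
proof -
  let ?xss = "map (\<lambda>j. map (\<lambda>r. if j \<in> M ! (r - 1) then r else 0) (rev [1..<length M + 1])) [1..<n + 1]"
  have "padded n M ! cell (length M) c r = ?xss ! (c - 1) ! (length M - r)"
    unfolding padded_def cell_def by (rule nth_concat_blocks) (use assms in \<open>auto simp del: upt_Suc\<close>)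
  also have "\<dots> = (if c \<in> M ! (r - 1) then r else 0)"
    using assms by (simp add: rev_nth del: upt_Suc)
  finally show ?thesis .
qed

section \<open>The pairing of two rows as greedy cyclic matching\<close>

fun col_picks :: "nat \<Rightarrow> nat set \<Rightarrow> (nat \<times> nat) list \<Rightarrow> (nat \<Rightarrow> nat option) \<Rightarrow> nat list" where
  "col_picks n low [] m = []"
| "col_picks n low ((c, l) # bs) m =
     (let d = hd (filter (\<lambda>d. d \<in> low \<and> m d = None) ([c..<n + 1] @ [1..<c]))
      in d # col_picks n low bs (m(d \<mapsto> l)))"

lemma length_col_picks [simp]: "length (col_picks n low bs m) = length bs"
proof (induction bs arbitrary: m)
  case (Cons b bs)
  show ?case by (cases b) (simp add: Let_def Cons.IH)
qed simp

text \<open>Later balls do not influence earlier choices. This matters because a threshold on the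
  labels cuts off a prefix of the pairing order.\<close>

lemma col_picks_append: "\<exists>m'. col_picks n low (bs @ bs') m = col_picks n low bs m @ col_picks n low bs' m'"
proof (induction bs arbitrary: m)
  case (Cons b bs)
  obtain c l where b: "b = (c, l)" by (cases b)
  define d where "d = hd (filter (\<lambda>d. d \<in> low \<and> m d = None) ([c..<n + 1] @ [1..<c]))"
  obtain m' where "col_picks n low (bs @ bs') (m(d \<mapsto> l)) = col_picks n low bs (m(d \<mapsto> l)) @ col_picks n low bs' m'"
    using Cons.IH by blast
  then show ?case unfolding b by (intro exI[of _ m']) (simp add: Let_def d_def)
qed auto

lemma hd_filter_upt:
  assumes "a \<le> d" "d < b" "A d" "\<And>x. a \<le> x \<Longrightarrow> x < d \<Longrightarrow> \<not> A x"
  shows "filter A [a..<b] \<noteq> [] \<and> hd (filter A [a..<b]) = d"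
proof -
  have "[a..<b] = [a..<d] @ d # [Suc d..<b]"
    using upt_split[of a d b] assms(1,2) by (simp add: upt_conv_Cons)
  moreover have "filter A [a..<d] = []" using assms(4) by (auto simp: filter_empty_conv)
  ultimately show ?thesis using assms(3) by simp
qed

lemma col_pick_cases:
  assumes "1 \<le> d0" "d0 \<le> n" "A d0"
  obtains (later) d where "c \<le> d" "d \<le> n" "A d" "\<And>x. c \<le> x \<Longrightarrow> x < d \<Longrightarrow> \<not> A x"
      "hd (filter A ([c..<n + 1] @ [1..<c])) = d"
  | (wrap) d where "1 \<le> d" "d < c" "A d" "\<And>x. c \<le> x \<Longrightarrow> x \<le> n \<Longrightarrow> \<not> A x"
      "\<And>x. 1 \<le> x \<Longrightarrow> x < d \<Longrightarrow> \<not> A x" "hd (filter A ([c..<n + 1] @ [1..<c])) = d"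
proof (cases "\<exists>d. c \<le> d \<and> d \<le> n \<and> A d")
  case True
  define d where "d = (LEAST d. c \<le> d \<and> d \<le> n \<and> A d)"
  have d: "c \<le> d" "d \<le> n" "A d" using LeastI_ex[OF True] by (auto simp: d_def)
  have l: "\<not> A x" if "c \<le> x" "x < d" for x
    using not_less_Least[of x "\<lambda>d. c \<le> d \<and> d \<le> n \<and> A d"] that d by (auto simp: d_def)
  have "filter A [c..<n + 1] \<noteq> [] \<and> hd (filter A [c..<n + 1]) = d"
    by (rule hd_filter_upt) (use d l in auto)
  then have "hd (filter A ([c..<n + 1] @ [1..<c])) = d" unfolding filter_append by (metis hd_append2)
  then show ?thesis using later d l by blast
next
  case False
  define d where "d = (LEAST d. 1 \<le> d \<and> A d)"
  have d: "1 \<le> d" "A d" using LeastI[of "\<lambda>d. 1 \<le> d \<and> A d" d0] assms by (auto simp: d_def)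
  have "d \<le> d0" using Least_le[of "\<lambda>d. 1 \<le> d \<and> A d" d0] assms by (simp add: d_def)
  then have dc: "d < c" using False assms d by (meson le_trans not_le)
  have l: "\<not> A x" if "1 \<le> x" "x < d" for x
    using not_less_Least[of x "\<lambda>d. 1 \<le> d \<and> A d"] that by (auto simp: d_def)
  have "filter A [c..<n + 1] = []" using False by (auto simp: filter_empty_conv simp del: upt_Suc)
  moreover have "filter A [1..<c] \<noteq> [] \<and> hd (filter A [1..<c]) = d"
    by (rule hd_filter_upt) (use d l dc in auto)
  ultimately have "hd (filter A ([c..<n + 1] @ [1..<c])) = d" unfolding filter_append by simp
  then show ?thesis using wrap d l dc False by blast
qed

text \<open>Columns are read top to bottom, so the cell directly below a ball comes after it: weakly
  to the right in the matrix means strictly later in the word.\<close>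

lemma next_pos_col:
  assumes i: "1 \<le> i" "i < L" and c: "1 \<le> c" "c \<le> n" and len: "length v = n * L"
    and A: "\<And>p. p < n * L \<Longrightarrow> v ! p = i \<longleftrightarrow> (\<exists>d. 1 \<le> d \<and> d \<le> n \<and> p = cell L d i \<and> A d)"
    and ex: "i \<in> set v"
  defines "d \<equiv> hd (filter A ([c..<n + 1] @ [1..<c]))"
  shows "1 \<le> d \<and> d \<le> n \<and> A d \<and> next_pos v (cell L c (Suc i)) i = cell L d i"
proof -
  obtain p0 where "p0 < n * L" "v ! p0 = i" using ex len by (auto simp: in_set_conv_nth)
  then obtain d0 where d0: "1 \<le> d0" "d0 \<le> n" "A d0" using A by auto
  have less: "cell L c' (Suc i) < cell L d' i \<longleftrightarrow> c' \<le> d'" "cell L d' i < cell L d'' i \<longleftrightarrow> d' < d''"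
    if "1 \<le> c'" "1 \<le> d'" "1 \<le> d''" for c' d' d''
    using cell_less[of "Suc i" L i c' d'] cell_less[of i L i d' d''] that i by auto
  have at: "v ! cell L d' i = i" if "1 \<le> d'" "d' \<le> n" "A d'" for d'
    using A[of "cell L d' i"] cell_bound[of i L d' n] that i by auto
  have bound: "cell L d' i < length v" if "1 \<le> d'" "d' \<le> n" for d'
    using cell_bound[of i L d' n] that i len by simp
  show ?thesis
  proof (cases rule: col_pick_cases[where A = A and c = c, OF d0])
    case (1 d')
    then have d': "d' = d" "1 \<le> d'" using c by (auto simp: d_def)
    have "next_pos v (cell L c (Suc i)) i = cell L d' i"
    proof (rule next_pos_later)
      show "cell L c (Suc i) < cell L d' i" using less(1)[of c d' d'] 1 c d' by simp
      show "cell L d' i < length v" "v ! cell L d' i = i" using bound at 1 d' by auto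
      fix m assume m: "cell L c (Suc i) < m" "m < cell L d' i"
      show "v ! m \<noteq> i"
      proof
        assume "v ! m = i"
        then obtain x where x: "1 \<le> x" "x \<le> n" "m = cell L x i" "A x"
          using A[of m] m bound[of d'] 1 d' len by auto
        then have "c \<le> x" "x < d'" using m less[of c x d'] c d' by auto
        then show False using 1(4) x by blast
      qed
    qed
    then show ?thesis using 1 d' by simp
  next
    case (2 d')
    then have d': "d' = d" by (simp add: d_def)
    have dn: "d' \<le> n" using 2 c by simp
    have "next_pos v (cell L c (Suc i)) i = cell L d' i"
    proof (rule next_pos_wrap)
      show "cell L d' i \<le> cell L c (Suc i)" using less(1)[of c d' d'] 2 c by auto
      show "v ! cell L d' i = i" using at 2 dn by auto
      show "v ! m \<noteq> i" if m: "cell L c (Suc i) < m" "m < length v" for m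
      proof
        assume "v ! m = i"
        then obtain x where x: "1 \<le> x" "x \<le> n" "m = cell L x i" "A x" using A[of m] m len by auto
        then have "c \<le> x" using m less[of c x x] c by auto
        then show False using 2(4) x by blast
      qed
      show "v ! m \<noteq> i" if m: "m < cell L d' i" for m
      proof
        assume "v ! m = i"
        then obtain x where x: "1 \<le> x" "x \<le> n" "m = cell L x i" "A x"
          using A[of m] m bound[of d'] 2 dn len by auto
        then have "x < d'" using m less(2)[of c x d'] c 2 by auto
        then show False using 2(5) x by blast
      qed
    qed
    then show ?thesis using 2 d' dn by simp
  qed
qed

text \<open>The two runs stay in step because a lower ball that is taken is marked in
  \<open>m\<close> on one side and overwritten by 0 in \<open>v\<close> on the other.\<close>

lemma picks_col_picks:
  assumes "1 \<le> i" "i < L" "length v = n * L"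
    and "\<And>c l. (c, l) \<in> set bs \<Longrightarrow> 1 \<le> c \<and> c \<le> n \<and> v ! cell L c (Suc i) = Suc i"
    and "distinct (map fst bs)" "cnt v (Suc i) \<le> cnt v i"
    and "\<And>p. p < n * L \<Longrightarrow> v ! p = i \<longleftrightarrow> (\<exists>d. 1 \<le> d \<and> d \<le> n \<and> p = cell L d i \<and> d \<in> low \<and> m d = None)"
  shows "picks i v (map (\<lambda>(c, l). cell L c (Suc i)) bs) = map (\<lambda>d. cell L d i) (col_picks n low bs m) \<and>
    distinct (col_picks n low bs m) \<and> set (col_picks n low bs m) \<subseteq> {d. 1 \<le> d \<and> d \<le> n \<and> d \<in> low \<and> m d = None}"
  using assms
proof (induction bs arbitrary: v m)
  case (Cons b bs)
  obtain c l where b: "b = (c, l)" by (cases b)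
  have c: "1 \<le> c" "c \<le> n" "v ! cell L c (Suc i) = Suc i" using Cons.prems(4)[of c l] b by auto
  let ?A = "\<lambda>d. d \<in> low \<and> m d = None"
  let ?p = "cell L c (Suc i)"
  have p: "?p < length v" using cell_bound[of "Suc i" L c n] c Cons.prems by simp
  note pk = pick[OF p c(3) Cons.prems(1,6)]
  have "i \<in> set v" using pk(1,2) by (metis nth_mem)
  define d where "d = hd (filter ?A ([c..<n + 1] @ [1..<c]))"
  have d: "1 \<le> d" "d \<le> n" "?A d" "next_pos v ?p i = cell L d i"
    using next_pos_col[OF Cons.prems(1,2) c(1,2) Cons.prems(3,7) \<open>i \<in> set v\<close>] unfolding d_def by blast+
  note pk = pk[unfolded d(4)]
  let ?v = "v[?p := 0, cell L d i := 0]" and ?m = "m(d \<mapsto> l)"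
  have IH: "picks i ?v (map (\<lambda>(c, l). cell L c (Suc i)) bs) = map (\<lambda>d. cell L d i) (col_picks n low bs ?m) \<and>
    distinct (col_picks n low bs ?m) \<and> set (col_picks n low bs ?m) \<subseteq> {d. 1 \<le> d \<and> d \<le> n \<and> d \<in> low \<and> ?m d = None}"
  proof (rule Cons.IH[OF Cons.prems(1,2)])
    show "length ?v = n * L" using Cons.prems(3) by simp
    show "1 \<le> c' \<and> c' \<le> n \<and> ?v ! cell L c' (Suc i) = Suc i" if "(c', l') \<in> set bs" for c' l'
    proof -
      have c': "1 \<le> c'" "c' \<le> n" "v ! cell L c' (Suc i) = Suc i" using Cons.prems(4)[of c' l'] that by auto
      have "c' \<noteq> c" using Cons.prems(5) that b by force
      then have "cell L c' (Suc i) \<noteq> ?p" using cell_eq[of "Suc i" L "Suc i" c' c] c c' Cons.prems(2) by simp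
      moreover have "cell L c' (Suc i) \<noteq> cell L d i" using pk(2) c' by auto
      ultimately show ?thesis using c' by simp
    qed
    show "distinct (map fst bs)" using Cons.prems(5) by simp
    show "cnt ?v (Suc i) \<le> cnt ?v i"
      using Cons.prems(1,6) p c pk(1,2,3) by (simp add: count_update)
    show "?v ! p = i \<longleftrightarrow> (\<exists>e. 1 \<le> e \<and> e \<le> n \<and> p = cell L e i \<and> e \<in> low \<and> ?m e = None)"
      if pn: "p < n * L" for p
    proof -
      have "?v ! p = i \<longleftrightarrow> v ! p = i \<and> p \<noteq> cell L d i"
        using pn Cons.prems(1,3) c(3) pk(1) p by (auto simp: nth_list_update)
      also have "\<dots> \<longleftrightarrow> (\<exists>e. 1 \<le> e \<and> e \<le> n \<and> p = cell L e i \<and> e \<in> low \<and> m e = None) \<and> p \<noteq> cell L d i"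
        using Cons.prems(7)[OF pn] by simp
      also have "\<dots> \<longleftrightarrow> (\<exists>e. 1 \<le> e \<and> e \<le> n \<and> p = cell L e i \<and> e \<in> low \<and> ?m e = None)"
      proof -
        have "cell L e i = cell L d i \<longleftrightarrow> e = d" if "1 \<le> e" for e
          using cell_eq[of i L i e d] Cons.prems(1,2) d(1) that by simp
        then show ?thesis by (auto split: if_splits)
      qed
      finally show ?thesis .
    qed
  qed
  have pr: "col_picks n low (b # bs) m = d # col_picks n low bs ?m" by (simp add: b d_def Let_def)
  have "d \<notin> set (col_picks n low bs ?m)" using IH by auto
  moreover have "set (col_picks n low bs ?m) \<subseteq> {d. 1 \<le> d \<and> d \<le> n \<and> d \<in> low \<and> m d = None}"
    using IH by (auto split: if_splits)
  ultimately show ?case using IH d unfolding pr by (auto simp: b)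
qed simp

text \<open>Distinctness of the choices guarantees that no label is overwritten later.\<close>

lemma pair_step_col_picks:
  assumes "distinct (col_picks n low bs m)"
  shows "(\<forall>t < length bs. fst (pair_step n r low bs m acc) (col_picks n low bs m ! t) = Some (snd (bs ! t))) \<and>
    (\<forall>d. d \<notin> set (col_picks n low bs m) \<longrightarrow> fst (pair_step n r low bs m acc) d = m d) \<and>
    snd (pair_step n r low bs m acc) =
      acc + (\<Sum>t < length bs. if col_picks n low bs m ! t < fst (bs ! t) then snd (bs ! t) + 1 - r else 0)"
  using assms
proof (induction bs arbitrary: m acc)
  case (Cons b bs)
  obtain c l where b: "b = (c, l)" by (cases b)
  define d where "d = hd (filter (\<lambda>d. d \<in> low \<and> m d = None) ([c..<n + 1] @ [1..<c]))"
  let ?m = "m(d \<mapsto> l)" and ?acc = "acc + (if d < c then l + 1 - r else 0)"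
  have pr: "col_picks n low (b # bs) m = d # col_picks n low bs ?m" by (simp add: b d_def Let_def)
  have ps: "pair_step n r low (b # bs) m acc = pair_step n r low bs ?m ?acc"
    by (simp add: b d_def Let_def)
  have dist: "distinct (col_picks n low bs ?m)" "d \<notin> set (col_picks n low bs ?m)" using Cons.prems unfolding pr by auto
  define ds where "ds = col_picks n low bs ?m"
  define R where "R = pair_step n r low bs ?m ?acc"
  have IH: "\<forall>t < length bs. fst R (ds ! t) = Some (snd (bs ! t))"
    "\<forall>e. e \<notin> set ds \<longrightarrow> fst R e = ?m e"
    "snd R = ?acc + (\<Sum>t < length bs. if ds ! t < fst (bs ! t) then snd (bs ! t) + 1 - r else 0)"
    using Cons.IH[OF dist(1), of ?acc] unfolding ds_def R_def by blast+
  have "fst R d = Some l" using IH(2) dist(2) unfolding ds_def by simp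
  then have 1: "\<forall>t < length (b # bs). fst R ((d # ds) ! t) = Some (snd ((b # bs) ! t))"
    using IH(1) by (auto simp: less_Suc_eq_0_disj b)
  have 2: "\<forall>e. e \<notin> set (d # ds) \<longrightarrow> fst R e = m e"
    using IH(2) by simp
  have 3: "snd R = acc + 
     (\<Sum>t < length (b # bs). if (d # ds) ! t < fst ((b # bs) ! t) then snd ((b # bs) ! t) + 1 - r else 0)"
    using IH(3) by (simp add: sum.lessThan_Suc_shift b del: sum.lessThan_Suc cong: if_cong)
  show ?case unfolding pr ps ds_def[symmetric] R_def[symmetric] using 1 2 3 by blast
qed simp

text \<open>With weakly decreasing content a reflection on the way creates no new letter at the
  lower level, so the letters \<open>l\<close> carried down to row \<open>j\<close> sit on balls of
  that row.\<close>

lemma reflects_subset: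
  assumes counts: "\<And>j l. 1 \<le> j \<Longrightarrow> j \<le> l \<Longrightarrow> cnt w l \<le> cnt w j"
    and j: "1 \<le> j" "j \<le> l" and p: "p < length w" "reflects [j..<l] w ! p = j"
  shows "w ! p = j"
proof (cases "j = l")
  case False
  let ?u = "reflects [Suc j..<l] w"
  have e: "reflects [j..<l] w = reflect j ?u" using False j by (simp add: upt_conv_Cons)
  have "cnt ?u (Suc j) \<le> cnt ?u j"
    using count_reflects[of "Suc j" l w] count_reflects_low[of j "Suc j" l w] counts[OF j] False j by simp
  then have "opens j ?u \<le> closes j ?u" by (rule opens_le_closes)
  then have "?u ! p = j" using rematch_nth_low[of j ?u "closes j ?u" p] p e by simp
  then show ?thesis using reflects_eq_iff[of p w j "Suc j" l] p by simp
qed (use p in simp)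

lemma padded_eq_iff:
  assumes "p < n * length M" "1 \<le> r" "r \<le> length M"
  shows "padded n M ! p = r \<longleftrightarrow> (\<exists>d. 1 \<le> d \<and> d \<le> n \<and> p = cell (length M) d r \<and> d \<in> M ! (r - 1))"
proof
  assume a: "padded n M ! p = r"
  obtain c s where cs: "1 \<le> c" "c \<le> n" "1 \<le> s" "s \<le> length M" "p = cell (length M) c s"
    using cell_surj[OF assms(1)] by blast
  then have "padded n M ! p = (if c \<in> M ! (s - 1) then s else 0)" using padded_cell by simp
  then have "s = r" "c \<in> M ! (r - 1)" using a assms(2) by (auto split: if_splits)
  then show "\<exists>d. 1 \<le> d \<and> d \<le> n \<and> p = cell (length M) d r \<and> d \<in> M ! (r - 1)" using cs by blast
next
  assume "\<exists>d. 1 \<le> d \<and> d \<le> n \<and> p = cell (length M) d r \<and> d \<in> M ! (r - 1)"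
  then show "padded n M ! p = r" using padded_cell assms by auto
qed

section \<open>Labels, thresholds and wrapping pairings\<close>

definition label_order :: "nat \<Rightarrow> nat set \<Rightarrow> (nat \<Rightarrow> nat) \<Rightarrow> nat list \<Rightarrow> (nat \<times> nat) list" where
  "label_order n S full ls = concat (map (\<lambda>l. map (\<lambda>c. (c, l)) (filter (\<lambda>c. c \<in> S \<and> full c = l) [1..<n + 1])) ls)"

lemma set_label_order:
  "set (label_order n S full ls) = {(c, l). 1 \<le> c \<and> c \<le> n \<and> c \<in> S \<and> full c = l \<and> l \<in> set ls}"
  unfolding label_order_def by (fastforce simp del: upt_Suc)

lemma label_order_Cons:
  "label_order n S full (l # ls) = map (\<lambda>c. (c, l)) (filter (\<lambda>c. c \<in> S \<and> full c = l) [1..<n + 1]) @ label_order n S full ls"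
  by (simp add: label_order_def)

lemma distinct_label_order:
  "distinct ls \<Longrightarrow> distinct (map fst (label_order n S full ls))"
proof (induction ls)
  case (Cons l ls)
  have "set (map fst (label_order n S full ls)) \<subseteq> {c. full c \<in> set ls}"
    using set_label_order[of n S full ls] by auto
  then show ?case using Cons by (auto simp: label_order_Cons o_def simp del: upt_Suc)
qed (simp add: label_order_def)

lemma sorted_label_order:
  "sorted_wrt (\<ge>) ls \<Longrightarrow> sorted_wrt (\<lambda>a b. snd b \<le> snd a) (label_order n S full ls)"
proof (induction ls)
  case (Cons l ls)
  have "\<forall>b \<in> set (label_order n S full ls). snd b \<in> set ls" using set_label_order[of n S full ls] by auto
  moreover have "sorted_wrt (\<lambda>a b. snd b \<le> snd a) (map (\<lambda>c. (c, l)) xs)" for xs :: "nat list"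
    by (induction xs) auto
  ultimately show ?case using Cons unfolding label_order_Cons sorted_wrt_append
    by (auto simp del: upt_Suc)
qed (simp add: label_order_def)

lemma length_filter_zip_conv_card:
  "length xs = length ys \<Longrightarrow> length (filter (\<lambda>(x, y). P x y) (zip xs ys)) = card {t. t < length xs \<and> P (xs ! t) (ys ! t)}"
  by (subst length_filter_conv_card) (auto intro!: arg_cong[of _ _ card])

context
  fixes n L :: nat and M :: "nat set list" and w :: "nat list"
  assumes M: "M \<in> binmat L n" and w: "w = padded n M"
    and counts: "\<And>j l. 1 \<le> j \<Longrightarrow> j \<le> l \<Longrightarrow> cnt w l \<le> cnt w j"
begin

lemma len_M: "length M = L" using M by (simp add: binmat_def)

lemma len_w: "length w = n * L" by (simp add: w length_padded len_M)

text \<open>The balls of row \<open>i + 1\<close> with label at least \<open>l\<close> are the letters \<open>i + 1\<close> of the word in which the letters \<open>l\<close> have been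
  carried down to row \<open>i + 1\<close>.\<close>

lemma threshold_step:
  assumes i: "1 \<le> i" "i < L" and l: "Suc i \<le> l" 
    and char: "\<And>c. 1 \<le> c \<Longrightarrow> c \<le> n \<Longrightarrow> c \<in> M ! i \<and> l \<le> full c \<longleftrightarrow> reflects [Suc i..<l] w ! cell L c (Suc i) = Suc i"
    and bs: "set bs = {(c, x). 1 \<le> c \<and> c \<le> n \<and> c \<in> M ! i \<and> full c = x \<and> l \<le> x}" "distinct (map fst bs)"
  defines "ds \<equiv> col_picks n (M ! (i - 1)) bs Map.empty"
  shows "opens i (reflects [Suc i..<l] w) = card {t. t < length bs \<and> ds ! t < fst (bs ! t)}"
    and "distinct ds" "\<And>d. d \<in> set ds \<longleftrightarrow> 1 \<le> d \<and> d \<le> n \<and> reflects [i..<l] w ! cell L d i = i"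
    and "set ds \<subseteq> M ! (i - 1)"
proof -
  let ?v = "reflects [Suc i..<l] w"
  let ?ps = "map (\<lambda>(c, l). cell L c (Suc i)) bs"
  have lv: "length ?v = n * L" by (simp add: len_w)
  have c: "cnt ?v (Suc i) \<le> cnt ?v i"
    using count_reflects[of "Suc i" l w] count_reflects_low[of i "Suc i" l w] counts[of i l] i l by simp
  have low: "?v ! p = i \<longleftrightarrow> (\<exists>d. 1 \<le> d \<and> d \<le> n \<and> p = cell L d i \<and> d \<in> M ! (i - 1) \<and> Map.empty d = None)"
    if "p < n * L" for p
    using reflects_eq_iff[of p w i "Suc i" l] padded_eq_iff[of p n M i] that i len_w len_M w by simp
  have at: "1 \<le> c \<and> c \<le> n \<and> ?v ! cell L c (Suc i) = Suc i" if "(c, x) \<in> set bs" for c x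
    using that char[of c] unfolding bs(1) by auto
  have p: "picks i ?v ?ps = map (\<lambda>d. cell L d i) ds \<and> distinct ds \<and>
      set ds \<subseteq> {d. 1 \<le> d \<and> d \<le> n \<and> d \<in> M ! (i - 1) \<and> Map.empty d = None}"
    using picks_col_picks[where m = Map.empty and low = "M ! (i - 1)", OF i lv at bs(2) c low]
    unfolding ds_def by simp
  then show "distinct ds" "set ds \<subseteq> M ! (i - 1)" by auto
  have inj: "inj_on (\<lambda>(c, l). cell L c (Suc i)) (set bs)"
  proof (rule inj_onI)
    fix a b assume ab: "a \<in> set bs" "b \<in> set bs" "(\<lambda>(c, l). cell L c (Suc i)) a = (\<lambda>(c, l). cell L c (Suc i)) b"
    then have "fst a = fst b" using cell_eq[of "Suc i" L "Suc i" "fst a" "fst b"] i unfolding bs(1) by auto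
    then show "a = b" using ab unfolding bs(1) by auto
  qed
  have dist: "distinct ?ps" using inj bs(2) unfolding distinct_map by blast
  have set: "set ?ps = {p. p < length ?v \<and> ?v ! p = Suc i}"
  proof (intro subset_antisym subsetI)
    fix p assume "p \<in> set ?ps"
    then obtain c x where "(c, x) \<in> set bs" "p = cell L c (Suc i)" by auto
    then show "p \<in> {p. p < length ?v \<and> ?v ! p = Suc i}"
      using at[of c x] cell_bound[of "Suc i" L c n] i lv by auto
  next
    fix p assume "p \<in> {p. p < length ?v \<and> ?v ! p = Suc i}"
    then have pp: "p < n * L" "?v ! p = Suc i" using lv by auto
    then have "w ! p = Suc i" using reflects_subset[OF counts, of "Suc i" l p] l len_w by simp
    then obtain c where cc: "1 \<le> c" "c \<le> n" "p = cell L c (Suc i)" "c \<in> M ! i"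
      using padded_eq_iff[of p n M "Suc i"] pp i len_M w by auto
    then have "(c, full c) \<in> set bs" using char[of c] pp unfolding bs(1) by auto
    then show "p \<in> set ?ps" using cc by force
  qed
  \<comment> \<open>The pairing order is just one enumeration of the letters i + 1, and
    \<open>picks_correct\<close> accepts any.\<close>
  note pc = picks_correct[OF dist set i(1) c]
  have ld: "length ds = length bs" by (simp add: ds_def)
  have wrap: "cell L (ds ! t) i < cell L (fst (bs ! t)) (Suc i) \<longleftrightarrow> ds ! t < fst (bs ! t)" if "t < length bs" for t
  proof -
    have "ds ! t \<in> set ds" using that ld by simp
    then have "1 \<le> ds ! t" using p by blast
    moreover have "1 \<le> fst (bs ! t)" using nth_mem[OF that] bs(1) by auto
    ultimately show ?thesis using cell_less[of i L "Suc i" "ds ! t" "fst (bs ! t)"] i by simp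
  qed
  have "opens i ?v = card {t. t < length ?ps \<and> picks i ?v ?ps ! t < ?ps ! t}"
    using pc length_filter_zip_conv_card[of ?ps "picks i ?v ?ps" "\<lambda>p q. q < p"] by simp
  also have "{t. t < length ?ps \<and> picks i ?v ?ps ! t < ?ps ! t} = {t. t < length bs \<and> ds ! t < fst (bs ! t)}"
    using p wrap ld by (auto simp: case_prod_beta)
  finally show "opens i ?v = card {t. t < length bs \<and> ds ! t < fst (bs ! t)}" .
  have e: "reflects [i..<l] w = reflect i ?v" using l by (simp add: upt_conv_Cons)
  have s: "{p. p < length ?v \<and> reflect i ?v ! p = i} = (\<lambda>d. cell L d i) ` set ds" using pc p by simp
  show "d \<in> set ds \<longleftrightarrow> 1 \<le> d \<and> d \<le> n \<and> reflects [i..<l] w ! cell L d i = i" for d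
  proof
    assume d: "d \<in> set ds"
    then have "cell L d i \<in> {p. p < length ?v \<and> reflect i ?v ! p = i}" unfolding s by blast
    then show "1 \<le> d \<and> d \<le> n \<and> reflects [i..<l] w ! cell L d i = i" using e p d by auto
  next
    assume d: "1 \<le> d \<and> d \<le> n \<and> reflects [i..<l] w ! cell L d i = i"
    then have "cell L d i \<in> {p. p < length ?v \<and> reflect i ?v ! p = i}"
      using cell_bound[of i L d n] i lv e by simp
    then obtain d' where "d' \<in> set ds" "cell L d i = cell L d' i" unfolding s by blast
    then show "d \<in> set ds" using cell_eq[of i L i d d'] p d i by auto
  qed
qed

text \<open>For each \<open>l\<close> the balls with label at least \<open>l\<close> pair as if
  alone, so \<open>threshold_step\<close> counts their wraps and identifies the balls of the next
  row that inherit such a label.\<close>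

lemma row_step:
  assumes i: "1 \<le> i" "i < L"
    and full: "\<And>c. c \<in> M ! i \<Longrightarrow> Suc i \<le> full c \<and> full c \<le> L"
    and char: "\<And>c l. Suc i \<le> l \<Longrightarrow> l \<le> L \<Longrightarrow> 1 \<le> c \<Longrightarrow> c \<le> n \<Longrightarrow>
       c \<in> M ! i \<and> l \<le> full c \<longleftrightarrow> reflects [Suc i..<l] w ! cell L c (Suc i) = Suc i"
  defines "res \<equiv> pair_step n (Suc i) (M ! (i - 1)) (label_order n (M ! i) full (rev [Suc i..<L + 1])) Map.empty 0"
  shows "snd res = (\<Sum>l = Suc i..L. opens i (reflects [Suc i..<l] w))"
    and "\<And>d l. Suc i \<le> l \<Longrightarrow> l \<le> L \<Longrightarrow> 1 \<le> d \<Longrightarrow> d \<le> n \<Longrightarrow>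
       (\<exists>x. fst res d = Some x \<and> l \<le> x) \<longleftrightarrow> reflects [i..<l] w ! cell L d i = i"
    and "\<And>d x. fst res d = Some x \<Longrightarrow> d \<in> M ! (i - 1) \<and> Suc i \<le> x \<and> x \<le> L"
proof -
  define ord where "ord = label_order n (M ! i) full (rev [Suc i..<L + 1])"
  define ds where "ds = col_picks n (M ! (i - 1)) ord Map.empty"
  have ld: "length ds = length ord" by (simp add: ds_def)
  have setord: "set ord = {(c, x). 1 \<le> c \<and> c \<le> n \<and> c \<in> M ! i \<and> full c = x}"
    using full unfolding ord_def set_label_order by (auto simp: less_Suc_eq_le simp del: upt_Suc)
  have distord: "distinct (map fst ord)" unfolding ord_def by (rule distinct_label_order) simp
  have srt: "sorted_wrt (\<lambda>a b. snd b \<le> snd a) ord" unfolding ord_def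
    by (rule sorted_label_order) (simp add: sorted_wrt_rev del: upt_Suc)
  let ?bs = "\<lambda>l. filter (\<lambda>p. l \<le> snd p) ord"
  \<comment> \<open>Labels decrease weakly along \<open>ord\<close>, so the balls with label at
    least \<open>l\<close> form a prefix, and their choices are those of the full run.\<close>
  have pre: "col_picks n (M ! (i - 1)) (?bs l) Map.empty = take (length (?bs l)) ds" 
    and len: "t < length (?bs l) \<longleftrightarrow> t < length ord \<and> l \<le> snd (ord ! t)"
    and nthb: "t < length (?bs l) \<Longrightarrow> ?bs l ! t = ord ! t" for l t
  proof -
    let ?b = "?bs l" and ?c = "filter (\<lambda>p. \<not> l \<le> snd p) ord"
    have split: "ord = ?b @ ?c" by (rule filter_prefix, rule sorted_wrt_mono_rel[OF _ srt]) simp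
    obtain m' where "col_picks n (M ! (i - 1)) (?b @ ?c) Map.empty =
        col_picks n (M ! (i - 1)) ?b Map.empty @ col_picks n (M ! (i - 1)) ?c m'" using col_picks_append by blast
    then show "col_picks n (M ! (i - 1)) ?b Map.empty = take (length ?b) ds"
      unfolding ds_def split[symmetric] by simp
    show n1: "t < length ?b \<Longrightarrow> ?b ! t = ord ! t" for t
      using split by (metis nth_append)
    show "t < length ?b \<longleftrightarrow> t < length ord \<and> l \<le> snd (ord ! t)"
    proof
      assume t: "t < length ?b"
      then have "?b ! t \<in> set ?b" by (rule nth_mem)
      then show "t < length ord \<and> l \<le> snd (ord ! t)"
        using t n1[OF t] length_filter_le[of "\<lambda>p. l \<le> snd p" ord] by (auto intro: less_le_trans)
    next
      assume t: "t < length ord \<and> l \<le> snd (ord ! t)"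
      show "t < length ?b"
      proof (rule ccontr)
        assume nt: "\<not> t < length ?b"
        have "length ord = length ?b + length ?c" using arg_cong[OF split, of length] by simp
        then have "t - length ?b < length ?c" using t nt by linarith
        then have "?c ! (t - length ?b) \<in> set ?c" by (rule nth_mem)
        moreover have "ord ! t = ?c ! (t - length ?b)" using split nt by (metis nth_append)
        ultimately show False using t by auto
      qed
    qed
  qed
  have bs: "set (?bs l) = {(c, x). 1 \<le> c \<and> c \<le> n \<and> c \<in> M ! i \<and> full c = x \<and> l \<le> x}"
    "distinct (map fst (?bs l))" for l
    using setord distord by (auto simp: distinct_map_filter)
  have th: "opens i (reflects [Suc i..<l] w) =
      card {t. t < length (?bs l) \<and> take (length (?bs l)) ds ! t < fst (?bs l ! t)}"
    "distinct (take (length (?bs l)) ds)" "set (take (length (?bs l)) ds) \<subseteq> M ! (i - 1)"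
    "\<And>d. d \<in> set (take (length (?bs l)) ds) \<longleftrightarrow> 1 \<le> d \<and> d \<le> n \<and> reflects [i..<l] w ! cell L d i = i"
    if "Suc i \<le> l" "l \<le> L" for l
    using threshold_step[OF i that(1) char[OF that] bs, unfolded pre] by blast+
  have "?bs (Suc i) = ord" using setord full by (auto simp: filter_id_conv)
  then have ds: "distinct ds" "set ds \<subseteq> M ! (i - 1)"
    using th(2,3)[of "Suc i"] i ld by auto
  note ps = pair_step_col_picks[OF ds(1)[unfolded ds_def], of "Suc i" 0, folded ds_def, folded ord_def, 
      unfolded res_def[folded ord_def, symmetric]]
  have ps1: "fst res (ds ! t) = Some (snd (ord ! t))" if "t < length ord" for t using ps that by blast
  have ps2: "fst res d = None" if "d \<notin> set ds" for d using ps that by simp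
  have lab: "fst res d = Some x \<longleftrightarrow> (\<exists>t < length ord. d = ds ! t \<and> x = snd (ord ! t))" for d x
  proof
    assume a: "fst res d = Some x"
    then have "d \<in> set ds" using ps2[of d] by fastforce
    then obtain t where "t < length ord" "d = ds ! t" using ld by (auto simp: in_set_conv_nth)
    then show "\<exists>t < length ord. d = ds ! t \<and> x = snd (ord ! t)" using ps1[of t] a by auto
  next
    assume "\<exists>t < length ord. d = ds ! t \<and> x = snd (ord ! t)"
    then show "fst res d = Some x" using ps1 by blast
  qed
  show "d \<in> M ! (i - 1) \<and> Suc i \<le> x \<and> x \<le> L" if a: "fst res d = Some x" for d x
  proof -
    obtain t where t: "t < length ord" "d = ds ! t" "x = snd (ord ! t)" using a lab by blast
    then have "d \<in> M ! (i - 1)" using ds(2) ld nth_mem by (metis subsetD)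
    moreover have "ord ! t \<in> set ord" using t by simp
    ultimately show ?thesis using t full unfolding setord by auto
  qed
  show "(\<exists>x. fst res d = Some x \<and> l \<le> x) \<longleftrightarrow> reflects [i..<l] w ! cell L d i = i"
    if l: "Suc i \<le> l" "l \<le> L" and d: "1 \<le> d" "d \<le> n" for d l
  proof -
    have "(\<exists>x. fst res d = Some x \<and> l \<le> x) \<longleftrightarrow> (\<exists>t < length (?bs l). d = ds ! t)"
      unfolding lab len by auto
    also have "\<dots> \<longleftrightarrow> d \<in> set (take (length (?bs l)) ds)"
      using ld by (auto simp: in_set_conv_nth)
    also have "\<dots> \<longleftrightarrow> reflects [i..<l] w ! cell L d i = i"
      using th(4)[of l d] l d by simp
    finally show ?thesis .
  qed
  have "opens i (reflects [Suc i..<l] w) = (\<Sum>t < length ord. if l \<le> snd (ord ! t) \<and> ds ! t < fst (ord ! t) then 1 else 0)"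
    if l: "Suc i \<le> l" "l \<le> L" for l
  proof -
    have "opens i (reflects [Suc i..<l] w) = card {t. t < length (?bs l) \<and> take (length (?bs l)) ds ! t < fst (?bs l ! t)}"
      by (rule th(1)[OF l])
    also have "{t. t < length (?bs l) \<and> take (length (?bs l)) ds ! t < fst (?bs l ! t)}
       = {t \<in> {..<length ord}. l \<le> snd (ord ! t) \<and> ds ! t < fst (ord ! t)}"
      using len[of _ l] nthb[of _ l] by auto
    finally show ?thesis by (simp add: sum.If_cases Int_def)
  qed
  then have "(\<Sum>l = Suc i..L. opens i (reflects [Suc i..<l] w)) =
    (\<Sum>l = Suc i..L. \<Sum>t < length ord. if l \<le> snd (ord ! t) \<and> ds ! t < fst (ord ! t) then 1 else 0)"
    by (intro sum.cong) auto
  \<comment> \<open>A wrapping pairing with label x is counted for l = i + 1, ..., x, hence x + 1 -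
    (i + 1) times; this is its weight in \<open>maj\<close>.\<close>
  also have "\<dots> = (\<Sum>t < length ord. \<Sum>l = Suc i..L. if l \<le> snd (ord ! t) \<and> ds ! t < fst (ord ! t) then 1 else 0)"
    by (rule sum.swap)
  also have "\<dots> = (\<Sum>t < length ord. if ds ! t < fst (ord ! t) then snd (ord ! t) + 1 - Suc i else 0)"
  proof (intro sum.cong refl)
    fix t assume "t \<in> {..<length ord}"
    then have "ord ! t \<in> set ord" by simp
    then have x: "snd (ord ! t) \<le> L" using full unfolding setord by auto
    have "(\<Sum>l = Suc i..L. if l \<le> snd (ord ! t) then 1 else (0::nat)) = card {l \<in> {Suc i..L}. l \<le> snd (ord ! t)}"
      by (simp add: sum.If_cases Int_def)
    also have "{l \<in> {Suc i..L}. l \<le> snd (ord ! t)} = {Suc i..snd (ord ! t)}" using x by auto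
    finally show "(\<Sum>l = Suc i..L. if l \<le> snd (ord ! t) \<and> ds ! t < fst (ord ! t) then 1 else 0) =
        (if ds ! t < fst (ord ! t) then snd (ord ! t) + 1 - Suc i else 0)" by simp
  qed
  also have "\<dots> = snd res" using ps by simp
  finally show "snd res = (\<Sum>l = Suc i..L. opens i (reflects [Suc i..<l] w))" by simp
qed

text \<open>Labels enter only through thresholds. The last hypothesis is the invariant kept while
  descending through the rows; it is vacuous at the top row \<open>r = L\<close>.\<close>

lemma maj_aux_reflects:
  assumes "r \<le> L"
    and "\<And>c x. lab c = Some x \<Longrightarrow> c \<in> M ! (r - 1) \<and> Suc r \<le> x \<and> x \<le> L"
    and "\<And>d l. Suc r \<le> l \<Longrightarrow> l \<le> L \<Longrightarrow> 1 \<le> d \<Longrightarrow> d \<le> n \<Longrightarrow>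
       (\<exists>x. lab d = Some x \<and> l \<le> x) \<longleftrightarrow> reflects [r..<l] w ! cell L d r = r"
  shows "maj_aux n L M r lab = (\<Sum>i = 1..<r. \<Sum>l = Suc i..L. opens i (reflects [Suc i..<l] w))"
  using assms
proof (induction r arbitrary: lab)
  case (Suc i)
  show ?case
  proof (cases i)
    case 0
    then show ?thesis by simp
  next
    case (Suc k)
    define full where "full = (\<lambda>c. case lab c of Some l \<Rightarrow> l | None \<Rightarrow> Suc i)"
    define res where "res = pair_step n (Suc i) (M ! (i - 1)) (label_order n (M ! i) full (rev [Suc i..<L + 1])) Map.empty 0"
    have i: "1 \<le> i" "i < L" using Suc Suc.prems(1) by auto
    have full: "Suc i \<le> full c \<and> full c \<le> L" for c
      using Suc.prems(1) Suc.prems(2)[of c] by (auto simp: full_def split: option.splits)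
    have char: "c \<in> M ! i \<and> l \<le> full c \<longleftrightarrow> reflects [Suc i..<l] w ! cell L c (Suc i) = Suc i"
      if l: "Suc i \<le> l" "l \<le> L" and c: "1 \<le> c" "c \<le> n" for c l
    proof (cases "l = Suc i")
      \<comment> \<open>All balls of row i + 1 pass this threshold, since unlabelled ones get the
        label i + 1 in \<open>full\<close>; on the word side no reflection has acted.\<close>
      case True
      then show ?thesis using full[of c] padded_cell[of "Suc i" M c n] i c len_M w by simp
    next
      case False
      then have "c \<in> M ! i \<and> l \<le> full c \<longleftrightarrow> (\<exists>x. lab c = Some x \<and> l \<le> x)"
        using l Suc.prems(2)[of c] by (auto simp: full_def split: option.splits)
      then show ?thesis using Suc.prems(3)[of l c] l c False by simp
    qed
    have rs: "snd res = (\<Sum>l = Suc i..L. opens i (reflects [Suc i..<l] w))"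
      "\<And>d l. Suc i \<le> l \<Longrightarrow> l \<le> L \<Longrightarrow> 1 \<le> d \<Longrightarrow> d \<le> n \<Longrightarrow>
       (\<exists>x. fst res d = Some x \<and> l \<le> x) \<longleftrightarrow> reflects [i..<l] w ! cell L d i = i"
      "\<And>d x. fst res d = Some x \<Longrightarrow> d \<in> M ! (i - 1) \<and> Suc i \<le> x \<and> x \<le> L"
      using row_step[where full = full, OF i full char] unfolding res_def by blast+
    have "maj_aux n L M (Suc i) lab = snd res + maj_aux n L M i (fst res)"
      unfolding res_def label_order_def full_def Suc by (simp add: Let_def del: upt_Suc)
    also have "maj_aux n L M i (fst res) = (\<Sum>i = 1..<i. \<Sum>l = Suc i..L. opens i (reflects [Suc i..<l] w))"
      using i rs by (intro Suc.IH) auto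
    finally show ?thesis using rs(1) i by simp
  qed
qed simp

lemma maj_eq_refl_charge: "maj n M = refl_charge L (cw n M)"
proof -
  let ?t = "\<lambda>i l. opens i (reflects [Suc i..<l] w)"
  have "maj n M = (\<Sum>i = 1..<L. \<Sum>l = Suc i..L. ?t i l)"
    unfolding maj_def len_M by (rule maj_aux_reflects) auto
  also have "\<dots> = (\<Sum>i \<in> {1..<L}. \<Sum>l \<in> {l \<in> {1..L}. i < l}. ?t i l)"
    by (intro sum.cong) auto
  also have "\<dots> = (\<Sum>l \<in> {1..L}. \<Sum>i \<in> {i \<in> {1..<L}. i < l}. ?t i l)"
    by (rule sum.swap_restrict) auto
  also have "\<dots> = (\<Sum>l = 1..L. \<Sum>i = 1..<l. ?t i l)"
    by (intro sum.cong) auto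
  also have "\<dots> = refl_charge L w" by (simp add: refl_charge_def)
  also have "\<dots> = refl_charge L (cw n M)" using refl_charge_filter[of L w] filter_padded[of n M] w by simp
  finally show ?thesis .
qed

end

section \<open>Partitions and multiline queues\<close>

text \<open>A raising step on a word x is undone by \<open>rematch\<close> with parameter
  \<open>opens i x\<close>. On a word equivalent to the raised x the same parameter yields a word
  equivalent to x, and raising this returns the word one started from, which has no unmatched i +
  1.\<close>

lemma raise_seq_lift_binmat:
  assumes "N \<in> binmat L n" "knuth (cw n N) (raise_seq is w)" "\<forall>i \<in> set is. 1 \<le> i \<and> i < L"
  shows "\<exists>M \<in> binmat L n. map fst (cwp n M) = map fst (cwp n N) \<and> raise_seq is (cw n M) = cw n N \<and> knuth (cw n M) w"
  using assms
proof (induction "is" arbitrary: N)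
  case (Cons i "is")
  let ?x = "raise_seq is w" and ?y = "cw n N"
  have y: "knuth ?y (rematch i 0 ?x)" using Cons.prems by simp
  have U: "free i (rematch i 0 ?x) = free i ?x" by (simp add: closes_rematch opens_rematch)
  have Uy: "free i ?y = free i ?x" using knuth_closes[OF y, of i] knuth_opens[OF y, of i] U by linarith
  obtain N' where N': "N' \<in> binmat L n" "map fst (cwp n N') = map fst (cwp n N)"
    "cw n N' = rematch i (opens i ?x) ?y" using rematch_binmat[OF Cons.prems(1), of i "opens i ?x"] Cons.prems(3) Uy by auto
  have "knuth (rematch i (opens i ?x) ?y) (rematch i (opens i ?x) (rematch i 0 ?x))"
    using knuth_rematch[OF y] Uy by simp
  then have "knuth (cw n N') ?x" unfolding N'(3) by (simp add: rematch_rematch)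
  from Cons.IH[OF N'(1) this] obtain M where M: "M \<in> binmat L n" "map fst (cwp n M) = map fst (cwp n N')"
    "raise_seq is (cw n M) = cw n N'" "knuth (cw n M) w" using Cons.prems(3) by auto
  have "opens i ?y = 0" using knuth_opens[OF y] by (simp add: opens_rematch)
  then have "rematch i 0 ?y = ?y" using rematch_opens[of i ?y] by simp
  then have "raise_seq (i # is) (cw n M) = ?y" using M(3) N'(3) Uy by (simp add: rematch_rematch)
  moreover have "map fst (cwp n M) = map fst (cwp n N)" using M(2) N'(2) by simp
  ultimately show ?case using M(1,4) by blast
qed auto

lemma opens_mono:
  assumes "length v = length w" "\<And>p. p < length w \<Longrightarrow> v ! p = i \<longleftrightarrow> w ! p = i"
    "\<And>p. p < length w \<Longrightarrow> v ! p = Suc i \<Longrightarrow> w ! p = Suc i"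
  shows "closes i w \<le> closes i v \<and> opens i v \<le> opens i w"
  using assms
proof (induction v w rule: list_induct2)
  case (Cons x v y w)
  have "closes i w \<le> closes i v \<and> opens i v \<le> opens i w"
    using Cons.prems(1)[of "Suc _"] Cons.prems(2)[of "Suc _"] by (intro Cons.IH) auto
  moreover have "x = i \<longleftrightarrow> y = i" "x = Suc i \<Longrightarrow> y = Suc i" using Cons.prems[of 0] by auto
  ultimately show ?case by auto
qed simp

text \<open>The summands with l = i + 1 are the numbers \<open>opens i w\<close>. They bound the
  others: the carried letters form a subset of the letters i + 1, while the letters i are the
  same.\<close>

lemma refl_charge_eq_0_iff:
  assumes "\<And>j l. 1 \<le> j \<Longrightarrow> j \<le> l \<Longrightarrow> cnt w l \<le> cnt w j"
  shows "refl_charge L w = 0 \<longleftrightarrow> (\<forall>i. 1 \<le> i \<and> i < L \<longrightarrow> opens i w = 0)"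
proof
  assume z: "refl_charge L w = 0"
  show "\<forall>i. 1 \<le> i \<and> i < L \<longrightarrow> opens i w = 0"
  proof (intro allI impI)
    fix i assume i: "1 \<le> i \<and> i < L"
    have "\<forall>l \<in> {1..L}. (\<Sum>j = 1..<l. opens j (reflects [Suc j..<l] w)) = 0"
      using z unfolding refl_charge_def by simp
    then have "(\<Sum>j = 1..<Suc i. opens j (reflects [Suc j..<Suc i] w)) = 0"
      by (rule bspec) (use i in simp)
    then have "opens i (reflects [Suc i..<Suc i] w) = 0"
      using i by (simp del: upt_Suc)
    then show "opens i w = 0" by simp
  qed
next
  assume z: "\<forall>i. 1 \<le> i \<and> i < L \<longrightarrow> opens i w = 0"
  have "opens i (reflects [Suc i..<l] w) = 0" if "1 \<le> i" "i < l" "l \<le> L" for i l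
  proof -
    have "opens i (reflects [Suc i..<l] w) \<le> opens i w"
      using opens_mono[of "reflects [Suc i..<l] w" w i] reflects_eq_iff[of _ w i "Suc i" l]
        reflects_subset[OF assms, of "Suc i" l] that by simp
    then show ?thesis using z that by simp
  qed
  then show "refl_charge L w = 0" unfolding refl_charge_def by (intro sum.neutral ballI) auto
qed

section \<open>Empty top rows and conjugate partitions\<close>

lemma cwp_pad: "cwp n (B @ replicate k {}) = cwp n B"
proof -
  have "(B @ replicate k {}) ! m = (if m < length B then B ! m else {})" if "m < length B + k" for m
    using that by (auto simp: nth_append)
  then have "set (col_word (B @ replicate k {}) j) = set (col_word B j)" for j
    unfolding set_col_word by (auto split: if_splits)
  then have "col_word (B @ replicate k {}) j = col_word B j" for j
    by (intro decreasing_unique[OF col_word_decreasing col_word_decreasing])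
  then show ?thesis by (simp add: cwp_col_word)
qed

text \<open>Common form of \<open>strip_rows\<close> and \<open>strip_tab\<close>, also applied to
  lists of row lengths with \<open>e\<close> = 0.\<close>

definition strip :: "'a \<Rightarrow> 'a list \<Rightarrow> 'a list" where
  "strip e xs = rev (dropWhile (\<lambda>x. x = e) (rev xs))"

lemma strip_pad: "\<exists>k. xs = strip e xs @ replicate k e"
proof -
  have "rev xs = takeWhile (\<lambda>x. x = e) (rev xs) @ dropWhile (\<lambda>x. x = e) (rev xs)" by simp
  moreover have "takeWhile (\<lambda>x. x = e) (rev xs) = replicate (length (takeWhile (\<lambda>x. x = e) (rev xs))) e"
    by (intro replicate_eqI[symmetric, THEN sym]) (auto dest: set_takeWhileD)
  ultimately have "rev xs = replicate (length (takeWhile (\<lambda>x. x = e) (rev xs))) e @ dropWhile (\<lambda>x. x = e) (rev xs)"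
    by metis
  then have "xs = strip e xs @ replicate (length (takeWhile (\<lambda>x. x = e) (rev xs))) e"
    unfolding strip_def by (metis rev_append rev_replicate rev_rev_ident)
  then show ?thesis by blast
qed

lemma strip_last: "strip e xs \<noteq> [] \<Longrightarrow> last (strip e xs) \<noteq> e"
  unfolding strip_def by (metis (full_types) hd_dropWhile last_rev rev_is_Nil_conv)

lemma strip_append: "e \<notin> set ys \<Longrightarrow> strip e (ys @ replicate k e) = ys"
proof -
  assume "e \<notin> set ys"
  then have "dropWhile (\<lambda>x. x = e) (rev ys) = rev ys"
    by (intro dropWhile_eq_self_iff[THEN iffD2]) (metis hd_in_set set_rev)
  moreover have "dropWhile (\<lambda>x. x = e) (replicate k e @ zs) = dropWhile (\<lambda>x. x = e) zs" for zs
    by (induction k) auto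
  ultimately show ?thesis by (simp add: strip_def)
qed

lemma strip_inj: "length xs = length ys \<Longrightarrow> strip e xs = strip e ys \<Longrightarrow> xs = ys"
  using strip_pad[of xs e] strip_pad[of ys e] by (metis add_left_cancel length_append length_replicate)

lemma strip_rows_strip: "strip_rows = strip {}"
  by (simp add: fun_eq_iff strip_rows_def strip_def)

lemma strip_tab_strip: "strip_tab = strip []"
  by (simp add: fun_eq_iff strip_tab_def strip_def)

lemma strip_map:
  assumes "\<And>x. x \<in> set xs \<Longrightarrow> f x = e' \<longleftrightarrow> x = e"
  shows "strip e' (map f xs) = map f (strip e xs)"
proof -
  have "dropWhile (\<lambda>x. x = e') (map f ys) = map f (dropWhile (\<lambda>x. x = e) ys)" if "set ys \<subseteq> set xs" for ys
    using that assms by (induction ys) auto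
  from this[of "rev xs"] show ?thesis by (simp add: strip_def rev_map)
qed

lemma rrw_pad: "rrw (T @ replicate k []) = rrw T"
  by (simp add: rrw_def)

lemma rrw_strip_tab: "rrw (strip_tab T) = rrw T"
  using strip_pad[of T "[]"] rrw_pad unfolding strip_tab_strip by metis

lemma is_partition_nth:
  "is_partition la \<longleftrightarrow> (\<forall>i j. i \<le> j \<longrightarrow> j < length la \<longrightarrow> la ! j \<le> la ! i) \<and> (\<forall>i < length la. 1 \<le> la ! i)"
proof -
  have "0 \<notin> set la \<longleftrightarrow> (\<forall>i < length la. 1 \<le> la ! i)"
    by (auto simp: in_set_conv_nth Suc_le_eq)
  then show ?thesis unfolding is_partition_def sorted_rev_iff_nth_mono by blast
qed

lemma length_conj_part [simp]: "length (conj_part la) = first_part la"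
  by (simp add: conj_part_def del: upt_Suc)

lemma conj_part_nth: "j < first_part la \<Longrightarrow> conj_part la ! j = card {i. i < length la \<and> Suc j \<le> la ! i}"
  by (simp add: conj_part_def del: upt_Suc)

lemma downward_closed_card:
  fixes S :: "nat set"
  assumes "finite S" "\<And>i j. j \<in> S \<Longrightarrow> i \<le> j \<Longrightarrow> i \<in> S"
  shows "i < card S \<longleftrightarrow> i \<in> S"
proof
  assume "i \<in> S"
  then have "{..i} \<subseteq> S" using assms(2) by auto
  then have "card {..i} \<le> card S" by (rule card_mono[OF assms(1)])
  then show "i < card S" by simp
next
  assume "i < card S"
  show "i \<in> S"
  proof (rule ccontr)
    assume "i \<notin> S"
    then have "S \<subseteq> {..<i}" using assms(2) by (metis lessThan_iff not_le subsetI)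
    then have "card S \<le> i" using card_mono[of "{..<i}" S] by simp
    then show False using \<open>i < card S\<close> by simp
  qed
qed

text \<open>Both sides say that a cell belongs to the Young diagram: the indices counted by
  \<open>conj_part\<close> form an initial segment.\<close>

lemma less_conj_part:
  assumes "is_partition la" "j < first_part la"
  shows "i < conj_part la ! j \<longleftrightarrow> i < length la \<and> Suc j \<le> la ! i"
proof -
  let ?S = "{i. i < length la \<and> Suc j \<le> la ! i}"
  have "i < card ?S \<longleftrightarrow> i \<in> ?S"
  proof (rule downward_closed_card)
    fix a b assume ab: "b \<in> ?S" "a \<le> b"
    then have "la ! b \<le> la ! a" using assms(1) unfolding is_partition_nth by blast
    then show "a \<in> ?S" using ab by auto
  qed simp
  then show ?thesis using conj_part_nth[OF assms(2)] by simp
qed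

lemma part_le_first:
  assumes "is_partition la" "i < length la"
  shows "la ! i \<le> first_part la"
proof -
  have "la \<noteq> []" using assms(2) by auto
  then have "first_part la = la ! 0" by (simp add: first_part_def hd_conv_nth)
  then show ?thesis using assms unfolding is_partition_nth by simp
qed

lemma is_partition_conj_part:
  assumes "is_partition la"
  shows "is_partition (conj_part la)"
  unfolding is_partition_nth
proof (intro conjI allI impI)
  fix i j assume ij: "i \<le> j" "j < length (conj_part la)"
  show "conj_part la ! j \<le> conj_part la ! i"
  proof (rule ccontr)
    assume "\<not> ?thesis"
    then have "conj_part la ! i < conj_part la ! j" by simp
    then have "Suc j \<le> la ! (conj_part la ! i)" "conj_part la ! i < length la"
      using less_conj_part[OF assms] ij by auto
    then have "conj_part la ! i < conj_part la ! i" using less_conj_part[OF assms, of i "conj_part la ! i"] ij by simp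
    then show False by simp
  qed
next
  fix j assume j: "j < length (conj_part la)"
  then have "la \<noteq> []" by (auto simp: first_part_def)
  then have "0 < conj_part la ! j" using less_conj_part[OF assms, of j 0] j
    by (simp add: first_part_def hd_conv_nth Suc_leI)
  then show "1 \<le> conj_part la ! j" by simp
qed

lemma conj_part_conj_part:
  assumes "is_partition la"
  shows "conj_part (conj_part la) = la"
proof -
  have f: "first_part (conj_part la) = length la"
  proof (cases "la = []")
    case True
    then show ?thesis by (simp add: first_part_def conj_part_def)
  next
    case False
    then have fp: "0 < first_part la" using assms unfolding is_partition_nth 
      by (simp add: first_part_def hd_conv_nth) (metis Suc_le_lessD length_greater_0_conv)
    then have "conj_part la \<noteq> []" by (metis length_conj_part length_0_conv less_irrefl)
    then have "first_part (conj_part la) = conj_part la ! 0" by (simp add: first_part_def hd_conv_nth)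
    also have "\<dots> = card {i. i < length la \<and> Suc 0 \<le> la ! i}" using conj_part_nth[OF fp] .
    also have "{i. i < length la \<and> Suc 0 \<le> la ! i} = {..<length la}"
      using assms unfolding is_partition_nth by auto
    finally show ?thesis by simp
  qed
  show ?thesis
  proof (rule nth_equalityI)
    show "length (conj_part (conj_part la)) = length la" using f by simp
    fix j assume "j < length (conj_part (conj_part la))"
    then have j: "j < length la" using f by simp
    have "conj_part (conj_part la) ! j = card {i. i < first_part la \<and> Suc j \<le> conj_part la ! i}"
      using conj_part_nth[of j "conj_part la"] j f by simp
    also have "{i. i < first_part la \<and> Suc j \<le> conj_part la ! i} = {..<la ! j}"
      using less_conj_part[OF assms, of _ j] part_le_first[OF assms j] j by (auto simp: Suc_le_eq)
    finally show "conj_part (conj_part la) ! j = la ! j" by simp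
  qed
qed

lemma set_cw: "B \<in> binmat L n \<Longrightarrow> set (cw n B) \<subseteq> {1..L}"
  using set_cwp[of B L n] by (auto simp: cw_def)

lemma binmat_counts:
  assumes "B \<in> binmat L n" "\<And>i j. i \<le> j \<Longrightarrow> j < L \<Longrightarrow> card (B ! j) \<le> card (B ! i)" "1 \<le> j" "j \<le> l"
  shows "cnt (cw n B) l \<le> cnt (cw n B) j"
proof (cases "l \<le> L")
  case True
  then show ?thesis using card_row[OF assms(1), of l] card_row[OF assms(1), of j] assms(2)[of "j - 1" "l - 1"] assms(3,4)
    by simp
next
  case False
  then have "l \<notin> set (cw n B)" using set_cw[OF assms(1)] by auto
  then have "cnt (cw n B) l = 0" by (simp add: count_eq_zero_iff)
  then show ?thesis by linarith
qed

lemma MLQ_iff: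
  assumes "is_partition la"
  shows "B \<in> MLQ la n \<longleftrightarrow> B \<in> binmat (first_part la) n \<and> map card B = conj_part la"
proof -
  have "(\<forall>j \<in> {1..first_part la}. card (B ! (j - 1)) = conj_part la ! (j - 1)) \<longleftrightarrow> map card B = conj_part la"
    if "length B = first_part la"
  proof
    assume a: "\<forall>j \<in> {1..first_part la}. card (B ! (j - 1)) = conj_part la ! (j - 1)"
    show "map card B = conj_part la"
    proof (rule nth_equalityI)
      fix i assume "i < length (map card B)"
      then show "map card B ! i = conj_part la ! i" using a[rule_format, of "Suc i"] that by simp
    qed (simp add: that)
  next
    assume a: "map card B = conj_part la"
    show "\<forall>j \<in> {1..first_part la}. card (B ! (j - 1)) = conj_part la ! (j - 1)"
      unfolding a[symmetric] using that by auto
  qed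
  then show ?thesis by (auto simp: MLQ_def binmat_def)
qed

lemma partition_row_cards:
  assumes "is_partition (map card B)" "i \<le> j" "j < length B"
  shows "card (B ! j) \<le> card (B ! i)"
proof -
  have "map card B ! j \<le> map card B ! i" using assms unfolding is_partition_nth by simp
  then show ?thesis using assms by simp
qed

lemma MLQ_maj:
  assumes "is_partition la" "B \<in> MLQ la n"
  shows "maj n B = refl_charge (first_part la) (cw n B)"
    and "\<And>j l. 1 \<le> j \<Longrightarrow> j \<le> l \<Longrightarrow> cnt (cw n B) l \<le> cnt (cw n B) j"
proof -
  have B: "B \<in> binmat (first_part la) n" "map card B = conj_part la" using assms MLQ_iff by auto
  then have "is_partition (map card B)" using is_partition_conj_part[OF assms(1)] by simp
  then have r: "card (B ! j) \<le> card (B ! i)" if "i \<le> j" "j < first_part la" for i j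
    using partition_row_cards[of B i j] that B(1) by (simp add: binmat_def)
  show c: "cnt (cw n B) l \<le> cnt (cw n B) j" if "1 \<le> j" "j \<le> l" for j l
    by (rule binmat_counts[OF B(1) r that])
  have "cnt (padded n B) j = cnt (cw n B) j" if "1 \<le> j" for j
    unfolding filter_padded[symmetric] mset_filter using that by simp
  then show "maj n B = refl_charge (first_part la) (cw n B)"
    using c by (intro maj_eq_refl_charge[OF B(1) refl]) simp
qed

lemma full_coll_rows:
  assumes "\<And>r. r < n \<Longrightarrow> set (T ! r) \<subseteq> {..L}"
  shows "row_word (full_coll L) T n = row_word (\<lambda>r x. Suc r) T n"
  using assms by (intro row_word_cong) (fastforce simp: full_coll_def)

lemma row_word_lengths:
  "(\<And>r. r < n \<Longrightarrow> length (T ! r) = length (T' ! r)) \<Longrightarrow> row_word (\<lambda>r x. Suc r) T n = row_word (\<lambda>r x. Suc r) T' n"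
  by (induction n) (auto simp: map_replicate_const)

text \<open>With all entries at most \<open>L\<close>, \<open>part_coll L j\<close> is the same for
  every \<open>j\<close>, so by \<open>row_word_step\<close> the operator i fixes this word, and a
  word fixed by a collapse has no unmatched i + 1.\<close>

lemma opens_full_coll:
  assumes T: "tableau T" "length T = L" "\<And>r. r < L \<Longrightarrow> set (T ! r) \<subseteq> {1..L}" and i: "1 \<le> i" "i < L"
  shows "opens i (row_word (full_coll L) T L) = 0"
proof -
  have e: "row_word (part_coll L j) T L = row_word (full_coll L) T L" for j
    by (intro row_word_cong) (use T(3) in \<open>fastforce simp: part_coll_def full_coll_def\<close>)
  have "rematch i 0 (row_word (part_coll L (Suc i)) T L) = row_word (part_coll L i) T L"
    by (rule row_word_step[OF T(1)]) (use T i in auto)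
  then have "rematch i 0 (row_word (full_coll L) T L) = row_word (full_coll L) T L" unfolding e .
  then show ?thesis using opens_rematch[of 0 i "row_word (full_coll L) T L"] by simp
qed

lemma length_rows:
  assumes "tableau T" "length T = L" "\<And>r. r < L \<Longrightarrow> set (T ! r) \<subseteq> {1..L}" "r < L"
    and "knuth y (row_word (full_coll L) T L)"
  shows "cnt y (Suc r) = length (T ! r)"
proof -
  have "cnt y (Suc r) = cnt (row_word (full_coll L) T L) (Suc r)"
    using knuth_mset[OF assms(5)] by simp
  also have "\<dots> = length (filter (\<lambda>x. x \<le> L) (T ! r))" using assms(4) by (intro count_full_coll)
  also have "filter (\<lambda>x. x \<le> L) (T ! r) = T ! r" using assms(3)[OF assms(4)] by (auto simp: filter_id_conv)
  finally show ?thesis .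
qed

section \<open>The collapsing bijection\<close>

lemma length_strip: "length (strip e xs) \<le> length xs"
  unfolding strip_def using length_dropWhile_le[of _ "rev xs"] by simp

lemma nth_strip: "i < length (strip e xs) \<Longrightarrow> strip e xs ! i = xs ! i"
  using strip_pad[of xs e] by (metis nth_append)

lemma is_partition_strip:
  assumes "\<And>i j. i \<le> j \<Longrightarrow> j < length xs \<Longrightarrow> xs ! j \<le> xs ! i"
  shows "is_partition (strip 0 xs)"
proof -
  let ?ys = "strip 0 xs"
  have anti: "?ys ! j \<le> ?ys ! i" if "i \<le> j" "j < length ?ys" for i j
    using assms[OF that(1)] that nth_strip[of _ 0 xs] length_strip[of 0 xs] by simp
  moreover have "1 \<le> ?ys ! i" if "i < length ?ys" for i
  proof -
    have ne: "?ys \<noteq> []" using that by auto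
    then have "last ?ys \<noteq> 0" by (rule strip_last)
    moreover have "last ?ys \<le> ?ys ! i" unfolding last_conv_nth[OF ne]
      by (rule anti) (use that in auto)
    ultimately show ?thesis by simp
  qed
  ultimately show ?thesis unfolding is_partition_nth by blast
qed

lemma tableau_length:
  assumes "tableau T" "i \<le> j" "j < length T"
  shows "length (T ! j) \<le> length (T ! i)"
  using assms(2,3)
proof (induction rule: dec_induct)
  case (step m)
  have "length (T ! Suc m) \<le> length (T ! m)"
  proof (rule ccontr)
    assume "\<not> ?thesis"
    then have "length (T ! m) < length (T ! Suc m)" by simp
    then show False using assms(1) step.prems unfolding tableau_def by blast
  qed
  then show ?case using step by simp
qed simp

lemma binmat_strip:
  assumes "N \<in> binmat L n"
  shows "strip {} N \<in> binmat (length (strip {} N)) n"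
  using assms nth_strip[of _ "{}" N] length_strip[of "{}" N] by (auto simp: binmat_def)

lemma cwp_strip: "cwp n (strip {} N) = cwp n N"
  using strip_pad[of N "{}"] cwp_pad by metis

lemma cw_strip: "cw n (strip {} N) = cw n N"
  by (simp add: cw_def cwp_strip)

lemma mset_rrw: "mset (rrw T) = mset (concat T)"
  by (simp add: rrw_def mset_concat rev_map[symmetric])

text \<open>Image and injectivity both need the matrix and the tableau before stripping. Their row
  lengths agree because the collapsed column word is equivalent to the word of row numbers of
  \<open>T\<close>.\<close>

lemma rho_structure:
  assumes mu: "is_partition mu" and M: "M \<in> MLQ mu n"
  defines "L \<equiv> first_part mu"
  obtains T N where "tableau T" "length T = L" "\<And>r. r < L \<Longrightarrow> set (T ! r) \<subseteq> {1..L}"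
    "knuth (cw n M) (rrw T)" "N \<in> binmat L n" "map fst (cwp n N) = map fst (cwp n M)"
    "cw n N = raise_seq (collapse_seq L) (cw n M)" "knuth (cw n N) (row_word (full_coll L) T L)"
    "map card N = map length T" "rho n M = (strip {} N, strip [] T)"
proof -
  have B: "M \<in> binmat L n" using M MLQ_iff[OF mu] unfolding L_def by blast
  then have len: "length M = L" by (simp add: binmat_def)
  obtain T where T: "tableau T" "length T = L" "\<forall>r < L. set (T ! r) \<subseteq> {1..L}" "knuth (cw n M) (rrw T)"
    using ex_tableau[OF set_cw[OF B]] by blast
  let ?N = "rhoN n M"
  have N: "?N \<in> binmat L n" "map fst (cwp n ?N) = map fst (cwp n M)" "cw n ?N = raise_seq (collapse_seq L) (cw n M)"
    using collapse_binmat[OF B order_refl] unfolding rhoN_def len by auto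
  have k: "knuth (cw n ?N) (row_word (full_coll L) T L)"
    using knuth_raise_seq[OF T(4), of "collapse_seq L"] raise_seq_row_word[OF T(1), of L] T(2) N(3) by simp
  have c: "map card ?N = map length T"
  proof (rule nth_equalityI)
    show "length (map card ?N) = length (map length T)" using N(1) T(2) by (simp add: binmat_def)
    fix r assume "r < length (map card ?N)"
    then have r: "r < L" "r < length ?N" using N(1) by (auto simp: binmat_def)
    have "cnt (cw n ?N) (Suc r) = length (T ! r)"
      using T(3) r(1) by (intro length_rows[OF T(1,2) _ _ k]) auto
    then show "map card ?N ! r = map length T ! r" using card_row[OF N(1), of "Suc r"] r T(2) by simp
  qed
  have "recording_tab L (cw n M) = T"
    using knuth_recording_tab[OF T(4)] recording_tab_rrw[OF T(1,2)] T(3) by (metis atLeastAtMost_iff subsetD)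
  then have "rho n M = (strip {} ?N, strip [] T)"
    unfolding rho_def rhoQ_recording_tab[OF B] strip_rows_strip strip_tab_strip by simp
  then show ?thesis using that T N k c by blast
qed

lemma rho_image:
  assumes mu: "is_partition mu" and M: "M \<in> MLQ mu n"
  shows "\<exists>la. is_partition la \<and> rho n M \<in> MLQ0 la n \<times> SSYT (conj_part la) (conj_part mu)"
    and "xmon M = xmon (fst (rho n M))" "maj n M = charge_tab (snd (rho n M))"
proof -
  define L where "L = first_part mu"
  obtain T N where T: "tableau T" "length T = L" "\<And>r. r < L \<Longrightarrow> set (T ! r) \<subseteq> {1..L}"
    "knuth (cw n M) (rrw T)" and N: "N \<in> binmat L n" "map fst (cwp n N) = map fst (cwp n M)"
    "cw n N = raise_seq (collapse_seq L) (cw n M)" "knuth (cw n N) (row_word (full_coll L) T L)"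
    "map card N = map length T" and rho: "rho n M = (strip {} N, strip [] T)"
    by (rule rho_structure[OF mu M, folded L_def]) blast
  have B: "M \<in> binmat L n" "map card M = conj_part mu" using M MLQ_iff[OF mu] unfolding L_def by auto
  let ?N = "strip {} N" and ?T = "strip [] T"
  define cs where "cs = strip 0 (map length T)"
  have csT: "map length ?T = cs" unfolding cs_def by (rule strip_map[symmetric]) simp
  have "finite S" if "S \<in> set N" for S
    using N(1) that by (auto simp: binmat_def in_set_conv_nth intro: finite_subset)
  then have csN: "map card ?N = cs" unfolding cs_def N(5)[symmetric] by (intro strip_map[symmetric]) simp
  have cs: "is_partition cs" unfolding cs_def
    by (rule is_partition_strip) (use tableau_length[OF T(1)] in simp)
  \<comment> \<open>The row sizes of a multiline queue are the conjugate of its partition, so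
    \<open>la\<close> is the conjugate of the common row lengths \<open>cs\<close>.\<close>
  define la where "la = conj_part cs"
  have la: "is_partition la" "conj_part la = cs" unfolding la_def
    using is_partition_conj_part[OF cs] conj_part_conj_part[OF cs] by auto
  have fla: "first_part la = length cs" using la(2) length_conj_part[of la] by simp
  have lN: "length ?N = length cs" using csN by (metis length_map)
  then have NM: "?N \<in> MLQ la n" using binmat_strip[OF N(1)] MLQ_iff[OF la(1)] la(2) csN fla by simp
  have lcs: "length cs \<le> L" using length_strip[of 0 "map length T"] T(2) by (simp add: cs_def)
  have hi0: "opens i (cw n N) = 0" if "1 \<le> i" "i < L" for i
    using knuth_opens[OF N(4)] opens_full_coll[OF T(1-3) that] by simp
  have "maj n ?N = 0"
    using MLQ_maj(1)[OF la(1) NM] refl_charge_eq_0_iff[OF MLQ_maj(2)[OF la(1) NM]] hi0 lcs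
    unfolding fla cw_strip by simp
  then have N0: "?N \<in> MLQ0 la n" using NM by (simp add: MLQ0_def)
  have rT: "rrw ?T = rrw T" using rrw_strip_tab[of T] by (simp add: strip_tab_strip)
  have nthT: "?T ! r = T ! r \<and> r < L" if "r < length ?T" for r
    using that nth_strip[OF that] length_strip[of "[]" T] T(2) by simp
  have mT: "mset (concat ?T) = mset (cw n M)"
  proof -
    show ?thesis using rT knuth_mset[OF T(4)] by (simp add: mset_rrw[symmetric])
  qed
  have "?T \<in> SSYT cs (conj_part mu)"
    unfolding SSYT_def mem_Collect_eq
  proof (intro conjI allI impI ballI)
    show "map length ?T = cs" by (rule csT)
    show "sorted (?T ! r)" if "r < length ?T" for r using nthT[OF that] T(1,2) by (simp add: tableau_def)
    show "?T ! r ! c < ?T ! Suc r ! c" if "Suc r < length ?T \<and> c < length (?T ! Suc r)" for r c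
      using nthT[of r] nthT[of "Suc r"] that T(1,2) by (simp add: tableau_def)
    show "1 \<le> x" if "x \<in> set (concat ?T)" for x
    proof -
      have "x \<in> set (cw n M)" using that mT by (metis set_mset_mset)
      then show ?thesis using set_cw[OF B(1)] by auto
    qed
    show "cnt (concat ?T) i = (if i \<le> length (conj_part mu) then conj_part mu ! (i - 1) else 0)"
      if i: "1 \<le> i" for i
    proof (cases "i \<le> L")
      case True
      have "i - 1 < length M" using True i B(1) by (simp add: binmat_def)
      then have "conj_part mu ! (i - 1) = card (M ! (i - 1))" unfolding B(2)[symmetric] by simp
      then show ?thesis using card_row[OF B(1) i True] mT True by (simp add: L_def)
    next
      case False
      then have "i \<notin> set (cw n M)" using set_cw[OF B(1)] by auto
      then have "cnt (concat ?T) i = 0" unfolding mT by (simp add: count_eq_zero_iff)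
      then show ?thesis using False by (simp add: L_def)
    qed
  qed
  then show "\<exists>la. is_partition la \<and> rho n M \<in> MLQ0 la n \<times> SSYT (conj_part la) (conj_part mu)"
    using la N0 rho by auto
  have "xmon ?N = mset (map fst (cwp n ?N))" by (rule xmon_cwp[OF binmat_strip[OF N(1)]])
  then show "xmon M = xmon (fst (rho n M))" using xmon_cwp[OF B(1)] N(2) rho by (simp add: cwp_strip)
  have "maj n M = refl_charge L (cw n M)" using MLQ_maj(1)[OF mu M] by (simp add: L_def)
  also have "\<dots> = refl_charge L (rrw T)" by (rule knuth_refl_charge[OF T(4)])
  also have "\<dots> = charge_word (rrw T)"
  proof (rule charge_word_eq_refl_charge[symmetric])
    have s: "set (rrw T) \<subseteq> {1..L}" using set_cw[OF B(1)] knuth_mset[OF T(4)] by (metis set_mset_mset)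
    then show "0 \<notin> set (rrw T)" "\<forall>x \<in> set (rrw T). x \<le> L" by auto
    show "cnt (rrw T) (Suc i) \<le> cnt (rrw T) i" if "1 \<le> i" for i
      using MLQ_maj(2)[OF mu M that, of "Suc i"] knuth_mset[OF T(4)] by simp
  qed
  also have "\<dots> = charge_tab (snd (rho n M))" using rho rT by (simp add: charge_tab_def)
  finally show "maj n M = charge_tab (snd (rho n M))" .
qed

lemma rho_inj:
  assumes mu: "is_partition mu" and M: "M \<in> MLQ mu n" "M' \<in> MLQ mu n" and eq: "rho n M = rho n M'"
  shows "M = M'"
proof -
  define L where "L = first_part mu"
  obtain T N where T: "knuth (cw n M) (rrw T)" and N: "N \<in> binmat L n" "map fst (cwp n N) = map fst (cwp n M)"
    "cw n N = raise_seq (collapse_seq L) (cw n M)" and r: "rho n M = (strip {} N, strip [] T)"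
    by (rule rho_structure[OF mu M(1), folded L_def]) blast
  obtain T' N' where T': "knuth (cw n M') (rrw T')" and N': "N' \<in> binmat L n" "map fst (cwp n N') = map fst (cwp n M')"
    "cw n N' = raise_seq (collapse_seq L) (cw n M')" and r': "rho n M' = (strip {} N', strip [] T')"
    by (rule rho_structure[OF mu M(2), folded L_def]) blast
  \<comment> \<open>Both matrices have \<open>L\<close> rows, so stripping has lost no
    information.\<close>
  have "N = N'" using N(1) N'(1) r r' eq by (intro strip_inj[of N N' "{}"]) (auto simp: binmat_def)
  have "rrw T = rrw T'" using r r' eq rrw_strip_tab[of T] rrw_strip_tab[of T'] by (simp add: strip_tab_strip)
  then have "knuth (cw n M) (cw n M')" using T T' knuth_sym knuth_trans by metis
  moreover have "raise_seq (collapse_seq L) (cw n M) = raise_seq (collapse_seq L) (cw n M')"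
    unfolding N(3)[symmetric] N'(3)[symmetric] \<open>N = N'\<close> ..
  ultimately have "cw n M = cw n M'" by (rule raise_seq_inj)
  moreover have "map fst (cwp n M) = map fst (cwp n M')"
    unfolding N(2)[symmetric] N'(2)[symmetric] \<open>N = N'\<close> ..
  ultimately have "cwp n M = cwp n M'" unfolding cw_def by (intro pair_list_eqI)
  moreover have "M \<in> binmat L n" "M' \<in> binmat L n" using M MLQ_iff[OF mu] by (auto simp: L_def)
  ultimately show ?thesis using cwp_inj by blast
qed

lemma rho_surj:
  assumes mu: "is_partition mu" and la: "is_partition la"
    and N0: "N0 \<in> MLQ0 la n" and Q: "Q \<in> SSYT (conj_part la) (conj_part mu)"
  shows "\<exists>M \<in> MLQ mu n. rho n M = (N0, Q)"
proof -
  define L where "L = first_part mu"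
  have cla: "is_partition (conj_part la)" by (rule is_partition_conj_part[OF la])
  have Q1: "map length Q = conj_part la" "\<And>r. r < length Q \<Longrightarrow> sorted (Q ! r)"
    "\<And>r c. Suc r < length Q \<Longrightarrow> c < length (Q ! Suc r) \<Longrightarrow> Q ! r ! c < Q ! Suc r ! c"
    "\<And>x. x \<in> set (concat Q) \<Longrightarrow> 1 \<le> x"
    "\<And>i. 1 \<le> i \<Longrightarrow> cnt (concat Q) i = (if i \<le> L then conj_part mu ! (i - 1) else 0)"
    using Q unfolding SSYT_def by (auto simp: L_def)
  have N1: "N0 \<in> binmat (first_part la) n" "map card N0 = conj_part la" "maj n N0 = 0" "N0 \<in> MLQ la n"
    using N0 MLQ_iff[OF la] by (auto simp: MLQ0_def)
  have lenQ: "length Q = first_part la" using Q1(1) by (metis length_map length_conj_part)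
  have rowlen: "length (Q ! r) = conj_part la ! r" if "r < length Q" for r
    using that unfolding Q1(1)[symmetric] by simp
  have ptQ: "tableau Q"
    unfolding tableau_def
  proof (intro conjI allI impI)
    show "sorted (Q ! r)" if "r < length Q" for r using Q1(2) that .
    show "0 \<notin> set (Q ! r)" if "r < length Q" for r
      using Q1(4)[of 0] nth_mem[OF that] by auto
    show "c < length (Q ! r)" if "Suc r < length Q \<and> c < length (Q ! Suc r)" for r c
    proof -
      have "conj_part la ! Suc r \<le> conj_part la ! r"
        using cla that lenQ unfolding is_partition_nth by simp
      then show ?thesis using that rowlen[of r] rowlen[of "Suc r"] by simp
    qed
    show "Q ! r ! c < Q ! Suc r ! c" if "Suc r < length Q \<and> c < length (Q ! Suc r)" for r c
      using Q1(3) that by blast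
  qed
  have entry: "x \<le> L" if "x \<in> set (concat Q)" for x
  proof (rule ccontr)
    assume "\<not> x \<le> L"
    then have "cnt (concat Q) x = 0" using Q1(5)[of x] by simp
    then show False using that by (simp add: count_eq_zero_iff)
  qed
  have nonemptyQ: "[] \<notin> set Q"
  proof
    assume "[] \<in> set Q"
    then have "0 \<in> set (map length Q)" by force
    then show False using cla unfolding Q1(1) is_partition_def by simp
  qed
  have lQL: "length Q \<le> L"
  proof (rule ccontr)
    assume "\<not> length Q \<le> L"
    then have L: "L < length Q" by simp
    then have "Q ! L \<noteq> []" using nonemptyQ by (metis nth_mem)
    then have "hd (Q ! L) \<in> set (Q ! L)" by simp
    moreover have "hd (Q ! L) \<in> set (concat Q)" using L \<open>hd (Q ! L) \<in> set (Q ! L)\<close> by auto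
    ultimately show False using tableau_entry_ge[OF ptQ L] entry by fastforce
  qed
  \<comment> \<open>Padding restores the \<open>L\<close> rows used by the facts on words; stripping
    returns \<open>Q\<close> and \<open>N0\<close> because a conjugate partition has no zero
    part.\<close>
  define T where "T = Q @ replicate (L - length Q) []"
  define N where "N = N0 @ replicate (L - length Q) {}"
  have lenT: "length T = L" using lQL by (simp add: T_def)
  have lN0: "length N0 = length Q" using N1(1) lenQ by (simp add: binmat_def)
  have nthT: "T ! r = (if r < length Q then Q ! r else [])" if "r < L" for r
    using that by (simp add: T_def nth_append)
  have nthN: "N ! r = (if r < length Q then N0 ! r else {})" if "r < L" for r
    using that by (simp add: N_def nth_append lN0)
  have ptT: "tableau T"
    unfolding tableau_def
  proof (intro conjI allI impI)
    fix r assume "r < length T"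
    then show "sorted (T ! r)" "0 \<notin> set (T ! r)"
      using nthT[of r] lenT ptQ by (auto simp: tableau_def)
  next
    fix r c assume a: "Suc r < length T \<and> c < length (T ! Suc r)"
    then have "Suc r < length Q" using nthT[of "Suc r"] lenT by (auto split: if_splits)
    then show "c < length (T ! r)" "T ! r ! c < T ! Suc r ! c"
      using a ptQ lenT nthT[of r] nthT[of "Suc r"] by (auto simp: tableau_def)
  qed
  have Tsub: "set (T ! r) \<subseteq> {1..L}" if "r < L" for r
  proof -
    have "set (T ! r) \<subseteq> set (concat Q)"
    proof (cases "r < length Q")
      case True
      then have "T ! r \<in> set Q" using nthT[OF that] by simp
      then show ?thesis unfolding set_concat by blast
    next
      case False
      then show ?thesis using nthT[OF that] by simp
    qed
    moreover have "set (concat Q) \<subseteq> {1..L}"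
    proof
      fix x assume "x \<in> set (concat Q)"
      then show "x \<in> {1..L}" using entry[of x] Q1(4)[of x] by simp
    qed
    ultimately show ?thesis by (rule subset_trans)
  qed
  have NB: "N \<in> binmat L n" 
    unfolding binmat_def mem_Collect_eq
  proof (intro conjI allI impI)
    show "length N = L" using lQL lN0 by (simp add: N_def)
    fix r assume "r < L"
    then show "N ! r \<subseteq> {1..n}" using nthN[of r] N1(1) lenQ by (auto simp: binmat_def)
  qed
  let ?y = "cw n N"
  have yN0: "?y = cw n N0" by (simp add: cw_def N_def cwp_pad)
  have hi0: "opens i ?y = 0" if i: "1 \<le> i" "i < L" for i
  proof (cases "i < first_part la")
    case True
    have "refl_charge (first_part la) ?y = 0" using MLQ_maj(1)[OF la N1(4)] N1(3) yN0 by simp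
    then show ?thesis using refl_charge_eq_0_iff[OF MLQ_maj(2)[OF la N1(4)]] True i yN0 by simp
  next
    case False
    then have "Suc i \<notin> set ?y" using set_cw[OF N1(1)] yN0 by auto
    then have "cnt ?y (Suc i) = 0" by (simp add: count_eq_zero_iff)
    then show ?thesis using opens_le_count[of i ?y] by linarith
  qed
  have fix_y: "raise_seq is ?y = ?y" if "\<forall>i \<in> set is. 1 \<le> i \<and> i < L" for "is"
    using that
  proof (induction "is")
    case (Cons i "is")
    then have "raise_seq (i # is) ?y = rematch i (opens i ?y) ?y" using hi0 by simp
    then show ?case by simp
  qed simp
  have idx: "\<forall>i \<in> set (collapse_seq L). 1 \<le> i \<and> i < L" using set_collapse_seq by blast
  \<comment> \<open>Nothing links \<open>Q\<close> to \<open>?y\<close> yet. A tableau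
    \<open>T2\<close> equivalent to \<open>?y\<close> collapses to its word of row numbers, which is
    equivalent to \<open>?y\<close> since the collapse fixes \<open>?y\<close>. That word depends on
    row lengths only, and these agree for \<open>T2\<close> and \<open>T\<close>, so
    \<open>?y\<close> is also equivalent to the collapse of \<open>T\<close>.\<close>
  obtain T2 where T2: "tableau T2" "length T2 = L" "\<forall>r < L. set (T2 ! r) \<subseteq> {1..L}" "knuth ?y (rrw T2)"
    using ex_tableau[OF set_cw[OF NB]] by blast
  have "knuth (raise_seq (collapse_seq L) ?y) (raise_seq (collapse_seq L) (rrw T2))" by (rule knuth_raise_seq[OF T2(4)])
  then have k2: "knuth ?y (row_word (full_coll L) T2 L)"
    using fix_y[OF idx] raise_seq_row_word[OF T2(1), of L] T2(2) by simp
  have lens: "length (T2 ! r) = length (T ! r)" if r: "r < L" for r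
  proof -
    have "length (T2 ! r) = cnt ?y (Suc r)"
      using T2(3) r by (intro length_rows[OF T2(1,2) _ _ k2, symmetric]) auto
    also have "\<dots> = card (N ! r)" using card_row[OF NB, of "Suc r"] r by simp
    also have "\<dots> = length (T ! r)"
    proof (cases "r < length Q")
      case True
      then have "card (N0 ! r) = conj_part la ! r" using lN0 unfolding N1(2)[symmetric] by simp
      then show ?thesis using nthN[OF r] nthT[OF r] rowlen[OF True] True by simp
    next
      case False
      then show ?thesis using nthN[OF r] nthT[OF r] by simp
    qed
    finally show ?thesis .
  qed
  have "row_word (full_coll L) T2 L = row_word (\<lambda>r x. Suc r) T2 L"
    by (rule full_coll_rows, rule subset_trans[OF T2(3)[rule_format]]) auto
  also have "\<dots> = row_word (\<lambda>r x. Suc r) T L" by (rule row_word_lengths) (rule lens)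
  also have "\<dots> = row_word (full_coll L) T L"
    by (rule full_coll_rows[symmetric], rule subset_trans[OF Tsub]) auto
  also have "\<dots> = raise_seq (collapse_seq L) (rrw T)" using raise_seq_row_word[OF ptT, of L] lenT by simp
  finally have "knuth ?y (raise_seq (collapse_seq L) (rrw T))" using k2 by simp
  from raise_seq_lift_binmat[OF NB this idx] obtain M where M: "M \<in> binmat L n"
    "map fst (cwp n M) = map fst (cwp n N)" "raise_seq (collapse_seq L) (cw n M) = ?y" "knuth (cw n M) (rrw T)" by blast
  have rT: "rrw T = rrw Q" by (simp add: T_def rrw_pad)
  have mM: "mset (cw n M) = mset (concat Q)"
    using knuth_mset[OF M(4)] unfolding rT mset_rrw .
  have lM: "length M = L" using M(1) by (simp add: binmat_def)
  have "map card M = conj_part mu"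
  proof (rule nth_equalityI)
    fix r assume "r < length (map card M)"
    then have r: "r < L" using lM by simp
    then show "map card M ! r = conj_part mu ! r"
      using card_row[OF M(1), of "Suc r"] mM Q1(5)[of "Suc r"] lM by simp
  qed (simp add: lM L_def)
  then have MM: "M \<in> MLQ mu n" using MLQ_iff[OF mu] M(1) by (simp add: L_def)
  have cl: "rhoN n M \<in> binmat L n" "map fst (cwp n (rhoN n M)) = map fst (cwp n M)"
    "cw n (rhoN n M) = raise_seq (collapse_seq L) (cw n M)"
    using collapse_binmat[OF M(1) order_refl] unfolding rhoN_def lM by auto
  have "cwp n (rhoN n M) = cwp n N"
    by (rule pair_list_eqI) (use cl M in \<open>simp_all add: cw_def\<close>)
  then have "rhoN n M = N" using cwp_inj cl(1) NB by blast
  moreover have "{} \<notin> set N0"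
  proof
    assume "{} \<in> set N0"
    then have "0 \<in> set (map card N0)" by force
    then show False using cla unfolding N1(2) is_partition_def by simp
  qed
  ultimately have "strip_rows (rhoN n M) = N0" unfolding strip_rows_strip N_def by (simp add: strip_append)
  moreover have "recording_tab L (cw n M) = T"
    using knuth_recording_tab[OF M(4)] recording_tab_rrw[OF ptT lenT] Tsub by (metis atLeastAtMost_iff subsetD)
  then have "rhoQ n M = Q"
    using nonemptyQ unfolding rhoQ_recording_tab[OF M(1)] strip_tab_strip by (simp add: T_def strip_append)
  ultimately show ?thesis using MM by (auto simp: rho_def)
qed

theorem theorem4p20:
  fixes mu :: "nat list" and n :: nat
  assumes "is_partition mu" and "0 < n" and "length mu \<le> n"
  shows "bij_betw (rho n) (MLQ mu n)
           (\<Union>la \<in> {la. is_partition la}. MLQ0 la n \<times> SSYT (conj_part la) (conj_part mu))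
         \<and> (\<forall>M \<in> MLQ mu n. xmon M = xmon (fst (rho n M))
                          \<and> maj n M = charge_tab (snd (rho n M)))"
proof (intro conjI ballI)
  show "bij_betw (rho n) (MLQ mu n)
      (\<Union>la \<in> {la. is_partition la}. MLQ0 la n \<times> SSYT (conj_part la) (conj_part mu))"
    unfolding bij_betw_def
  proof (intro conjI subset_antisym subsetI)
    show "inj_on (rho n) (MLQ mu n)"
      using rho_inj[OF assms(1)] by (intro inj_onI) blast
  next
    fix p assume "p \<in> rho n ` MLQ mu n"
    then obtain M where M: "M \<in> MLQ mu n" "p = rho n M" by (rule imageE)
    obtain la where "is_partition la" "p \<in> MLQ0 la n \<times> SSYT (conj_part la) (conj_part mu)"
      using rho_image(1)[OF assms(1) M(1)] unfolding M(2) by (elim exE conjE)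
    then show "p \<in> (\<Union>la \<in> {la. is_partition la}. MLQ0 la n \<times> SSYT (conj_part la) (conj_part mu))"
      by (intro UN_I[of la]) simp_all
  next
    fix p assume "p \<in> (\<Union>la \<in> {la. is_partition la}. MLQ0 la n \<times> SSYT (conj_part la) (conj_part mu))"
    then obtain la N Q where "is_partition la" "N \<in> MLQ0 la n" "Q \<in> SSYT (conj_part la) (conj_part mu)" "p = (N, Q)"
      by blast
    then obtain M where "M \<in> MLQ mu n" "rho n M = p" using rho_surj[OF assms(1)] by metis
    then show "p \<in> rho n ` MLQ mu n" by (intro image_eqI[of p "rho n" M]) simp_all
  qed
next
  fix M assume M: "M \<in> MLQ mu n"
  show "xmon M = xmon (fst (rho n M))" by (rule rho_image(2)[OF assms(1) M])
  show "maj n M = charge_tab (snd (rho n M))" by (rule rho_image(3)[OF assms(1) M])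
qed

end
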